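(* Let $G$ be a finite group and suppose $G=G_1G_2\cdots G_n$, where $G_1,\dots,G_n$ are pairwise totally permutable subgroups of $G$. Let $\Gamma(G)$ denote the graph with vertex set $\pi(G)$ and edge set $\{(p,q)\mid p,q\in\pi(G),\ q\in\pi(p-1)\}$. Then $$\Gamma_s(G)\subseteq\bigcup_{i=1}^n\Gamma_s(G_i)\cup\Gamma(G),\quad \Gamma_H(G)\subseteq\bigcup_{i=1}^n\Gamma_H(G_i)\cup\Gamma(G),\quad \Gamma_{Nc}(G)\subseteq\bigcup_{i=1}^n\Gamma_{Nc}(G_i)\cup\Gamma(G).$$
   Context: All groups are finite; $\pi(G)$ denotes the set of prime divisors of $|G|$, and $\pi(n)$ the set of prime divisors of an integer $n$. Graphs are directed: a graph $\Gamma$ consists of a vertex set $V(\Gamma)$ and an edge set $E(\Gamma)$ of ordered pairs of vertices. The union of graphs takes the union of vertex sets and of edge sets; $\Gamma_1\subseteq\Gamma_2$ means $V(\Gamma_1)\subseteq V(\Gamma_2)$ and $E(\Gamma_1)\subseteq E(\Gamma_2)$. $O_{p',p}(G)$ is the largest normal $p$-nilpotent subgroup of $G$. The Hawkes graph $\Gamma_H(G)$ has vertex set $\pi(G)$ and an edge $(p,q)$ whenever $q\in\pi(G/O_{p',p}(G))$. The Sylow graph $\Gamma_s(G)$ has vertex set $\pi(G)$ and an edge $(p,q)$ whenever $q\in\pi(N_G(P)/PC_G(P))$ for some Sylow $p$-subgroup $P$ of $G$. A Schmidt group is a non-nilpotent group all of whose proper subgroups are nilpotent; a Schmidt $(p,q)$-group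 is a Schmidt group $S$ with $\pi(S)=\{p,q\}$ and a normal Sylow $p$-subgroup. The $N$-critical graph $\Gamma_{Nc}(G)$ has vertex set $\pi(G)$ and an edge $(p,q)$ whenever $G$ contains a Schmidt $(p,q)$-subgroup. Subgroups $H$ and $K$ are totally permutable if every subgroup of $H$ permutes with every subgroup of $K$; "pairwise totally permutable" means $G_i$ and $G_j$ are totally permutable for all $i\neq j$. *)

theory Defs
  imports "HOL-Algebra.Algebra" "HOL-Computational_Algebra.Primes"
begin

definition prime_set :: "('a, 'b) monoid_scheme \<Rightarrow> nat set" where
  "prime_set G = {p. Factorial_Ring.prime p \<and> p dvd order G}"

definition prime_divs :: "nat \<Rightarrow> nat set" where
  "prime_divs n = {p. Factorial_Ring.prime p \<and> p dvd n}"

definition centralizer :: "('a, 'b) monoid_scheme \<Rightarrow> 'a set \<Rightarrow> 'a set" where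
  "centralizer G H = {g \<in> carrier G. \<forall>h\<in>H. g \<otimes>\<^bsub>G\<^esub> h = h \<otimes>\<^bsub>G\<^esub> g}"

definition sylow_subgroup :: "('a, 'b) monoid_scheme \<Rightarrow> nat \<Rightarrow> 'a set \<Rightarrow> bool" where
  "sylow_subgroup G p P \<longleftrightarrow> subgroup P G \<and> card P = p ^ multiplicity p (order G)"

definition comm_set :: "('a, 'b) monoid_scheme \<Rightarrow> 'a set \<Rightarrow> 'a set \<Rightarrow> 'a set" where
  "comm_set G H K = (\<Union>h\<in>H. \<Union>k\<in>K.
     {h \<otimes>\<^bsub>G\<^esub> k \<otimes>\<^bsub>G\<^esub> inv\<^bsub>G\<^esub> h \<otimes>\<^bsub>G\<^esub> inv\<^bsub>G\<^esub> k})"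

fun lower_central :: "('a, 'b) monoid_scheme \<Rightarrow> nat \<Rightarrow> 'a set" where
  "lower_central G 0 = carrier G"
| "lower_central G (Suc n) = generate G (comm_set G (lower_central G n) (carrier G))"

definition nilpotent :: "('a, 'b) monoid_scheme \<Rightarrow> bool" where
  "nilpotent G \<longleftrightarrow> (\<exists>n. lower_central G n = {\<one>\<^bsub>G\<^esub>})"

definition p_nilpotent :: "('a, 'b) monoid_scheme \<Rightarrow> nat \<Rightarrow> bool" where
  "p_nilpotent G p \<longleftrightarrow> (\<exists>K. K \<lhd> G \<and> \<not> p dvd card K \<and> (\<exists>k. order G = card K * p ^ k))"

definition O_pp :: "('a, 'b) monoid_scheme \<Rightarrow> nat \<Rightarrow> 'a set" where
  "O_pp G p = (THE N. N \<lhd> G \<and> p_nilpotent (G\<lparr>carrier := N\<rparr>) p \<and>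
      (\<forall>M. M \<lhd> G \<and> p_nilpotent (G\<lparr>carrier := M\<rparr>) p \<longrightarrow> M \<subseteq> N))"

definition schmidt_group :: "('a, 'b) monoid_scheme \<Rightarrow> bool" where
  "schmidt_group S \<longleftrightarrow> \<not> nilpotent S \<and>
     (\<forall>H. subgroup H S \<and> H \<noteq> carrier S \<longrightarrow> nilpotent (S\<lparr>carrier := H\<rparr>))"

definition schmidt_pq_group :: "('a, 'b) monoid_scheme \<Rightarrow> nat \<Rightarrow> nat \<Rightarrow> bool" where
  "schmidt_pq_group S p q \<longleftrightarrow> schmidt_group S \<and> prime_set S = {p, q} \<and>
     (\<exists>P. sylow_subgroup S p P \<and> P \<lhd> S)"

definition totally_permutable :: "('a, 'b) monoid_scheme \<Rightarrow> 'a set \<Rightarrow> 'a set \<Rightarrow> bool" where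
  "totally_permutable G H K \<longleftrightarrow> (\<forall>A B. subgroup A G \<and> A \<subseteq> H \<and> subgroup B G \<and> B \<subseteq> K \<longrightarrow>
      A <#>\<^bsub>G\<^esub> B = B <#>\<^bsub>G\<^esub> A)"

fun prod_sets :: "('a, 'b) monoid_scheme \<Rightarrow> (nat \<Rightarrow> 'a set) \<Rightarrow> nat \<Rightarrow> 'a set" where
  "prod_sets G Gs 0 = {\<one>\<^bsub>G\<^esub>}"
| "prod_sets G Gs (Suc n) = prod_sets G Gs n <#>\<^bsub>G\<^esub> Gs n"

type_synonym graph = "nat set \<times> (nat \<times> nat) set"

definition subgraph :: "graph \<Rightarrow> graph \<Rightarrow> bool" where
  "subgraph A B \<longleftrightarrow> fst A \<subseteq> fst B \<and> snd A \<subseteq> snd B"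

definition graph_union :: "graph \<Rightarrow> graph \<Rightarrow> graph" where
  "graph_union A B = (fst A \<union> fst B, snd A \<union> snd B)"

definition graph_Union :: "'i set \<Rightarrow> ('i \<Rightarrow> graph) \<Rightarrow> graph" where
  "graph_Union I f = ((\<Union>i\<in>I. fst (f i)), (\<Union>i\<in>I. snd (f i)))"

definition hawkes_graph :: "('a, 'b) monoid_scheme \<Rightarrow> graph" where
  "hawkes_graph G = (prime_set G,
     {(p, q). p \<in> prime_set G \<and> q \<in> prime_divs (order G div card (O_pp G p))})"

text \<open>Sylow graph; pi(N_G(P)/PC_G(P)) via the order |N_G(P)| / |P C_G(P)|\<close>
definition sylow_graph :: "('a, 'b) monoid_scheme \<Rightarrow> graph" where
  "sylow_graph G = (prime_set G,
     {(p, q). p \<in> prime_set G \<and> (\<exists>P. sylow_subgroup G p P \<and>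
        q \<in> prime_divs (card (normalizer G P) div card (P <#>\<^bsub>G\<^esub> centralizer G P)))})"

definition ncrit_graph :: "('a, 'b) monoid_scheme \<Rightarrow> graph" where
  "ncrit_graph G = (prime_set G,
     {(p, q). p \<in> prime_set G \<and> q \<in> prime_set G \<and>
        (\<exists>S. subgroup S G \<and> schmidt_pq_group (G\<lparr>carrier := S\<rparr>) p q)})"

definition pm1_graph :: "('a, 'b) monoid_scheme \<Rightarrow> graph" where
  "pm1_graph G = (prime_set G,
     {(p, q). p \<in> prime_set G \<and> q \<in> prime_set G \<and> q \<in> prime_divs (p - 1)})"

end

theory Submission
  imports Defs "HOL-Number_Theory.Residues"
begin

text \<open>
  The key fact is that for totally permutable \<open>A\<close> and \<open>B\<close> every commutator of two elements of \<open>A\<close>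
  of prime power orders for distinct primes centralises \<open>B\<close>. It comes from two observations: an
  element of \<open>B\<close> of order a power of \<open>q\<close> normalises \<open>\<langle>a\<rangle>\<close> whenever \<open>a \<in> A\<close> has order a power of a
  prime \<open>p > q\<close>, and automorphisms of a cyclic group commute. Consequently the nilpotent residuals
  \<open>R\<^sub>i\<close> of the factors are normal in \<open>G\<close>, and \<open>G\<close> acts on \<open>R\<^sub>i\<close> as \<open>G\<^sub>i\<close> does.

  Let \<open>q\<close> not divide \<open>p - 1\<close>. Modulo \<open>R = R\<^sub>1 \<cdots> R\<^sub>n\<close> the factors are nilpotent; descending through the
  primes from the largest one, and using the transfer into a central Sylow subgroup, the normal
  subgroup generated by the \<open>q\<close>-elements is seen to have order prime to \<open>p\<close> there (if \<open>p = q\<close>, this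
  holds for the subgroup generated by its \<open>p'\<close>-elements). So whatever produces an edge \<open>(p, q)\<close> lies
  inside \<open>R\<close>, and it is detected in one of the \<open>R\<^sub>i\<close>, on which \<open>G\<^sub>i\<close> induces the same automorphisms.
\<close>

text \<open>Total permutability is used on pairs of cyclic subgroups, so the proof works with
  elements of prime power order. Counting cosets in <a><b> controls the action of b on <a> only if b
  belongs to the smaller prime. Hence the key fact splits by the position of the prime of b relative
  to the other two, and equal primes are the hardest cases.

  An edge (p, q) of the Sylow or N-critical graph is a q-element that normalises but does not
  centralise a p-subgroup; this forces p and q to differ. An edge of the Hawkes graph is a
  nontrivial p-element of O^p(O^{q'}(G)), which covers loops as well.

  That q does not divide p - 1 acts at one place: the automorphism that a q-element induces on a
  subgroup of order p has order dividing both a power of q and p - 1.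

  Two obstacles shape the last steps. The R_i may overlap in central elements, so components of an
  element of R and the element of G_i that imitates a given element of G are not unique; both are
  treated as relations. For the Sylow graph the imitating element need not normalise a Sylow
  subgroup of G_i and has to be corrected.\<close>

hide_const (open) Divisibility.prime

section \<open>Elements of prime power order\<close>

text \<open>An annihilating exponent in place of the order of \<open>x\<close> makes stability under
  powers, conjugation, homomorphisms and change of the carrier immediate. \<open>pp_elem\<close>
  does the same for p'-elements.\<close>

definition p_elem :: "('a, 'b) monoid_scheme \<Rightarrow> nat \<Rightarrow> 'a \<Rightarrow> bool" where
  "p_elem G p x \<longleftrightarrow> x \<in> carrier G \<and> (\<exists>k::nat. x [^]\<^bsub>G\<^esub> (p ^ k) = \<one>\<^bsub>G\<^esub>)"

definition pp_elem :: "('a, 'b) monoid_scheme \<Rightarrow> nat \<Rightarrow> 'a \<Rightarrow> bool" where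
  "pp_elem G p x \<longleftrightarrow> x \<in> carrier G \<and> (\<exists>m::nat. coprime m p \<and> x [^]\<^bsub>G\<^esub> m = \<one>\<^bsub>G\<^esub>)"

lemma prime_power_if_only_prime_divisor:
  fixes n p :: nat
  assumes "n > 0" "prime p" "\<And>q. prime q \<Longrightarrow> q dvd n \<Longrightarrow> q = p"
  shows "\<exists>k. n = p ^ k"
proof -
  obtain c where c: "n = p ^ multiplicity p n * c" "\<not> p dvd c"
    using assms(1,2) by (metis less_not_refl multiplicity_decompose' not_prime_unit)
  have "c = 1"
  proof (rule ccontr)
    assume "c \<noteq> 1"
    then obtain q where "prime q" "q dvd c"
      using prime_factor_nat by blast
    then show False using assms(3)[of q] c by (metis dvd_mult)
  qed
  then show ?thesis using c by auto
qed

lemma not_dvd_div_iff_multiplicity: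
  fixes k n p :: nat
  assumes "k > 0" "n > 0" "k dvd n" "prime p"
  shows "\<not> p dvd n div k \<longleftrightarrow> multiplicity p k = multiplicity p n"
proof -
  obtain c where c: "n = k * c" using assms(3) by blast
  then have "c > 0" using assms(2) by (metis gr0I mult_0_right)
  then have "multiplicity p n = multiplicity p k + multiplicity p c"
    using c assms by (simp add: prime_elem_multiplicity_mult_distrib)
  moreover have "\<not> p dvd c \<longleftrightarrow> multiplicity p c = 0"
    using \<open>c > 0\<close> assms(4) by (metis multiplicity_eq_zero_iff not_prime_unit less_not_refl)
  ultimately show ?thesis using c assms(1) by simp
qed

lemma (in group) inv_cancel_left [simp]:
  assumes "x \<in> carrier G" "y \<in> carrier G"
  shows "x \<otimes> (inv x \<otimes> y) = y" "inv x \<otimes> (x \<otimes> y) = y"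
  using assms by (simp_all flip: m_assoc)

lemmas (in group) grp_word = m_assoc inv_mult_group

abbreviation (in group) conj :: "'a \<Rightarrow> 'a \<Rightarrow> 'a" where
  "conj g x \<equiv> g \<otimes> x \<otimes> inv g"

abbreviation (in group) comm :: "'a \<Rightarrow> 'a \<Rightarrow> 'a" where
  "comm x y \<equiv> x \<otimes> y \<otimes> inv x \<otimes> inv y"

lemma (in group) conj_hom: "g \<in> carrier G \<Longrightarrow> group_hom G G (\<lambda>x. conj g x)"
  by unfold_locales (auto simp: hom_def grp_word)

lemma (in group) conj_conj: "g \<in> carrier G \<Longrightarrow> h \<in> carrier G \<Longrightarrow> x \<in> carrier G \<Longrightarrow> conj g (conj h x) = conj (g \<otimes> h) x"
  by (simp add: grp_word)

lemma (in group) conj_inj_on: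
  assumes g: "g \<in> carrier G" and S: "S \<subseteq> carrier G"
  shows "inj_on (conj g) S"
proof (rule inj_onI)
  fix x y assume "x \<in> S" "y \<in> S" "conj g x = conj g y"
  then show "x = y" using g S by (simp add: subset_iff)
qed

lemma (in group) conj_nat_pow:
  "g \<in> carrier G \<Longrightarrow> x \<in> carrier G \<Longrightarrow> conj g x [^] (n::nat) = conj g (x [^] n)"
  using group_hom.hom_nat_pow[OF conj_hom] by metis

lemma (in group) conj_int_pow:
  "g \<in> carrier G \<Longrightarrow> x \<in> carrier G \<Longrightarrow> conj g x [^] (n::int) = conj g (x [^] n)"
  using group_hom.hom_int_pow[OF conj_hom] by metis

lemma (in group) conj_eq_iff_comm:
  assumes "g \<in> carrier G" "x \<in> carrier G"
  shows "conj g x = x \<longleftrightarrow> g \<otimes> x = x \<otimes> g" "comm g x = \<one> \<longleftrightarrow> g \<otimes> x = x \<otimes> g"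
proof -
  have "conj g x = x \<longleftrightarrow> conj g x \<otimes> g = x \<otimes> g"
    using assms right_cancel[of g "conj g x" x] by simp
  then show 1: "conj g x = x \<longleftrightarrow> g \<otimes> x = x \<otimes> g" using assms by (simp add: m_assoc)
  have "comm g x = \<one> \<longleftrightarrow> comm g x \<otimes> x = \<one> \<otimes> x"
    using assms right_cancel[of x "comm g x" \<one>] by simp
  then show "comm g x = \<one> \<longleftrightarrow> g \<otimes> x = x \<otimes> g" using assms 1 by (simp add: m_assoc)
qed

lemma (in group) commutes_inv:
  assumes "x \<in> carrier G" "y \<in> carrier G" "x \<otimes> y = y \<otimes> x"
  shows "x \<otimes> inv y = inv y \<otimes> x" "inv x \<otimes> y = y \<otimes> inv x" "inv x \<otimes> inv y = inv y \<otimes> inv x"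
proof -
  have 1: "a \<otimes> inv b = inv b \<otimes> a" if "a \<in> carrier G" "b \<in> carrier G" "a \<otimes> b = b \<otimes> a" for a b
  proof -
    have "a \<otimes> inv b = inv b \<otimes> (b \<otimes> a) \<otimes> inv b" using that(1,2) by (simp add: m_assoc)
    also have "\<dots> = inv b \<otimes> (a \<otimes> b) \<otimes> inv b" using that(3) by simp
    also have "\<dots> = inv b \<otimes> a" using that(1,2) by (simp add: m_assoc)
    finally show ?thesis .
  qed
  show "x \<otimes> inv y = inv y \<otimes> x" using 1 assms by blast
  show 2: "inv x \<otimes> y = y \<otimes> inv x" using 1[of y x] assms by simp
  show "inv x \<otimes> inv y = inv y \<otimes> inv x" using 1[of "inv x" y] 2 assms by simp
qed

lemma set_multI: "a \<in> A \<Longrightarrow> b \<in> B \<Longrightarrow> a \<otimes>\<^bsub>G\<^esub> b \<in> A <#>\<^bsub>G\<^esub> B"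
  unfolding set_mult_def by blast

lemma set_multE:
  assumes "x \<in> A <#>\<^bsub>G\<^esub> B"
  obtains a b where "a \<in> A" "b \<in> B" "x = a \<otimes>\<^bsub>G\<^esub> b"
  using assms unfolding set_mult_def by blast

lemma (in group) set_mult_permute_subgroup:
  assumes "subgroup A G" "subgroup B G" "A <#> B = B <#> A"
  shows "subgroup (A <#> B) G"
proof (rule subgroupI)
  interpret A: subgroup A G by fact
  interpret B: subgroup B G by fact
  show "A <#> B \<subseteq> carrier G" by (simp add: A.subset B.subset setmult_subset_G)
  have "\<one> \<otimes> \<one> \<in> A <#> B" using A.one_closed B.one_closed unfolding set_mult_def by blast
  then show "A <#> B \<noteq> {}" by blast
  fix x assume x: "x \<in> A <#> B"
  then obtain a b where ab: "a \<in> A" "b \<in> B" "x = a \<otimes> b" unfolding set_mult_def by blast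
  have "inv x = inv b \<otimes> inv a" using ab by (simp add: inv_mult_group)
  then have "inv x \<in> B <#> A" using ab unfolding set_mult_def by blast
  then show "inv x \<in> A <#> B" using assms(3) by simp
  fix y assume y: "y \<in> A <#> B"
  then obtain c d where cd: "c \<in> A" "d \<in> B" "y = c \<otimes> d" unfolding set_mult_def by blast
  have "b \<otimes> c \<in> A <#> B" using set_multI[OF ab(2) cd(1)] assms(3) by simp
  then obtain e f where ef: "e \<in> A" "f \<in> B" "b \<otimes> c = e \<otimes> f" unfolding set_mult_def by blast
  have "x \<otimes> y = a \<otimes> (b \<otimes> c) \<otimes> d" using ab cd by (simp add: m_assoc)
  also have "\<dots> = (a \<otimes> e) \<otimes> (f \<otimes> d)" unfolding ef(3) using ab cd ef by (simp add: m_assoc)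
  finally have "x \<otimes> y = (a \<otimes> e) \<otimes> (f \<otimes> d)" .
  moreover have "a \<otimes> e \<in> A" "f \<otimes> d \<in> B" using ab cd ef by simp_all
  ultimately show "x \<otimes> y \<in> A <#> B" unfolding set_mult_def by blast
qed

lemma (in group) set_mult_subset_left:
  assumes "subgroup A G" "subgroup B G"
  shows "A \<subseteq> A <#> B" "B \<subseteq> A <#> B"
proof -
  interpret A: subgroup A G by fact
  interpret B: subgroup B G by fact
  show "A \<subseteq> A <#> B"
  proof
    fix a assume "a \<in> A"
    then have "a = a \<otimes> \<one>" by simp
    then show "a \<in> A <#> B" using \<open>a \<in> A\<close> B.one_closed unfolding set_mult_def by blast
  qed
  show "B \<subseteq> A <#> B"
  proof
    fix a assume "a \<in> B"
    then have "a = \<one> \<otimes> a" by simp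
    then show "a \<in> A <#> B" using \<open>a \<in> B\<close> A.one_closed unfolding set_mult_def by blast
  qed
qed

lemma (in group) set_mult_subset_subgroup:
  assumes "A \<subseteq> H" "B \<subseteq> H" "subgroup H G"
  shows "A <#> B \<subseteq> H"
  using assms subgroup.m_closed[OF assms(3)] unfolding set_mult_def by blast

locale fin_group = group G for G (structure) +
  assumes fin [simp]: "finite (carrier G)"
begin

lemma finite_sub [simp]: "subgroup H G \<Longrightarrow> finite H"
  using finite_subset subgroup.subset fin by metis

lemma card_sub_pos [simp]: "subgroup H G \<Longrightarrow> card H > 0"
  using subgroup.finite_imp_card_positive fin by metis

lemma sub_fin_group: "subgroup H G \<Longrightarrow> fin_group (G\<lparr>carrier := H\<rparr>)"
  by (simp add: fin_group_def fin_group_axioms_def subgroup_imp_group)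

lemma sub_card_dvd:
  assumes "subgroup H G" "subgroup K G" "K \<subseteq> H"
  shows "card K dvd card H"
proof -
  have "subgroup K (G\<lparr>carrier := H\<rparr>)" using assms subgroup_incl by blast
  from group.lagrange[OF subgroup_imp_group[OF assms(1)] this]
  have "card (rcosets\<^bsub>G\<lparr>carrier := H\<rparr>\<^esub> K) * card K = card H" by (simp add: order_def)
  then show ?thesis by (metis dvd_triv_right)
qed

lemma sub_card_dvd_order: "subgroup H G \<Longrightarrow> card H dvd card (carrier G)"
  using sub_card_dvd subgroup_self subgroup.subset by blast

lemma multiplicity_card_mono:
  "subgroup H G \<Longrightarrow> subgroup K G \<Longrightarrow> K \<subseteq> H \<Longrightarrow> multiplicity p (card K) \<le> multiplicity p (card H)"
  using dvd_imp_multiplicity_le sub_card_dvd card_sub_pos by (metis less_not_refl)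

lemma sylow_index:
  assumes p: "prime p" and L: "subgroup L G" and K: "subgroup K G" "K \<subseteq> L"
    and T: "subgroup T G" "T \<subseteq> K" "card T = p ^ multiplicity p (card L)"
  shows "\<not> p dvd card L div card K"
proof -
  have "multiplicity p (card T) = multiplicity p (card L)" using T(3) p by simp
  then show ?thesis
    using multiplicity_card_mono[OF L K, of p] multiplicity_card_mono[OF K(1) T(1,2), of p]
      not_dvd_div_iff_multiplicity[OF card_sub_pos[OF K(1)] card_sub_pos[OF L] sub_card_dvd[OF L K] p] by simp
qed

lemma sylow_intermediate:
  assumes p: "prime p" and L: "subgroup L G" and K: "subgroup K G" "K \<subseteq> L"
    and T: "subgroup T G" "T \<subseteq> K" "card T = p ^ multiplicity p (card L)"
  shows "card T = p ^ multiplicity p (card K)"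
proof -
  have "multiplicity p (card T) = multiplicity p (card L)" using T(3) p by simp
  then have "multiplicity p (card K) = multiplicity p (card L)"
    using multiplicity_card_mono[OF L K, of p] multiplicity_card_mono[OF K(1) T(1,2), of p] by simp
  then show ?thesis using T(3) by simp
qed

lemma p_elem_in_carrier: "p_elem G p x \<Longrightarrow> x \<in> carrier G"
  by (simp add: p_elem_def)

lemma pp_elem_in_carrier: "pp_elem G p x \<Longrightarrow> x \<in> carrier G"
  by (simp add: pp_elem_def)

lemma p_elem_one [simp]: "p_elem G p \<one>"
  by (simp add: p_elem_def)

lemma pp_elem_one [simp]: "pp_elem G p \<one>"
  unfolding pp_elem_def by (metis coprime_1_left nat_pow_one one_closed)

lemma p_elem_conj: "p_elem G p x \<Longrightarrow> g \<in> carrier G \<Longrightarrow> p_elem G p (conj g x)"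
  unfolding p_elem_def using conj_nat_pow by (metis inv_closed m_closed r_inv r_one)

lemma pp_elem_conj: "pp_elem G p x \<Longrightarrow> g \<in> carrier G \<Longrightarrow> pp_elem G p (conj g x)"
  unfolding pp_elem_def using conj_nat_pow by (metis inv_closed m_closed r_inv r_one)

lemma p_elem_inv: "p_elem G p x \<Longrightarrow> p_elem G p (inv x)"
  unfolding p_elem_def by (metis inv_closed inv_one nat_pow_inv)

lemma p_elem_nat_pow: "p_elem G p x \<Longrightarrow> p_elem G p (x [^] (n::nat))"
  unfolding p_elem_def
  by (metis mult.commute nat_pow_closed nat_pow_one nat_pow_pow)

lemma p_elem_int_pow: "p_elem G p x \<Longrightarrow> p_elem G p (x [^] (n::int))"
  by (metis int_pow_def2 p_elem_inv p_elem_nat_pow)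

lemma p_elem_imp_pp_elem:
  assumes "p_elem G q x" "prime p" "prime q" "p \<noteq> q"
  shows "pp_elem G p x"
proof -
  have "coprime (q ^ k) p" for k using assms by (simp add: primes_coprime)
  then show ?thesis using assms(1) unfolding p_elem_def pp_elem_def by blast
qed

lemma pow_eq_one_coprime:
  assumes "x \<in> carrier G" "x [^] (m::nat) = \<one>" "x [^] (n::nat) = \<one>" "coprime m n"
  shows "x = \<one>"
  using assms pow_eq_id ord_eq_1 by (metis coprime_common_divisor_nat)

lemma p_elem_and_pp_elem: "p_elem G p x \<Longrightarrow> pp_elem G p x \<Longrightarrow> x = \<one>"
  unfolding p_elem_def pp_elem_def
  using pow_eq_one_coprime by (metis coprime_commute coprime_power_left_iff power_0_left power_eq_0_iff
      coprime_1_right gr0I power_0)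

lemma p_elem_two_primes:
  assumes "p_elem G q x" "p_elem G p x" "prime p" "prime q" "p \<noteq> q"
  shows "x = \<one>"
  using assms p_elem_imp_pp_elem p_elem_and_pp_elem by blast

lemma p_elem_mult_commuting:
  assumes "p_elem G p x" "p_elem G p y" "x \<otimes> y = y \<otimes> x"
  shows "p_elem G p (x \<otimes> y)"
proof -
  obtain k l where kl: "x [^] (p ^ k) = \<one>" "y [^] (p ^ l) = \<one>" and c: "x \<in> carrier G" "y \<in> carrier G"
    using assms unfolding p_elem_def by blast
  have "x [^] (p ^ (k + l)) = \<one>" "y [^] (p ^ (k + l)) = \<one>"
    using kl c by (metis nat_pow_one nat_pow_pow power_add, metis nat_pow_one nat_pow_pow power_add mult.commute)
  then have "(x \<otimes> y) [^] (p ^ (k + l)) = \<one>"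
    using pow_mult_distrib[OF assms(3) c] by simp
  then show ?thesis unfolding p_elem_def using c by blast
qed

lemma pp_elem_mult_commuting:
  assumes "pp_elem G p x" "pp_elem G p y" "x \<otimes> y = y \<otimes> x"
  shows "pp_elem G p (x \<otimes> y)"
proof -
  obtain k l where kl: "x [^] k = \<one>" "y [^] l = \<one>" "coprime k p" "coprime l p"
    and c: "x \<in> carrier G" "y \<in> carrier G"
    using assms unfolding pp_elem_def by blast
  have "x [^] (k * l) = \<one>" "y [^] (k * l) = \<one>"
    using kl c by (metis nat_pow_one nat_pow_pow, metis nat_pow_one nat_pow_pow mult.commute)
  then have "(x \<otimes> y) [^] (k * l) = \<one>"
    using pow_mult_distrib[OF assms(3) c] by simp
  moreover have "coprime (k * l) p" using kl by simp
  ultimately show ?thesis unfolding pp_elem_def using c by blast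
qed

lemma pp_elem_inv: "pp_elem G p x \<Longrightarrow> pp_elem G p (inv x)"
  unfolding pp_elem_def by (metis inv_closed inv_one nat_pow_inv)

text \<open>Chinese remainder: an exponent that is 1 modulo the p-part of |G| and 0 modulo the
  p'-part sends each element to its p-part. It is the same for all elements, so it can be applied to
  both sides of a relation between elements, as in \<open>acts_p_elem\<close>.\<close>

lemma p_part_exponent:
  assumes p: "prime p"
  obtains m :: nat where "\<And>x. x \<in> carrier G \<Longrightarrow> p_elem G p (x [^] m)"
    "\<And>x. p_elem G p x \<Longrightarrow> x [^] m = x" "\<And>x. pp_elem G p x \<Longrightarrow> x [^] m = \<one>"
    "\<And>x. x \<in> carrier G \<Longrightarrow> pp_elem G p (x \<otimes> inv (x [^] m))"
proof -
  let ?n = "card (carrier G)"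
  have n: "?n > 0" using card_sub_pos[OF subgroup_self] .
  obtain c where c: "?n = p ^ multiplicity p ?n * c" "\<not> p dvd c"
    using n p by (metis less_not_refl multiplicity_decompose' not_prime_unit)
  let ?a = "multiplicity p ?n"
  have "coprime c (p ^ ?a)" using c p by (metis coprime_commute coprime_power_right_iff prime_imp_coprime)
  then obtain y where y: "[c * y = 1] (mod p ^ ?a)" using cong_solve_coprime_nat[of c "p ^ ?a"] by (metis One_nat_def)
  have ordn: "x [^] ?n = \<one>" if "x \<in> carrier G" for x
    using pow_order_eq_1[OF that] by (simp add: order_def)
  show ?thesis
  proof
    fix x assume x: "x \<in> carrier G"
    have "c * y * p ^ ?a = ?n * y" using c(1) by (metis mult.assoc mult.commute)
    then have "(x [^] (c * y)) [^] (p ^ ?a) = (x [^] ?n) [^] y"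
      using x by (simp only: nat_pow_pow)
    then show "p_elem G p (x [^] (c * y))"
      unfolding p_elem_def using x ordn[OF x] by (metis nat_pow_closed nat_pow_one)
  next
    fix x assume "p_elem G p x"
    then obtain k where k: "x [^] (p ^ k) = \<one>" and x: "x \<in> carrier G" unfolding p_elem_def by blast
    have "ord x dvd p ^ k" "ord x dvd ?n" using k x ordn pow_eq_id by auto
    moreover have "coprime (ord x) c"
      using \<open>ord x dvd p ^ k\<close> c(2) p by (metis coprime_commute coprime_divisors coprime_power_right_iff dvd_refl prime_imp_coprime)
    ultimately have "ord x dvd p ^ ?a" using c(1) by (metis coprime_dvd_mult_left_iff)
    then have "[c * y = 1] (mod ord x)" using y cong_dvd_modulus_nat by blast
    then have "[int (c * y) = int 1] (mod int (ord x))" using cong_int_iff by blast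
    then have "x [^] int (c * y) = x [^] int 1" using int_pow_eq[OF x] by (metis cong_iff_dvd_diff dvd_diff_commute)
    then show "x [^] (c * y) = x" using x by (metis int_pow_1 int_pow_int of_nat_1)
  next
    fix x assume "pp_elem G p x"
    then obtain k where k: "x [^] k = \<one>" "coprime k p" and x: "x \<in> carrier G" unfolding pp_elem_def by blast
    have "ord x dvd k" "ord x dvd ?n" using k x ordn pow_eq_id by auto
    moreover have "coprime (ord x) (p ^ ?a)"
      using k(2) \<open>ord x dvd k\<close> by (metis coprime_divisors coprime_power_right_iff dvd_refl)
    ultimately have "ord x dvd c" using c(1) by (metis coprime_dvd_mult_right_iff)
    then show "x [^] (c * y) = \<one>" using pow_eq_id x by (meson dvd_mult2)
  next
    fix x assume x: "x \<in> carrier G"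
    have "[c * y * c = c] (mod ?n)"
    proof -
      have "[c * (c * y) = c * 1] (mod c * p ^ ?a)"
        using y unfolding cong_def by (simp only: mult_mod_right[symmetric])
      then show ?thesis using c(1) by (metis mult.commute mult.right_neutral)
    qed
    then have "[c * y * c = c] (mod ord x)" using ordn[OF x] pow_eq_id[OF x] cong_dvd_modulus_nat by blast
    then have "[int (c * y * c) = int c] (mod int (ord x))" using cong_int_iff by blast
    then have "x [^] int (c * y * c) = x [^] int c" using int_pow_eq[OF x] by (metis cong_iff_dvd_diff dvd_diff_commute)
    then have e: "x [^] (c * y * c) = x [^] c" by (simp only: int_pow_int)
    have "(x \<otimes> inv (x [^] (c * y))) [^] c = x [^] c \<otimes> inv (x [^] (c * y)) [^] c"
      using x nat_pow_Suc2[OF x] by (intro pow_mult_distrib commutes_inv) simp_all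
    also have "\<dots> = \<one>" using x e by (simp add: nat_pow_inv nat_pow_pow)
    finally show "pp_elem G p (x \<otimes> inv (x [^] (c * y)))"
      unfolding pp_elem_def using x c(2) p by (metis coprime_commute inv_closed m_closed nat_pow_closed prime_imp_coprime)
  qed
qed

lemma pp_part_exponent:
  assumes p: "prime p"
  obtains m :: nat where "\<And>x. x \<in> carrier G \<Longrightarrow> pp_elem G p (x [^] m)" "\<And>x. pp_elem G p x \<Longrightarrow> x [^] m = x"
proof -
  obtain m :: nat where m: "\<And>x. pp_elem G p x \<Longrightarrow> x [^] m = \<one>"
    "\<And>x. x \<in> carrier G \<Longrightarrow> pp_elem G p (x \<otimes> inv (x [^] m))"
    using p_part_exponent[OF p] by metis
  \<comment> \<open>Exponents count modulo |G|, so 1 + m (|G| - 1) is a natural number standing for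
    1 - m.\<close>
  have eq: "x [^] (1 + m * (order G - 1)) = x \<otimes> inv (x [^] m)" if x: "x \<in> carrier G" for x
  proof -
    have "order G > 0" using order_gt_0_iff_finite by simp
    then have "(x [^] m) [^] (order G - 1) \<otimes> x [^] m = \<one>"
      using pow_order_eq_1[of "x [^] m"] x by (metis Suc_pred' nat_pow_Suc nat_pow_closed)
    then have "inv (x [^] m) = x [^] (m * (order G - 1))" using x by (metis inv_equality nat_pow_closed nat_pow_pow)
    then show ?thesis using nat_pow_Suc2[OF x] by (metis plus_1_eq_Suc)
  qed
  show ?thesis
    by (rule that[of "1 + m * (order G - 1)"]) (use eq m pp_elem_in_carrier in auto)
qed

lemma p_elem_restrict: "subgroup H G \<Longrightarrow> p_elem (G\<lparr>carrier := H\<rparr>) p x \<longleftrightarrow> p_elem G p x \<and> x \<in> H"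
  using subgroup.mem_carrier unfolding p_elem_def by (auto simp flip: nat_pow_consistent)

lemma pp_elem_restrict: "subgroup H G \<Longrightarrow> pp_elem (G\<lparr>carrier := H\<rparr>) p x \<longleftrightarrow> pp_elem G p x \<and> x \<in> H"
  using subgroup.mem_carrier unfolding pp_elem_def by (auto simp flip: nat_pow_consistent)

lemma sub_nat_pow_closed: "subgroup H G \<Longrightarrow> x \<in> H \<Longrightarrow> x [^] (n::nat) \<in> H"
  by (metis int_pow_int subgroup_int_pow_closed)

lemma sylow_exists:
  assumes "prime p" "subgroup H G"
  obtains P where "subgroup P G" "P \<subseteq> H" "card P = p ^ multiplicity p (card H)"
proof -
  obtain c where "card H = p ^ multiplicity p (card H) * c"
    using multiplicity_dvd by (metis dvdE)
  then have "order (G\<lparr>carrier := H\<rparr>) = p ^ multiplicity p (card H) * c" by (simp add: order_def)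
  then obtain P where "subgroup P (G\<lparr>carrier := H\<rparr>)" "card P = p ^ multiplicity p (card H)"
    using Sylow.sylow_thm[OF assms(1) subgroup_imp_group[OF assms(2)]] assms(2) by auto
  then show ?thesis using that assms(2) incl_subgroup subgroup.subset by fastforce
qed

lemma p_group_p_elem: 
  assumes "subgroup P G" "card P = p ^ k" "x \<in> P"
  shows "p_elem G p x"
proof -
  have "order (G\<lparr>carrier := P\<rparr>) = p ^ k" using assms by (simp add: order_def)
  then have "x [^]\<^bsub>G\<lparr>carrier := P\<rparr>\<^esub> (p ^ k) = \<one>"
    using group.pow_order_eq_1[OF subgroup_imp_group[OF assms(1)]] assms(3) by fastforce
  then show ?thesis unfolding p_elem_def using assms subgroup.mem_carrier by (metis nat_pow_consistent)
qed

lemma cauchy_p_elem: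
  assumes "prime q" "subgroup H G" "q dvd card H"
  obtains x where "x \<in> H" "p_elem G q x" "x \<noteq> \<one>"
proof -
  obtain P where P: "subgroup P G" "P \<subseteq> H" "card P = q ^ multiplicity q (card H)"
    using sylow_exists assms by blast
  have "multiplicity q (card H) \<noteq> 0"
    using assms card_sub_pos by (metis multiplicity_eq_zero_iff not_prime_unit less_not_refl)
  then have "card P \<noteq> 1" using P(3) assms(1) by (metis nat_power_eq_Suc_0_iff One_nat_def not_prime_1)
  then have "P \<noteq> {\<one>}" by auto
  then obtain x where "x \<in> P" "x \<noteq> \<one>" using P(1) subgroup.one_closed by blast
  then show ?thesis using that P p_group_p_elem by blast
qed

lemma p_group_card:
  assumes "prime p" "subgroup P G" "\<And>x. x \<in> P \<Longrightarrow> p_elem G p x"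
  shows "\<exists>k. card P = p ^ k"
proof (rule prime_power_if_only_prime_divisor)
  fix q assume q: "prime q" "q dvd card P"
  then obtain x where "x \<in> P" "p_elem G q x" "x \<noteq> \<one>" using cauchy_p_elem assms by blast
  then show "q = p" using p_elem_two_primes assms q by blast
qed (use assms in auto)

lemma p_group_card_iff_sylow:
  assumes "prime p" "subgroup P G" "P \<subseteq> H" "subgroup H G" "\<And>x. x \<in> P \<Longrightarrow> p_elem G p x"
   and "\<not> p dvd card H div card P"
  shows "card P = p ^ multiplicity p (card H)"
proof -
  obtain k where k: "card P = p ^ k" using p_group_card assms by blast
  then have "multiplicity p (card P) = k" using assms(1) by (simp add: prime_elem_multiplicity_eq_zero_iff)
  then show ?thesis using k not_dvd_div_iff_multiplicity assms sub_card_dvd by (metis card_sub_pos)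
qed

end

section \<open>Sylow subgroups\<close>

context fin_group begin

text \<open>Each fibre of (a, b) -> a b is a copy of the intersection of A and B, through t -> (a t,
  t^-1 b).\<close>

lemma card_set_mult:
  assumes A: "subgroup A G" and B: "subgroup B G"
  shows "card (A <#> B) * card (A \<inter> B) = card A * card B"
proof -
  interpret A: subgroup A G by fact
  interpret B: subgroup B G by fact
  let ?f = "\<lambda>(a, b). a \<otimes> b"
  have img: "A <#> B = ?f ` (A \<times> B)" unfolding set_mult_def by auto
  have fib: "card {z \<in> A \<times> B. ?f z = x} = card (A \<inter> B)" if xAB: "x \<in> A <#> B" for x
  proof -
    obtain a b where ab: "a \<in> A" "b \<in> B" "x = a \<otimes> b" using set_multE[OF xAB] by blast
    have "bij_betw (\<lambda>t. (a \<otimes> t, inv t \<otimes> b)) (A \<inter> B) {z \<in> A \<times> B. ?f z = x}"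
    proof (rule bij_betw_byWitness[where f' = "\<lambda>(c, d). inv a \<otimes> c"])
      show "\<forall>t\<in>A \<inter> B. (case (a \<otimes> t, inv t \<otimes> b) of (c, d) \<Rightarrow> inv a \<otimes> c) = t"
        using ab by auto
      show "\<forall>z\<in>{z \<in> A \<times> B. ?f z = x}. (a \<otimes> (case z of (c, d) \<Rightarrow> inv a \<otimes> c),
          inv (case z of (c, d) \<Rightarrow> inv a \<otimes> c) \<otimes> b) = z"
      proof
        fix z assume "z \<in> {z \<in> A \<times> B. ?f z = x}"
        then obtain c d where z: "z = (c, d)" "c \<in> A" "d \<in> B" "c \<otimes> d = a \<otimes> b" using ab(3) by auto
        have "inv (inv a \<otimes> c) \<otimes> b = inv c \<otimes> (a \<otimes> b)" using ab z by (simp add: grp_word)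
        also have "\<dots> = d" using z by (simp flip: z(4))
        finally show "(a \<otimes> (case z of (c, d) \<Rightarrow> inv a \<otimes> c),
          inv (case z of (c, d) \<Rightarrow> inv a \<otimes> c) \<otimes> b) = z" using ab z by simp
      qed
      show "(\<lambda>t. (a \<otimes> t, inv t \<otimes> b)) ` (A \<inter> B) \<subseteq> {z \<in> A \<times> B. ?f z = x}"
        using ab by (auto simp: m_assoc)
      show "(\<lambda>(c, d). inv a \<otimes> c) ` {z \<in> A \<times> B. ?f z = x} \<subseteq> A \<inter> B"
      proof
        fix y assume "y \<in> (\<lambda>(c, d). inv a \<otimes> c) ` {z \<in> A \<times> B. ?f z = x}"
        then obtain c d where z: "c \<in> A" "d \<in> B" "c \<otimes> d = x" and y: "y = inv a \<otimes> c" by auto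
        have "c = c \<otimes> d \<otimes> inv d" using z(1,2) by (simp add: m_assoc)
        then have "c = a \<otimes> b \<otimes> inv d" using z(3) ab(3) by simp
        then have "inv a \<otimes> c = inv a \<otimes> (a \<otimes> b \<otimes> inv d)" by simp
        also have "\<dots> = b \<otimes> inv d" using z(2) ab by (simp add: m_assoc)
        finally have "inv a \<otimes> c = b \<otimes> inv d" .
        moreover have "inv a \<otimes> c \<in> A" "b \<otimes> inv d \<in> B" using z ab by simp_all
        ultimately show "y \<in> A \<inter> B" using y by simp
      qed
    qed
    from bij_betw_same_card[OF this] show ?thesis by (rule sym)
  qed
  have "card (A \<times> B) = (\<Sum>x\<in>A <#> B. card {z \<in> A \<times> B. ?f z = x})"
    unfolding img by (rule sum.image_gen[where h = "\<lambda>_. 1::nat", simplified]) (simp add: A B)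
  also have "\<dots> = card (A <#> B) * card (A \<inter> B)" using fib by simp
  finally show ?thesis by (simp add: card_cartesian_product)
qed

text \<open>The product formula equates two products of p-parts: that of P Q and the intersection of
  P and Q, and that of A B and the intersection of A and B. Each factor of the first is at most the
  matching factor of the second, so they agree.\<close>

lemma sylow_set_mult:
  assumes p: "prime p"
    and sub: "subgroup A G" "subgroup B G" "subgroup (A <#> B) G"
    and P: "subgroup P G" "P \<subseteq> A" "card P = p ^ multiplicity p (card A)"
    and Q: "subgroup Q G" "Q \<subseteq> B" "card Q = p ^ multiplicity p (card B)"
    and PQ: "subgroup (P <#> Q) G"
  shows "card (P <#> Q) = p ^ multiplicity p (card (A <#> B))"
proof -
  let ?m = "multiplicity p"
  have mul: "?m (x * y) = ?m x + ?m y" if "x > 0" "y > 0" for x y :: nat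
    using that p by (simp add: prime_elem_multiplicity_mult_distrib)
  have s: "subgroup (P \<inter> Q) G" "subgroup (A \<inter> B) G" using P Q sub subgroups_Inter_pair by auto
  have sub': "P <#> Q \<subseteq> A <#> B" using P Q by (simp add: mono_set_mult)
  have e1: "card (P <#> Q) * card (P \<inter> Q) = p ^ (?m (card A) + ?m (card B))"
    using card_set_mult[OF P(1) Q(1)] P(3) Q(3) by (simp add: power_add)
  then have pow: "card (P <#> Q) dvd p ^ (?m (card A) + ?m (card B))" by (metis dvd_triv_left)
  then obtain k where k: "card (P <#> Q) = p ^ k" using divides_primepow_nat[OF p] by blast
  have mp: "?m (p ^ n) = n" for n using p by simp
  have "?m (card (P <#> Q)) + ?m (card (P \<inter> Q)) = ?m (card A) + ?m (card B)"
    using e1 mul[of "card (P <#> Q)" "card (P \<inter> Q)"] mp PQ s by (metis card_sub_pos)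
  also have "\<dots> = ?m (card (A <#> B)) + ?m (card (A \<inter> B))"
    using card_set_mult[OF sub(1,2)] mul sub s by (metis card_sub_pos)
  finally have eq: "k + ?m (card (P \<inter> Q)) = ?m (card (A <#> B)) + ?m (card (A \<inter> B))" using k mp by simp
  have "?m (card (P \<inter> Q)) \<le> ?m (card (A \<inter> B))"
    using multiplicity_card_mono[OF s(2,1)] P(2) Q(2) by blast
  moreover have "k \<le> ?m (card (A <#> B))"
    using multiplicity_card_mono[OF sub(3) PQ sub', of p] k mp by simp
  ultimately have "k = ?m (card (A <#> B))" using eq by linarith
  then show ?thesis using k by simp
qed

lemma set_mult_permute_set_mult:
  assumes "A \<subseteq> carrier G" "B \<subseteq> carrier G" "C \<subseteq> carrier G" "A <#> C = C <#> A" "B <#> C = C <#> B"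
  shows "(A <#> B) <#> C = C <#> (A <#> B)"
  using assms by (metis set_mult_assoc)

lemma prod_sets_permuting:
  assumes "\<And>i. i < n \<Longrightarrow> subgroup (H i) G"
    and "\<And>i j. i < n \<Longrightarrow> j < n \<Longrightarrow> i \<noteq> j \<Longrightarrow> H i <#> H j = H j <#> H i"
  shows "k \<le> n \<Longrightarrow> subgroup (prod_sets G H k) G"
    and "k \<le> n \<Longrightarrow> j < n \<Longrightarrow> k \<le> j \<Longrightarrow> prod_sets G H k <#> H j = H j <#> prod_sets G H k"
proof (induction k arbitrary: j)
  case 0
  { case 1 show ?case by (simp add: triv_subgroup) }
  { case 2
    then have "H j \<subseteq> carrier G" using assms subgroup.subset by blast
    then show ?case by (force simp: set_mult_def subset_iff) }
next
  case (Suc k)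
  { case 1
    then show ?case using Suc.IH set_mult_permute_subgroup assms by simp }
  { case 2
    have "H j \<subseteq> carrier G" "H k \<subseteq> carrier G" "prod_sets G H k \<subseteq> carrier G"
      using subgroup.subset[OF assms(1)] subgroup.subset[OF Suc.IH(1)] 2 by auto
    then show ?case using Suc.IH(2)[of j] 2 assms(2)[of k j] by (simp add: set_mult_permute_set_mult) }
qed

lemma prod_sets_contains:
  assumes "\<And>i. i < n \<Longrightarrow> subgroup (H i) G"
    and "\<And>i j. i < n \<Longrightarrow> j < n \<Longrightarrow> i \<noteq> j \<Longrightarrow> H i <#> H j = H j <#> H i"
  shows "k \<le> n \<Longrightarrow> i < k \<Longrightarrow> H i \<subseteq> prod_sets G H k"
proof (induction k)
  case (Suc k)
  have s: "subgroup (prod_sets G H k) G" "subgroup (H k) G"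
    using prod_sets_permuting(1)[of n H, OF assms] assms(1) Suc.prems by auto
  show ?case
    using Suc set_mult_subset_left[OF s] by (cases "i = k") auto
qed simp

lemma prod_sets_least:
  assumes "subgroup K G" "\<And>i. i < n \<Longrightarrow> H i \<subseteq> K"
  shows "prod_sets G H n \<subseteq> K"
  using assms(2)
proof (induction n)
  case 0
  then show ?case using assms(1) by (simp add: subgroup.one_closed)
next
  case (Suc n)
  then show ?case using set_mult_subset_subgroup[OF _ _ assms(1)] by simp
qed

lemma sylow_prod_sets:
  assumes p: "prime p"
    and H: "\<And>i. i < n \<Longrightarrow> subgroup (H i) G"
    and Hp: "\<And>i j. i < n \<Longrightarrow> j < n \<Longrightarrow> i \<noteq> j \<Longrightarrow> H i <#> H j = H j <#> H i"
    and P: "\<And>i. i < n \<Longrightarrow> subgroup (P i) G"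
    and Pp: "\<And>i j. i < n \<Longrightarrow> j < n \<Longrightarrow> i \<noteq> j \<Longrightarrow> P i <#> P j = P j <#> P i"
    and sub: "\<And>i. i < n \<Longrightarrow> P i \<subseteq> H i"
    and syl: "\<And>i. i < n \<Longrightarrow> card (P i) = p ^ multiplicity p (card (H i))"
  shows "k \<le> n \<Longrightarrow> prod_sets G P k \<subseteq> prod_sets G H k \<and> 
    card (prod_sets G P k) = p ^ multiplicity p (card (prod_sets G H k))"
proof (induction k)
  case (Suc k)
  have "subgroup (prod_sets G P k <#> P k) G" "subgroup (prod_sets G H k <#> H k) G"
    using prod_sets_permuting(1)[of n P, OF P Pp, of "Suc k"] prod_sets_permuting(1)[of n H, OF H Hp, of "Suc k"] Suc.prems by auto
  moreover have "subgroup (prod_sets G P k) G" "subgroup (prod_sets G H k) G"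
    using prod_sets_permuting(1)[of n P, OF P Pp, of "k"] prod_sets_permuting(1)[of n H, OF H Hp, of "k"] Suc.prems by auto
  ultimately show ?case
    using Suc sylow_set_mult[OF p, of "prod_sets G H k" "H k" "prod_sets G P k" "P k"] H P sub syl
    by (simp add: mono_set_mult)
qed simp

lemma p_group_fixed_points:
  assumes act: "group_action G E \<phi>" and fE: "finite E" and p: "prime p" and ord: "order G = p ^ k"
  shows "[card E = card {x \<in> E. \<forall>g\<in>carrier G. \<phi> g x = x}] (mod p)"
proof -
  interpret group_action G E \<phi> by fact
  define F where "F = {x \<in> E. \<forall>g\<in>carrier G. \<phi> g x = x}"
  define Os where "Os = {Q \<in> orbits G E \<phi>. card Q \<noteq> 1}"
  note FO = F_def Os_def
  have part: "partition E (orbits G E \<phi>)" by (rule orbit_partition)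
  have un: "\<Union>(orbits G E \<phi>) = E" using partition.partition_coverture[OF part] .
  have orb: "orbit G \<phi> x = (\<lambda>g. \<phi> g x) ` carrier G" for x unfolding orbit_def by auto
  have eq: "E = F \<union> \<Union>Os"
  proof
    show "E \<subseteq> F \<union> \<Union>Os"
    proof
      fix x assume x: "x \<in> E"
      have xo: "x \<in> orbit G \<phi> x" using orbit_refl x by simp
      show "x \<in> F \<union> \<Union>Os"
      proof (cases "card (orbit G \<phi> x) = 1")
        case True
        then have "orbit G \<phi> x = {x}" using xo by (metis card_1_singletonE singletonD)
        then show ?thesis using x unfolding orb FO by auto
      next
        case False
        then have "orbit G \<phi> x \<in> Os" using False x unfolding orbits_def FO by auto
        then show ?thesis using xo by blast
      qed
    qed
    show "F \<union> \<Union>Os \<subseteq> E" using un unfolding FO by auto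
  qed
  have disj: "F \<inter> \<Union>Os = {}"
  proof (rule ccontr)
    assume "F \<inter> \<Union>Os \<noteq> {}"
    then obtain x Q where x: "x \<in> F" "x \<in> Q" "Q \<in> orbits G E \<phi>" "card Q \<noteq> 1" unfolding Os_def by blast
    then obtain y where y: "y \<in> E" "Q = orbit G \<phi> y" unfolding orbits_def by auto
    then have "y \<in> orbit G \<phi> x" using orbit_sym x F_def by blast
    then have "y = x" using x unfolding orb FO by auto
    then have "Q = {x}" using x y unfolding orb F_def by (auto intro: one_closed)
    then show False using x by simp
  qed
  have dv: "p dvd card Q" if Q: "Q \<in> Os" for Q
  proof -
    obtain y where y: "y \<in> E" "Q = orbit G \<phi> y" using Q unfolding orbits_def FO by auto
    have "card Q dvd p ^ k" using orbit_stabilizer_theorem[OF y(1)] y ord by (metis dvd_triv_left)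
    then obtain j where "card Q = p ^ j" using divides_primepow_nat[OF p] by blast
    then show ?thesis using Q unfolding FO by (cases j) auto
  qed
  have "Os \<subseteq> Pow E" using un unfolding FO by blast
  then have fO: "finite Os" using fE finite_subset finite_Pow_iff by blast
  have fO': "finite Q" if "Q \<in> Os" for Q
    using that \<open>Os \<subseteq> Pow E\<close> fE finite_subset by blast
  have "card (\<Union>Os) = sum card Os"
  proof (rule card_Union_disjoint)
    show "pairwise disjnt Os"
      using partition.disjoint_union[OF part] unfolding pairwise_def disjnt_def FO by blast
  qed (use fO' in blast)
  then have "p dvd card (\<Union>Os)" using dv dvd_sum[of Os p card] by metis
  moreover have "card E = card F + card (\<Union>Os)"
  proof -
    have 1: "finite F" using fE unfolding FO by simp
    have "\<Union>Os \<subseteq> E" using un unfolding FO by blast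
    then have 2: "finite (\<Union>Os)" using fE by (rule finite_subset)
    have "card E = card (F \<union> \<Union>Os)" by (rule arg_cong[OF eq, where f=card])
    also have "\<dots> = card F + card (\<Union>Os)" using 1 2 disj by (rule card_Un_disjoint)
    finally show ?thesis .
  qed
  ultimately obtain t where "card E = card F + p * t" by (metis dvdE)
  then have "card E mod p = card F mod p" by (metis mod_mult_self2)
  then show ?thesis unfolding cong_def F_def .
qed

text \<open>The fixed point count for a plain function \<open>act\<close>, which is restricted to
  \<open>E\<close> so that it yields elements of \<open>BijGroup E\<close>.\<close>

lemma p_group_fixed_points_act:
  fixes act :: "'a \<Rightarrow> 'c \<Rightarrow> 'c"
  assumes fE: "finite E" and p: "prime p" and P: "subgroup P G" "card P = p ^ k"
    and cl: "\<And>g x. g \<in> P \<Longrightarrow> x \<in> E \<Longrightarrow> act g x \<in> E"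
    and one: "\<And>x. x \<in> E \<Longrightarrow> act \<one> x = x"
    and mul: "\<And>g h x. g \<in> P \<Longrightarrow> h \<in> P \<Longrightarrow> x \<in> E \<Longrightarrow> act (g \<otimes> h) x = act g (act h x)"
  shows "[card E = card {x \<in> E. \<forall>g\<in>P. act g x = x}] (mod p)"
proof -
  let ?H = "G\<lparr>carrier := P\<rparr>" and ?\<phi> = "\<lambda>g. restrict (act g) E"
  interpret P: subgroup P G by fact
  have bij: "bij_betw (act g) E E" if g: "g \<in> P" for g
    by (rule bij_betw_byWitness[where f' = "act (inv g)"])
      (use g mul one cl in \<open>auto simp flip: mul simp: P.mem_carrier\<close>)
  have "group_hom ?H (BijGroup E) ?\<phi>"
  proof (unfold group_hom_def group_hom_axioms_def, intro conjI)
    show "Group.group ?H" using P(1) subgroup_imp_group by blast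
    show "Group.group (BijGroup E)" by (rule group_BijGroup)
    show "?\<phi> \<in> hom ?H (BijGroup E)"
    proof (rule homI)
      fix g assume "g \<in> carrier ?H"
      then show "?\<phi> g \<in> carrier (BijGroup E)"
        using bij by (simp add: BijGroup_def Bij_def)
    next
      fix g h assume gh: "g \<in> carrier ?H" "h \<in> carrier ?H"
      then have "?\<phi> g \<in> Bij E" "?\<phi> h \<in> Bij E" using bij by (simp_all add: Bij_def)
      then have "?\<phi> g \<otimes>\<^bsub>BijGroup E\<^esub> ?\<phi> h = compose E (?\<phi> g) (?\<phi> h)" by (simp add: BijGroup_def)
      also have "\<dots> = ?\<phi> (g \<otimes> h)"
        using gh cl mul by (auto simp: compose_def restrict_def fun_eq_iff)
      finally show "?\<phi> (g \<otimes>\<^bsub>?H\<^esub> h) = ?\<phi> g \<otimes>\<^bsub>BijGroup E\<^esub> ?\<phi> h" by simp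
    qed
  qed
  then have "group_action ?H E ?\<phi>" by (simp add: group_action_def)
  interpret H: fin_group ?H using sub_fin_group[OF P(1)] .
  have "[card E = card {x \<in> E. \<forall>g\<in>carrier ?H. ?\<phi> g x = x}] (mod p)"
    using H.p_group_fixed_points[OF \<open>group_action ?H E ?\<phi>\<close> fE p, of k] P(2) by (simp add: order_def)
  moreover have "{x \<in> E. \<forall>g\<in>carrier ?H. ?\<phi> g x = x} = {x \<in> E. \<forall>g\<in>P. act g x = x}" by auto
  ultimately show ?thesis by simp
qed

text \<open>Q acts on the left cosets of P, whose number is prime to p; a fixed coset aP gives a^-1
  Q a inside P.\<close>

lemma sylow_conj_carrier:
  assumes p: "prime p" and P: "subgroup P G" "\<not> p dvd card (carrier G) div card P"
    and Q: "subgroup Q G" "card Q = p ^ k"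
  shows "\<exists>g\<in>carrier G. \<forall>x\<in>Q. conj (inv g) x \<in> P"
proof -
  define E where "E = lcosets P"
  interpret P: subgroup P G by fact
  interpret Q: subgroup Q G by fact
  have "card E * card P = card (carrier G)" using l_lagrange[OF fin P(1)] by (simp add: order_def E_def)
  then have "card E = card (carrier G) div card P" using card_sub_pos[OF P(1)] by (metis div_mult_self_is_m)
  then have nd: "\<not> p dvd card E" using P(2) by simp
  have fE: "finite E" by (metis E_def LCOSETS_def fin finite.emptyI finite.insertI finite_UN)
  have "[card E = card {C \<in> E. \<forall>g\<in>Q. g <# C = C}] (mod p)"
  proof (rule p_group_fixed_points_act[OF fE p Q])
    fix g C assume g: "g \<in> Q" and "C \<in> E"
    then obtain a where "a \<in> carrier G" "C = a <# P" unfolding E_def LCOSETS_def by auto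
    then show "g <# C \<in> E" using g by (auto simp: E_def LCOSETS_def lcos_m_assoc P.subset)
  next
    fix C assume "C \<in> E"
    then have "C \<subseteq> carrier G" using P.lcosets_carrier[OF is_group] E_def by blast
    then show "\<one> <# C = C" by (rule lcos_mult_one)
    fix g h assume "g \<in> Q" "h \<in> Q"
    then show "(g \<otimes> h) <# C = g <# (h <# C)" using \<open>C \<subseteq> carrier G\<close> by (simp add: lcos_m_assoc)
  qed
  then have "card {C \<in> E. \<forall>g\<in>Q. g <# C = C} \<noteq> 0" using nd by (metis cong_0_iff)
  then have "{C \<in> E. \<forall>g\<in>Q. g <# C = C} \<noteq> {}" by (metis card.empty)
  then obtain C where C: "C \<in> E" "\<forall>g\<in>Q. g <# C = C" by blast
  then obtain a where a: "a \<in> carrier G" "C = a <# P" unfolding E_def LCOSETS_def by auto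
  have "conj (inv a) x \<in> P" if x: "x \<in> Q" for x
  proof -
    have "x \<otimes> a \<in> C"
      using C(2) x a by (metis P(1) P.subset Q.mem_carrier lcos_m_assoc lcos_self m_closed)
    then obtain b where "b \<in> P" "x \<otimes> a = a \<otimes> b" unfolding a l_coset_def by auto
    then have "inv a \<otimes> (x \<otimes> a) = b" using a by simp
    then show ?thesis using a x \<open>b \<in> P\<close> by (simp add: m_assoc)
  qed
  then show ?thesis using a by blast
qed

lemma sylow_conj:
  assumes p: "prime p" and H: "subgroup H G"
    and P: "subgroup P G" "P \<subseteq> H" "\<not> p dvd card H div card P"
    and Q: "subgroup Q G" "Q \<subseteq> H" "card Q = p ^ k"
  obtains g where "g \<in> H" "\<And>x. x \<in> Q \<Longrightarrow> conj (inv g) x \<in> P"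
proof -
  interpret H: fin_group "G\<lparr>carrier := H\<rparr>" using sub_fin_group[OF H] .
  have "subgroup P (G\<lparr>carrier := H\<rparr>)" "subgroup Q (G\<lparr>carrier := H\<rparr>)" using subgroup_incl H P Q by auto
  then obtain g where "g \<in> H" "\<forall>x\<in>Q. inv\<^bsub>G\<lparr>carrier := H\<rparr>\<^esub> g \<otimes> x \<otimes> inv\<^bsub>G\<lparr>carrier := H\<rparr>\<^esub> (inv\<^bsub>G\<lparr>carrier := H\<rparr>\<^esub> g) \<in> P"
    using H.sylow_conj_carrier[OF p, of P Q k] P Q by auto
  then show ?thesis using that[of g] H by (simp add: subgroup.m_inv_closed)
qed

text \<open>For every prime the intersection of H and K has the full prime part of |H|. At p a
  single Sylow subgroup inside K is enough; with a stabiliser as K, normality can thus be tested on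
  one chosen Sylow p-subgroup and the elements of other prime power orders.\<close>

lemma generate_sylow_and_coprime:
  assumes p: "prime p" and H: "subgroup H G"
    and P: "subgroup P G" "P \<subseteq> H" "card P = p ^ multiplicity p (card H)"
    and K: "subgroup K G" "P \<subseteq> K" "\<And>q x. prime q \<Longrightarrow> q \<noteq> p \<Longrightarrow> p_elem G q x \<Longrightarrow> x \<in> H \<Longrightarrow> x \<in> K"
  shows "H \<subseteq> K"
proof -
  have HK: "subgroup (H \<inter> K) G" using H K subgroups_Inter_pair by blast
  have "card H dvd card (H \<inter> K)"
  proof (rule multiplicity_le_imp_dvd)
    show "card H \<noteq> 0" using H by (metis card_sub_pos less_not_refl)
    fix q :: nat assume q: "prime q"
    obtain Q where Q: "subgroup Q G" "Q \<subseteq> H" "card Q = q ^ multiplicity q (card H)" "Q \<subseteq> K"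
    proof (cases "q = p")
      case False
      obtain Q where Q: "subgroup Q G" "Q \<subseteq> H" "card Q = q ^ multiplicity q (card H)" using sylow_exists q H by blast
      then show ?thesis using K(3)[OF q False] p_group_p_elem[OF Q(1,3)] that by blast
    qed (use P K that in blast)
    then have "q ^ multiplicity q (card H) dvd card (H \<inter> K)" using sub_card_dvd[OF HK Q(1)] by auto
    then show "multiplicity q (card H) \<le> multiplicity q (card (H \<inter> K))"
      using q HK by (metis card_sub_pos less_not_refl multiplicity_geI not_prime_unit)
  qed
  then have "card H \<le> card (H \<inter> K)" using card_sub_pos[OF HK] by (simp add: dvd_imp_le)
  then have "H \<inter> K = H" using H by (intro card_seteq) auto
  then show ?thesis by blast
qed

lemma subgroup_contains_if_p_elems:
  assumes H: "subgroup H G" and K: "subgroup K G"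
    and "\<And>q x. prime q \<Longrightarrow> p_elem G q x \<Longrightarrow> x \<in> H \<Longrightarrow> x \<in> K"
  shows "H \<subseteq> K"
proof -
  \<comment> \<open>The prime 2 is an arbitrary choice of the distinguished prime.\<close>
  obtain P where P: "subgroup P G" "P \<subseteq> H" "card P = 2 ^ multiplicity 2 (card H)"
    using sylow_exists[OF two_is_prime_nat H] .
  show ?thesis
    using generate_sylow_and_coprime[OF two_is_prime_nat H P K] p_group_p_elem[OF P(1,3)] assms(3) P(2) two_is_prime_nat
    by blast
qed

end

section \<open>Transfer into a central subgroup\<close>

lemma (in group_hom) hom_p_elem: "p_elem G p x \<Longrightarrow> p_elem H p (h x)"
  unfolding p_elem_def by (metis hom_closed hom_nat_pow hom_one)

lemma (in group_hom) hom_pp_elem: "pp_elem G p x \<Longrightarrow> pp_elem H p (h x)"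
  unfolding pp_elem_def by (metis hom_closed hom_nat_pow hom_one)

text \<open>For a subgroup S of a finite group the inclusion is enough, since conjugation is
  injective; the result is the normaliser of S (\<open>normalizer_eq\<close>).\<close>

definition conj_stab :: "('a, 'b) monoid_scheme \<Rightarrow> 'a set \<Rightarrow> 'a set" where
  "conj_stab G S = {g \<in> carrier G. \<forall>s\<in>S. g \<otimes>\<^bsub>G\<^esub> s \<otimes>\<^bsub>G\<^esub> inv\<^bsub>G\<^esub> g \<in> S}"

context fin_group begin

lemma cyclic_p_group:
  assumes "prime p" "p_elem G p x"
  shows "\<exists>k. card (generate G {x}) = p ^ k" "\<And>y. y \<in> generate G {x} \<Longrightarrow> p_elem G p y"
proof -
  have x: "x \<in> carrier G" using assms(2) by (rule p_elem_in_carrier)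
  show *: "p_elem G p y" if "y \<in> generate G {x}" for y
    using that generate_pow[OF x] p_elem_int_pow[OF assms(2)] by auto
  show "\<exists>k. card (generate G {x}) = p ^ k"
    using p_group_card[OF assms(1) generate_is_subgroup *] x by simp
qed

lemma conj_stab_subgroup:
  assumes S: "subgroup S G"
  shows "subgroup (conj_stab G S) G"
proof (rule subgroupI)
  have "\<one> \<in> conj_stab G S" unfolding conj_stab_def using subgroup.mem_carrier[OF S] by simp
  then show "conj_stab G S \<noteq> {}" by blast
  fix g assume g: "g \<in> conj_stab G S"
  then have gc: "g \<in> carrier G" unfolding conj_stab_def by blast
  have "inj_on (conj g) S" using conj_inj_on[OF gc subgroup.subset[OF S]] .
  then have sur: "conj g ` S = S"
    using g S unfolding conj_stab_def by (intro endo_inj_surj) auto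
  have "conj (inv g) s \<in> S" if s: "s \<in> S" for s
  proof -
    obtain t where t: "t \<in> S" "s = conj g t" using sur s by blast
    then have "conj (inv g) s = t" using gc subgroup.mem_carrier[OF S] by (simp add: grp_word)
    then show ?thesis using t by simp
  qed
  then show "inv g \<in> conj_stab G S" unfolding conj_stab_def using gc by blast
  fix h assume h: "h \<in> conj_stab G S"
  then have hc: "h \<in> carrier G" unfolding conj_stab_def by blast
  have "conj (g \<otimes> h) s \<in> S" if s: "s \<in> S" for s
  proof -
    have "conj g (conj h s) \<in> S" using g h s unfolding conj_stab_def by blast
    then show ?thesis using conj_conj[OF gc hc subgroup.mem_carrier[OF S s]] by simp
  qed
  then show "g \<otimes> h \<in> conj_stab G S" unfolding conj_stab_def using gc hc by blast
qed (auto simp: conj_stab_def)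

lemma subgroup_le_conj_stab: "subgroup S G \<Longrightarrow> S \<subseteq> conj_stab G S"
  unfolding conj_stab_def by (auto simp: subgroup.mem_carrier subgroup.m_closed subgroup.m_inv_closed)

lemma normal_iff_conj_stab: "N \<lhd> G \<longleftrightarrow> subgroup N G \<and> carrier G \<subseteq> conj_stab G N"
  unfolding normal_inv_iff conj_stab_def by auto

text \<open>Sylow's theorem in L moves <x> into a Sylow p-subgroup of K, and L normalises K.
  Relative normality is written \<open>L \<subseteq> conj_stab G K\<close> from here on, which
  avoids a change of carrier.\<close>

lemma p_elem_in_coprime_index:
  assumes p: "prime p" and L: "subgroup L G" and K: "subgroup K G" "K \<subseteq> L" "L \<subseteq> conj_stab G K"
    and nd: "\<not> p dvd card L div card K" and x: "x \<in> L" "p_elem G p x"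
  shows "x \<in> K"
proof -
  let ?Q = "generate G {x}"
  have xc: "x \<in> carrier G" using x(2) by (rule p_elem_in_carrier)
  obtain k where k: "card ?Q = p ^ k" using cyclic_p_group[OF p x(2)] by blast
  have sQ: "subgroup ?Q G" using generate_is_subgroup xc by simp
  have QL: "?Q \<subseteq> L" using generate_subgroup_incl[OF _ L] x by simp
  obtain P where P: "subgroup P G" "P \<subseteq> K" "card P = p ^ multiplicity p (card K)"
    using sylow_exists[OF p K(1)] .
  then have "card P = p ^ multiplicity p (card L)"
    using not_dvd_div_iff_multiplicity[OF card_sub_pos[OF K(1)] card_sub_pos[OF L] sub_card_dvd[OF L K(1,2)] p] nd by simp
  then have "\<not> p dvd card L div card P" using sylow_index[OF p L P(1) _ P(1)] P(2) K(2) by blast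
  then obtain g where g: "g \<in> L" "conj (inv g) x \<in> P"
    using sylow_conj[OF p L P(1) _ _ sQ QL k] P(2) K(2) by (metis generate.incl singletonI subset_trans)
  have gc: "g \<in> carrier G" using subgroup.mem_carrier[OF L g(1)] .
  have "conj g (conj (inv g) x) \<in> K" using g P(2) K(3) unfolding conj_stab_def by blast
  then show ?thesis using gc xc by (simp add: grp_word)
qed

lemma sylow_overgroup_contains_p_elems:
  assumes p: "prime p" and L: "subgroup L G"
    and K: "subgroup K G" "K \<subseteq> L" "L \<subseteq> conj_stab G K"
    and T: "subgroup T G" "T \<subseteq> K" "card T = p ^ multiplicity p (card L)"
    and x: "x \<in> L" "p_elem G p x"
  shows "x \<in> K"
  using p_elem_in_coprime_index[OF p L K sylow_index[OF p L K(1,2) T] x] .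

lemma sylow_normal_contains_p_elems:
  assumes "prime p" "N \<lhd> G"
    "subgroup P G" "P \<subseteq> N" "card P = p ^ multiplicity p (card (carrier G))" "p_elem G p x"
  shows "x \<in> N"
  using sylow_overgroup_contains_p_elems[OF assms(1) subgroup_self _ _ _ assms(3-5) p_elem_in_carrier[OF assms(6)] assms(6)]
    assms(2) normal_iff_conj_stab subgroup.subset by blast

lemma p_elem_in_normal_of_coprime_index:
  assumes "prime p" "N \<lhd> G" "\<not> p dvd card (carrier G) div card N" "p_elem G p x"
  shows "x \<in> N"
  using p_elem_in_coprime_index[OF assms(1) subgroup_self _ _ _ assms(3) p_elem_in_carrier[OF assms(4)] assms(4)]
    assms(2) normal_iff_conj_stab subgroup.subset by blast

lemma coprime_index_if_p_elems_in:
  assumes p: "prime p" and H: "subgroup H G" and K: "subgroup K G" "K \<subseteq> H"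
    and x: "\<And>x. p_elem G p x \<Longrightarrow> x \<in> H \<Longrightarrow> x \<in> K"
  shows "\<not> p dvd card H div card K"
proof -
  obtain P where P: "subgroup P G" "P \<subseteq> H" "card P = p ^ multiplicity p (card H)"
    using sylow_exists[OF p H] by blast
  have "P \<subseteq> K" using x p_group_p_elem[OF P(1,3)] P(2) by blast
  then show ?thesis using sylow_index[OF p H K P(1) _ P(3)] by blast
qed

text \<open>The transfer homomorphism into a central subgroup: \<open>\<tau>\<close> selects coset
  representatives and \<open>f g C\<close> in Z measures how far g is from respecting them. For g =
  z in Z each of these values is z, one for each coset.\<close>

lemma central_transfer:
  assumes Z: "subgroup Z G" and cen: "\<And>z g. z \<in> Z \<Longrightarrow> g \<in> carrier G \<Longrightarrow> z \<otimes> g = g \<otimes> z"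
  obtains T where "\<And>g. g \<in> carrier G \<Longrightarrow> T g \<in> Z"
    "\<And>g h. g \<in> carrier G \<Longrightarrow> h \<in> carrier G \<Longrightarrow> T (g \<otimes> h) = T g \<otimes> T h"
    "\<And>z. z \<in> Z \<Longrightarrow> T z = z [^] card (rcosets Z)"
proof -
  interpret Z: subgroup Z G by fact
  let ?H = "G\<lparr>carrier := Z\<rparr>"
  interpret H: comm_group ?H
    using subgroup_imp_group[OF Z] cen by (intro group.group_comm_groupI) auto
  define \<tau> where "\<tau> C = (SOME x. x \<in> C)" for C :: "'a set"
  define f where "f g C = \<tau> C \<otimes> g \<otimes> inv (\<tau> (C #> g))" for g C
  define T where "T g = finprod ?H (f g) (rcosets Z)" for g
  have cos: "C \<subseteq> carrier G" if "C \<in> rcosets Z" for C using Z.rcosets_carrier[OF is_group that] .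
  have \<tau>: "\<tau> C \<in> C" if C: "C \<in> rcosets Z" for C
    using Z.rcosets_non_empty[OF C] unfolding \<tau>_def by (metis some_in_eq)
  have \<tau>c: "\<tau> C \<in> carrier G" if C: "C \<in> rcosets Z" for C using \<tau>[OF C] cos[OF C] by blast
  have mv: "C #> g \<in> rcosets Z" if C: "C \<in> rcosets Z" and g: "g \<in> carrier G" for C g
  proof -
    obtain a where a: "a \<in> carrier G" "C = Z #> a" using C unfolding RCOSETS_def by blast
    then have "C #> g = Z #> (a \<otimes> g)" using g by (simp add: coset_mult_assoc Z.subset)
    then show ?thesis using a g by (simp add: rcosetsI Z.subset)
  qed
  have mv2: "(C #> g) #> h = C #> (g \<otimes> h)" if C: "C \<in> rcosets Z" and g: "g \<in> carrier G" "h \<in> carrier G" for C g h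
    using coset_mult_assoc[OF cos[OF C] g] .
  have fZ: "f g C \<in> Z" if C: "C \<in> rcosets Z" and g: "g \<in> carrier G" for C g
  proof -
    have "\<tau> C \<otimes> g \<in> C #> g" using \<tau>[OF C] unfolding r_coset_def by blast
    moreover have "\<tau> (C #> g) \<in> C #> g" using \<tau>[OF mv[OF C g]] .
    moreover obtain a where a: "a \<in> carrier G" "C #> g = Z #> a" using mv[OF C g] unfolding RCOSETS_def by blast
    ultimately have "\<tau> C \<otimes> g \<in> Z #> a" "\<tau> (C #> g) \<in> Z #> a" by auto
    then obtain z z' where z: "z \<in> Z" "z' \<in> Z" "\<tau> C \<otimes> g = z \<otimes> a" "\<tau> (C #> g) = z' \<otimes> a" unfolding r_coset_def by blast
    then have "f g C = z \<otimes> inv z'" unfolding f_def using a by (simp add: grp_word)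
    then show ?thesis using z by simp
  qed
  have TZ: "T g \<in> Z" if g: "g \<in> carrier G" for g
    using H.finprod_closed[of "f g" "rcosets Z"] fZ[OF _ g] unfolding T_def by auto
  have Tm: "T (g \<otimes> h) = T g \<otimes> T h" if g: "g \<in> carrier G" and h: "h \<in> carrier G" for g h
  proof -
    have inj: "inj_on (\<lambda>C. C #> g) (rcosets Z)"
    proof (rule inj_onI)
      fix C D assume "C \<in> rcosets Z" "D \<in> rcosets Z" "C #> g = D #> g"
      then have "C #> (g \<otimes> inv g) = D #> (g \<otimes> inv g)" using mv2 g by (metis inv_closed)
      then show "C = D" using g cos \<open>C \<in> rcosets Z\<close> \<open>D \<in> rcosets Z\<close> by simp
    qed
    have img: "(\<lambda>C. C #> g) ` (rcosets Z) = rcosets Z"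
      using inj mv[OF _ g] by (intro endo_inj_surj rcosets_finite) (auto simp: RCOSETS_def)
    \<comment> \<open>Cocycle identity: \<open>f (g \<otimes> h) C\<close> is \<open>f g C\<close>
      times \<open>f h (C #> g)\<close>, and C -> C g permutes the cosets over which the product
      runs.\<close>
    have "T (g \<otimes> h) = finprod ?H (\<lambda>C. f g C \<otimes>\<^bsub>?H\<^esub> f h (C #> g)) (rcosets Z)"
      unfolding T_def
    proof (rule H.finprod_cong')
      fix C assume C: "C \<in> rcosets Z"
      show "f (g \<otimes> h) C = f g C \<otimes>\<^bsub>?H\<^esub> f h (C #> g)"
        unfolding f_def using C g h \<tau>c[OF C] \<tau>c[OF mv[OF C g]] \<tau>c[OF mv[OF C, of "g \<otimes> h"]]
        by (simp add: mv2 grp_word)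
    qed (use fZ mv g h in auto)
    also have "\<dots> = T g \<otimes> finprod ?H (\<lambda>C. f h (C #> g)) (rcosets Z)"
      unfolding T_def by (subst H.finprod_multf) (use fZ mv g h in auto)
    also have "finprod ?H (\<lambda>C. f h (C #> g)) (rcosets Z) = finprod ?H (f h) ((\<lambda>C. C #> g) ` (rcosets Z))"
      by (rule H.finprod_reindex[symmetric]) (use fZ mv g h inj img in auto)
    finally show ?thesis using img by (simp add: T_def)
  qed
  have Tz: "T z = z [^] card (rcosets Z)" if z: "z \<in> Z" for z
  proof -
    have "T z = finprod ?H (\<lambda>_. z) (rcosets Z)"
      unfolding T_def
    proof (rule H.finprod_cong')
      fix C assume C: "C \<in> rcosets Z"
      then obtain a where a: "a \<in> carrier G" "C = Z #> a" unfolding RCOSETS_def by blast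
      have "C #> z = Z #> (z \<otimes> a)" using a z cen by (simp add: coset_mult_assoc Z.subset)
      also have "\<dots> = C" using a z coset_mult_assoc[OF Z.subset, of z a] Z.rcos_const[OF is_group z] by simp
      finally show "f z C = z" unfolding f_def using cen[OF z \<tau>c[OF C]] \<tau>c[OF C] z by (metis Z.mem_carrier inv_solve_right m_closed)
    qed (use z in auto)
    also have "\<dots> = z [^]\<^bsub>?H\<^esub> card (rcosets Z)" using z by (simp add: H.finprod_const)
    finally show ?thesis by (simp flip: nat_pow_consistent)
  qed
  show ?thesis using that[of T] TZ Tm Tz by blast
qed

text \<open>The transfer sends \<open>z\<close> to a power of \<open>z\<close> with exponent prime to \<open>p\<close>, but its values are products of
  commuting \<open>p'\<close>-elements.\<close>

lemma central_p_elems_trivial: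
  assumes p: "prime p"
    and gen: "\<And>K. subgroup K G \<Longrightarrow> (\<And>x. pp_elem G p x \<Longrightarrow> x \<in> K) \<Longrightarrow> carrier G \<subseteq> K"
    and cen: "\<And>x g. p_elem G p x \<Longrightarrow> g \<in> carrier G \<Longrightarrow> x \<otimes> g = g \<otimes> x"
    and z: "p_elem G p z"
  shows "z = \<one>"
proof -
  let ?Z = "{z \<in> carrier G. \<forall>g\<in>carrier G. z \<otimes> g = g \<otimes> z}"
  have Z: "subgroup ?Z G"
  proof (rule subgroupI)
    fix a assume a: "a \<in> ?Z"
    show "inv a \<in> ?Z"
      using a commutes_inv(2) by auto
    fix b assume b: "b \<in> ?Z"
    have "a \<otimes> b \<otimes> g = g \<otimes> (a \<otimes> b)" if g: "g \<in> carrier G" for g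
    proof -
      have c: "a \<in> carrier G" "b \<in> carrier G" "a \<otimes> g = g \<otimes> a" "b \<otimes> g = g \<otimes> b" using a b g by blast+
      then show ?thesis using g by (metis m_assoc)
    qed
    then show "a \<otimes> b \<in> ?Z" using a b by blast
  qed (auto intro: one_closed)
  obtain T where T: "\<And>g. g \<in> carrier G \<Longrightarrow> T g \<in> ?Z"
    "\<And>g h. g \<in> carrier G \<Longrightarrow> h \<in> carrier G \<Longrightarrow> T (g \<otimes> h) = T g \<otimes> T h"
    "\<And>z. z \<in> ?Z \<Longrightarrow> T z = z [^] card (rcosets ?Z)"
    using central_transfer[OF Z] by blast
  have Tc: "T g \<in> carrier G" if "g \<in> carrier G" for g using T(1)[OF that] by simp
  interpret T: group_hom G G T using T(2) Tc by unfold_locales (auto simp: hom_def)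
  have "subgroup {g \<in> carrier G. pp_elem G p (T g)} G"
  proof (rule subgroupI)
    fix a assume a: "a \<in> {g \<in> carrier G. pp_elem G p (T g)}"
    then show "inv a \<in> {g \<in> carrier G. pp_elem G p (T g)}" by (simp add: pp_elem_inv)
    fix b assume b: "b \<in> {g \<in> carrier G. pp_elem G p (T g)}"
    then show "a \<otimes> b \<in> {g \<in> carrier G. pp_elem G p (T g)}"
      using a T(1)[of a] by (simp add: pp_elem_mult_commuting)
  qed (auto intro!: exI[of _ \<one>])
  then have all: "pp_elem G p (T g)" if "g \<in> carrier G" for g
    using gen[of "{g \<in> carrier G. pp_elem G p (T g)}"] T.hom_pp_elem pp_elem_in_carrier that by blast
  have zZ: "z \<in> ?Z" using cen z p_elem_in_carrier by blast
  have zc: "z \<in> carrier G" using z by (rule p_elem_in_carrier)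
  have "pp_elem G p (z [^] card (rcosets ?Z))" using all[OF zc] unfolding T(3)[OF zZ] .
  then have 1: "z [^] card (rcosets ?Z) = \<one>" using p_elem_nat_pow[OF z] p_elem_and_pp_elem by blast
  have sZ: "?Z \<subseteq> carrier G" by auto
  have "card (rcosets ?Z) * card ?Z = card (carrier G)" using lagrange[OF Z] by (simp add: order_def)
  then have "card (rcosets ?Z) = card (carrier G) div card ?Z"
    using div_mult_self_is_m[OF card_sub_pos[OF Z], of "card (rcosets ?Z)"] by presburger
  moreover have "\<not> p dvd card (carrier G) div card ?Z"
    using cen p_elem_in_carrier by (intro coprime_index_if_p_elems_in[OF p subgroup_self Z sZ]) auto
  ultimately have nd: "\<not> p dvd card (rcosets ?Z)" by (simp only: not_False_eq_True)
  have "coprime (card (rcosets ?Z)) p" using prime_imp_coprime[OF p nd] by (simp only: coprime_commute)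
  then have "pp_elem G p z" using 1 zZ unfolding pp_elem_def by blast
  then show ?thesis using z p_elem_and_pp_elem by blast
qed

text \<open>This is \<open>central_p_elems_trivial\<close> in G/N. A p-element of the quotient may
  be given by a representative a that is not a p-element; then its p-part a^m represents the same
  coset, because a a^-m is a p'-element whose image is a p-element, so it lies in N.\<close>

lemma central_p_elems_mod_normal:
  assumes p: "prime p" and N: "N \<lhd> G"
    and gen: "\<And>K. subgroup K G \<Longrightarrow> (\<And>x. pp_elem G p x \<Longrightarrow> x \<in> K) \<Longrightarrow> carrier G \<subseteq> K"
    and cen: "\<And>x g. p_elem G p x \<Longrightarrow> g \<in> carrier G \<Longrightarrow> comm x g \<in> N"
    and z: "p_elem G p z"
  shows "z \<in> N"
proof -
  interpret N: normal N G by fact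
  let ?Q = "G Mod N" and ?\<pi> = "\<lambda>a. N #> a"
  interpret Q: group ?Q by (rule N.factorgroup_is_group)
  interpret \<pi>: group_hom G ?Q ?\<pi> using N.r_coset_hom_Mod by unfold_locales
  have carQ: "carrier ?Q = ?\<pi> ` carrier G" by (rule carrier_FactGroup)
  interpret Q: fin_group ?Q by unfold_locales (simp add: carQ)
  have ker: "?\<pi> a = \<one>\<^bsub>?Q\<^esub> \<longleftrightarrow> a \<in> N" if "a \<in> carrier G" for a
    using that coset_join1 coset_join2 N.is_subgroup by (metis N.subset one_FactGroup)
  obtain m where m: "\<And>x. x \<in> carrier G \<Longrightarrow> p_elem G p (x [^] (m::nat))"
    "\<And>x. x \<in> carrier G \<Longrightarrow> pp_elem G p (x \<otimes> inv (x [^] m))"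
    using p_part_exponent[OF p] by metis
  have lift: "?\<pi> a = ?\<pi> (a [^] m)" if a: "a \<in> carrier G" "p_elem ?Q p (?\<pi> a)" for a
  proof -
    let ?b = "a \<otimes> inv (a [^] m)"
    have 1: "?\<pi> ?b = ?\<pi> a \<otimes>\<^bsub>?Q\<^esub> inv\<^bsub>?Q\<^esub> (?\<pi> a [^]\<^bsub>?Q\<^esub> m)"
      using a by (simp only: \<pi>.hom_mult \<pi>.hom_inv \<pi>.hom_nat_pow nat_pow_closed inv_closed)
    have "p_elem ?Q p (?\<pi> ?b)"
      unfolding 1
    proof (rule Q.p_elem_mult_commuting)
      have c: "?\<pi> a \<in> carrier ?Q" using a Q.p_elem_in_carrier by blast
      have "?\<pi> a \<otimes>\<^bsub>?Q\<^esub> (?\<pi> a [^]\<^bsub>?Q\<^esub> m) = (?\<pi> a [^]\<^bsub>?Q\<^esub> m) \<otimes>\<^bsub>?Q\<^esub> ?\<pi> a"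
        using Q.nat_pow_Suc2[OF c] by (simp del: mult_FactGroup)
      then show "?\<pi> a \<otimes>\<^bsub>?Q\<^esub> inv\<^bsub>?Q\<^esub> (?\<pi> a [^]\<^bsub>?Q\<^esub> m) = inv\<^bsub>?Q\<^esub> (?\<pi> a [^]\<^bsub>?Q\<^esub> m) \<otimes>\<^bsub>?Q\<^esub> ?\<pi> a"
        using c by (intro Q.commutes_inv Q.nat_pow_closed)
    qed (use a Q.p_elem_inv Q.p_elem_nat_pow in blast)+
    moreover have "pp_elem ?Q p (?\<pi> ?b)" using m(2)[OF a(1)] \<pi>.hom_pp_elem by blast
    ultimately have "?\<pi> ?b = \<one>\<^bsub>?Q\<^esub>" using Q.p_elem_and_pp_elem by blast
    then have "?b \<in> N" using a ker[of ?b] by blast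
    then show ?thesis using a by (metis N.rcos_module_imp N.is_subgroup inv_closed nat_pow_closed repr_independence N.rcos_module is_group)
  qed
  have "?\<pi> z = \<one>\<^bsub>?Q\<^esub>"
  proof (rule Q.central_p_elems_trivial[OF p])
    show "p_elem ?Q p (?\<pi> z)" using z by (rule \<pi>.hom_p_elem)
  next
    fix y h assume y: "p_elem ?Q p y" and h: "h \<in> carrier ?Q"
    obtain a where a: "a \<in> carrier G" "y = ?\<pi> a" using y Q.p_elem_in_carrier carQ by blast
    obtain g where g: "g \<in> carrier G" "h = ?\<pi> g" using h carQ by blast
    let ?c = "a [^] m"
    have "comm ?c g \<in> N" using cen m(1) a(1) g(1) by blast
    then have "\<one>\<^bsub>?Q\<^esub> = ?\<pi> (comm ?c g)" using ker[of "comm ?c g"] a g by (metis inv_closed m_closed nat_pow_closed)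
    also have "\<dots> = ?\<pi> ?c \<otimes>\<^bsub>?Q\<^esub> ?\<pi> g \<otimes>\<^bsub>?Q\<^esub> inv\<^bsub>?Q\<^esub> ?\<pi> ?c \<otimes>\<^bsub>?Q\<^esub> inv\<^bsub>?Q\<^esub> ?\<pi> g"
      using a g by (simp only: \<pi>.hom_mult \<pi>.hom_inv nat_pow_closed inv_closed m_closed)
    finally have "?\<pi> ?c \<otimes>\<^bsub>?Q\<^esub> ?\<pi> g = ?\<pi> g \<otimes>\<^bsub>?Q\<^esub> ?\<pi> ?c"
      using Q.conj_eq_iff_comm(2)[of "?\<pi> ?c" "?\<pi> g"] a g by (metis \<pi>.hom_closed nat_pow_closed)
    then show "y \<otimes>\<^bsub>?Q\<^esub> h = h \<otimes>\<^bsub>?Q\<^esub> y" using lift[OF a(1)] y a g by metis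
  next
    fix K assume K: "subgroup K ?Q" and pK: "\<And>x. pp_elem ?Q p x \<Longrightarrow> x \<in> K"
    interpret K: subgroup K ?Q by fact
    let ?L = "{g \<in> carrier G. ?\<pi> g \<in> K}"
    have "subgroup ?L G"
    proof (rule subgroupI)
      have "?\<pi> \<one> \<in> K" using K.one_closed \<pi>.hom_one by metis
      then show "?L \<noteq> {}" by blast
      fix a assume a: "a \<in> ?L"
      then have "?\<pi> (inv a) \<in> K" using K.m_inv_closed \<pi>.hom_inv by fastforce
      then show "inv a \<in> ?L" using a by blast
      fix b assume b: "b \<in> ?L"
      then have "?\<pi> (a \<otimes> b) \<in> K" using a K.m_closed \<pi>.hom_mult by fastforce
      then show "a \<otimes> b \<in> ?L" using a b by blast
    qed blast
    moreover have "x \<in> ?L" if "pp_elem G p x" for x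
      using pK[OF \<pi>.hom_pp_elem[OF that]] pp_elem_in_carrier[OF that] by blast
    ultimately have "carrier G \<subseteq> ?L" by (rule gen)
    then show "carrier ?Q \<subseteq> K" unfolding carQ by blast
  qed
  then show ?thesis using ker z p_elem_in_carrier by blast
qed

end

section \<open>Elements normalising a cyclic subgroup\<close>

lemma one_mod_prime_power_lift:
  fixes j :: int
  assumes p: "prime (p::nat)" and 1: "int p dvd j - 1" and n: "int (p ^ m) dvd j ^ n - 1" and pn: "\<not> p dvd n"
  shows "int (p ^ m) dvd j - 1"
proof -
  have eq: "j ^ n - 1 = (j - 1) * (\<Sum>i<n. j ^ i)" by (rule power_diff_1_eq)
  have "int p dvd j ^ i - 1" for i
    using 1 by (metis dvd_mult2 power_diff_1_eq)
  \<comment> \<open>Modulo p every term of the geometric sum is 1, so the sum is n there and hence a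
    unit modulo p^m.\<close>
  then have "int p dvd (\<Sum>i<n. j ^ i - 1)" by (simp add: dvd_sum)
  then have "int p dvd (\<Sum>i<n. j ^ i) - int n" by (simp add: sum_subtractf)
  then have "\<not> int p dvd (\<Sum>i<n. j ^ i)"
    using pn by (metis dvd_diff_right_iff int_dvd_int_iff dvd_diffD1 minus_diff_eq dvd_minus_iff dvd_diff_commute)
  then have "coprime (int (p ^ m)) (\<Sum>i<n. j ^ i)"
    using p by (simp add: prime_imp_coprime)
  then show ?thesis using n unfolding eq by (simp add: coprime_dvd_mult_left_iff)
qed

lemma fermat_int:
  fixes s :: int
  assumes p: "prime (p::nat)" and s: "\<not> int p dvd s"
  shows "int p dvd s ^ (p - 1) - 1"
proof -
  have p0: "int p > 0" using p by (simp add: prime_gt_0_nat)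
  define t where "t = nat (s mod int p)"
  have t: "int t = s mod int p" unfolding t_def using p0 by simp
  have "\<not> p dvd t" using s p0 t by (metis dvd_mod_iff dvd_refl int_dvd_int_iff)
  then have "[t ^ (p - 1) = 1] (mod p)" using fermat_theorem p by blast
  then have "[int t ^ (p - 1) = 1] (mod int p)" by (metis cong_int_iff of_nat_1 of_nat_power)
  moreover have "[int t ^ (p - 1) = s ^ (p - 1)] (mod int p)"
    unfolding t by (intro cong_pow) (simp add: cong_def)
  ultimately show ?thesis by (metis cong_iff_dvd_diff cong_sym cong_trans)
qed

lemma power_prime_cong_one:
  fixes s :: int
  assumes p: "prime (p::nat)" and 1: "int p dvd s ^ p - 1"
  shows "int p dvd s - 1"
proof -
  have "\<not> int p dvd s"
  proof
    assume "int p dvd s"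
    then have "int p dvd s ^ p" using p by (simp add: dvd_power_same dvd_power prime_gt_0_nat dvd_trans)
    then have "int p dvd s ^ p - (s ^ p - 1)" using 1 by (rule dvd_diff)
    then have "int p dvd 1" by simp
    then show False using p by (simp add: prime_gt_1_nat)
  qed
  then have "int p dvd s * (s ^ (p - 1) - 1)" using fermat_int[OF p] by simp
  moreover have "s * s ^ (p - 1) = s ^ p" using p by (metis power_minus_mult mult.commute prime_gt_0_nat)
  ultimately have "int p dvd s ^ p - s" by (simp add: right_diff_distrib)
  then have "int p dvd (s ^ p - 1) - (s ^ p - s)" using 1 dvd_diff by blast
  then show ?thesis by simp
qed

lemma coprime_exponents_cong_one:
  fixes s :: int
  assumes "d dvd s ^ a - 1" "d dvd s ^ b - 1" "coprime a b"
  shows "d dvd s - 1"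
proof (cases "a = 0")
  case True
  then show ?thesis using assms by simp
next
  case False
  obtain u v where uv: "a * u = b * v + gcd a b" using bezout_nat[OF False] by blast
  then have uv: "a * u = b * v + 1" using assms(3) by simp
  have "d dvd s ^ (a * u) - 1" using assms(1) by (metis dvd_mult2 power_diff_1_eq power_mult)
  then have 1: "d dvd s ^ (b * v) * s - 1" using uv by (simp add: mult.commute)
  have "d dvd s ^ (b * v) - 1" using assms(2) by (metis dvd_mult2 power_diff_1_eq power_mult)
  then have "d dvd (s ^ (b * v) - 1) * s" by simp
  with 1 have "d dvd (s ^ (b * v) * s - 1) - (s ^ (b * v) - 1) * s" by (rule dvd_diff)
  then show ?thesis by (simp add: algebra_simps)
qed

text \<open>The step of lifting the exponent that fails for \<open>p = 2\<close>.\<close>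

lemma prime_power_dvd_lift:
  fixes s :: int
  assumes p: "prime (p::nat)" "odd p" and 1: "int p dvd s - 1" and m: "int (p ^ m) dvd s ^ p - 1"
  shows "int (p ^ m) dvd int p * (s - 1)"
proof -
  obtain t where t: "s - 1 = int p * t" using 1 by blast
  let ?P = "int p"
  have s: "\<exists>c. s ^ i = 1 + int i * (?P * t) + ?P ^ 2 * c" for i
  proof (induction i)
    case (Suc i)
    then obtain c where c: "s ^ i = 1 + int i * (?P * t) + ?P ^ 2 * c" by blast
    have "s = 1 + ?P * t" using t by simp
    then have "s ^ Suc i = (1 + ?P * t) * (1 + int i * (?P * t) + ?P ^ 2 * c)" using c by simp
    also have "\<dots> = 1 + int (Suc i) * (?P * t) + ?P ^ 2 * (c + int i * t * t + ?P * t * c)"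
      by (simp add: algebra_simps power2_eq_square)
    finally show ?case by blast
  qed (auto intro: exI[of _ 0])
  then obtain c where c: "\<And>i. s ^ i = 1 + int i * (?P * t) + ?P ^ 2 * c i" by metis
  \<comment> \<open>Oddness makes 0 + 1 + ... + (p - 1) = h p a multiple of p, so the geometric sum
    of s is p times an integer prime to p.\<close>
  obtain h where h: "p = 2 * h + 1" using p(2) by (rule oddE)
  have "(\<Sum>i<p. int i) = int h * ?P"
  proof -
    have "2 * (\<Sum>i<k. int i) = int k * (int k - 1)" for k by (induction k) (auto simp: algebra_simps)
    from this[of p] have "2 * (\<Sum>i<p. int i) = 2 * (int h * ?P)" by (simp add: h algebra_simps)
    then show ?thesis by simp
  qed
  then have "(\<Sum>i<p. s ^ i) = ?P + int h * ?P * (?P * t) + ?P ^ 2 * (\<Sum>i<p. c i)"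
    by (simp add: c sum.distrib sum_distrib_left flip: sum_distrib_right)
  then have S: "(\<Sum>i<p. s ^ i) = ?P * (1 + ?P * (int h * t + (\<Sum>i<p. c i)))"
    by (simp add: algebra_simps power2_eq_square)
  let ?u = "1 + ?P * (int h * t + (\<Sum>i<p. c i))"
  have "coprime ?P ?u"
  proof (rule coprimeI)
    fix d assume "d dvd ?P" "d dvd ?u"
    then show "is_unit d" using dvd_add_left_iff[of d "?P * (int h * t + (\<Sum>i<p. c i))" 1] dvd_mult2 by blast
  qed
  then have "coprime (int (p ^ m)) ?u" by simp
  moreover have "s ^ p - 1 = (?P * (s - 1)) * ?u" using power_diff_1_eq[of s p] S by simp
  ultimately show ?thesis using m by (metis coprime_dvd_mult_left_iff)
qed

text \<open>The element b normalises <a>, with the induced automorphism recorded as an exponent: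
  automorphisms of a cyclic group become integers modulo the order of a, and their composition
  becomes multiplication.\<close>

definition normalises :: "('a, 'b) monoid_scheme \<Rightarrow> 'a \<Rightarrow> 'a \<Rightarrow> bool" where
  "normalises G b a \<longleftrightarrow> (\<exists>i::int. b \<otimes>\<^bsub>G\<^esub> a \<otimes>\<^bsub>G\<^esub> inv\<^bsub>G\<^esub> b = a [^]\<^bsub>G\<^esub> i)"

context group begin

lemma commutes_int_pow:
  assumes "x \<in> carrier G" "y \<in> carrier G" "x \<otimes> y = y \<otimes> x"
  shows "x [^] (i::int) \<otimes> y = y \<otimes> x [^] i"
proof -
  have "x [^] n \<otimes> y = y \<otimes> x [^] n" for n :: nat using group_commutes_pow assms by blast
  then show ?thesis
  proof (cases i rule: int_cases2)
    case (nonpos n)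
    then show ?thesis using commutes_inv(2)[OF nat_pow_closed[OF assms(1)] assms(2), of n] \<open>x [^] n \<otimes> y = y \<otimes> x [^] n\<close> assms(1)
      by (simp add: int_pow_neg_int)
  qed (simp add: int_pow_int)
qed

lemma conj_inv_eq:
  assumes "g \<in> carrier G" "x \<in> carrier G" "y \<in> carrier G"
  shows "conj g x = y \<longleftrightarrow> x = conj (inv g) y"
proof
  show "conj g x = y \<Longrightarrow> x = conj (inv g) y" using assms by (auto simp: conj_conj[symmetric] grp_word)
  show "x = conj (inv g) y \<Longrightarrow> conj g x = y" using assms by (auto simp: grp_word)
qed

lemma conj_pow_pow:
  assumes "b \<in> carrier G" "a \<in> carrier G" "conj b a = a [^] (i::int)"
  shows "conj (b [^] (n::nat)) a = a [^] (i ^ n)"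
proof (induction n)
  case 0
  then show ?case using assms by simp
next
  case (Suc n)
  have "conj (b [^] Suc n) a = conj (b [^] n) (conj b a)" using assms(1,2) by (simp add: grp_word)
  also have "\<dots> = (conj (b [^] n) a) [^] i" using assms by (simp add: conj_int_pow)
  also have "\<dots> = a [^] (i ^ Suc n)" using Suc assms by (simp add: int_pow_pow mult.commute)
  finally show ?case .
qed

lemma normalises_mult:
  assumes "b \<in> carrier G" "c \<in> carrier G" "a \<in> carrier G" "normalises G b a" "normalises G c a"
  shows "normalises G (b \<otimes> c) a"
proof -
  obtain i j :: int where ij: "conj b a = a [^] i" "conj c a = a [^] j" using assms(4,5) unfolding normalises_def by blast
  have "conj (b \<otimes> c) a = conj b (a [^] j)" using assms(1-3) ij(2) by (simp flip: conj_conj)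
  also have "\<dots> = (a [^] i) [^] j" using assms(1-3) ij(1) conj_int_pow by metis
  finally show ?thesis unfolding normalises_def using assms(3) by (auto simp: int_pow_pow)
qed

lemma normalises_conj:
  assumes "g \<in> carrier G" "b \<in> carrier G" "a \<in> carrier G"
  shows "normalises G b (conj g a) \<longleftrightarrow> normalises G (conj (inv g) b) a"
proof -
  have "conj b (conj g a) = conj g a [^] i \<longleftrightarrow> conj (conj (inv g) b) a = a [^] i" for i :: int
  proof -
    have "conj b (conj g a) = conj g a [^] i \<longleftrightarrow> conj b (conj g a) = conj g (a [^] i)" using assms by (simp add: conj_int_pow)
    also have "\<dots> \<longleftrightarrow> a [^] i = conj (inv g) (conj b (conj g a))" using conj_inv_eq[of g "a [^] i" "conj b (conj g a)"] assms by auto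
    also have "conj (inv g) (conj b (conj g a)) = conj (conj (inv g) b) a" using assms by (simp add: grp_word)
    finally show ?thesis by metis
  qed
  then show ?thesis unfolding normalises_def by simp
qed

lemma normalises_self_pow: "a \<in> carrier G \<Longrightarrow> normalises G (a [^] (k::int)) a"
  unfolding normalises_def
proof (rule exI[of _ 1])
  assume a: "a \<in> carrier G"
  then have "a [^] k \<otimes> a = a \<otimes> a [^] k" using commutes_int_pow by blast
  then have "conj (a [^] k) a = a" using a conj_eq_iff_comm(1) by blast
  then show "conj (a [^] k) a = a [^] (1::int)" using a by (simp only: int_pow_1)
qed

text \<open>Modulo <a> only w counts, and w moves powers of a to powers of a.\<close>

lemma normalised_mult_pow:
  assumes "w \<in> carrier G" "a \<in> carrier G" "normalises G w a"
  shows "\<exists>u::int. (a [^] (s::int) \<otimes> w) [^] (n::nat) = a [^] u \<otimes> w [^] n"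
proof (induction n)
  case 0
  then show ?case using assms by (intro exI[of _ 0]) simp
next
  case (Suc n)
  then obtain u :: int where u: "(a [^] s \<otimes> w) [^] n = a [^] u \<otimes> w [^] n" by blast
  obtain i :: int where i: "conj w a = a [^] i" using assms unfolding normalises_def by blast
  have 1: "w [^] n \<otimes> a [^] s = a [^] (i ^ n * s) \<otimes> w [^] n"
  proof -
    have "conj (w [^] n) (a [^] s) = a [^] (i ^ n * s)"
      using conj_pow_pow[OF assms(1,2) i, of n] assms by (metis conj_int_pow int_pow_pow nat_pow_closed)
    then have "conj (w [^] n) (a [^] s) \<otimes> w [^] n = a [^] (i ^ n * s) \<otimes> w [^] n" by simp
    then show ?thesis using assms by (simp add: m_assoc)
  qed
  have "(a [^] s \<otimes> w) [^] Suc n = a [^] u \<otimes> (w [^] n \<otimes> a [^] s) \<otimes> w" using u assms by (simp add: m_assoc)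
  also have "\<dots> = a [^] (u + i ^ n * s) \<otimes> w [^] Suc n" unfolding 1 using assms by (simp add: m_assoc int_pow_mult)
  finally show ?case by blast
qed

end

context fin_group begin

lemma normalises_inv:
  assumes "b \<in> carrier G" "a \<in> carrier G" "normalises G b a"
  shows "normalises G (inv b) a"
proof -
  obtain i :: int where i: "conj b a = a [^] i" using assms unfolding normalises_def by blast
  have "ord b > 0" using ord_ge_1[OF fin assms(1)] by simp
  then have "b [^] (ord b - 1) \<otimes> b = \<one>" using assms(1) pow_ord_eq_1 by (metis Suc_pred' nat_pow_Suc)
  then have "inv b = b [^] (ord b - 1)" using assms(1) by (metis inv_equality nat_pow_closed)
  then show ?thesis using conj_pow_pow[OF assms(1,2) i, of "ord b - 1"] unfolding normalises_def by metis
qed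

lemma normalises_int_pow:
  assumes "b \<in> carrier G" "a \<in> carrier G" "normalises G b a"
  shows "normalises G (b [^] (k::int)) a"
proof -
  have n: "normalises G (c [^] n) a" if "c \<in> carrier G" "normalises G c a" for c and n :: nat
    using that conj_pow_pow assms(2) unfolding normalises_def by metis
  have "normalises G (b [^] m) a" "normalises G (inv (b [^] m)) a" for m :: nat
    using n[OF assms(1,3)] normalises_inv[OF nat_pow_closed[OF assms(1)] assms(2)] by blast+
  then show ?thesis using assms(1) by (cases k rule: int_cases2) (simp_all add: int_pow_int int_pow_neg_int)
qed

text \<open>The automorphism group of a cyclic group is abelian: on <x> both orders of composition
  have the exponent s t.\<close>

lemma normalising_commutator_centralises:
  assumes c: "g \<in> carrier G" "h \<in> carrier G" "x \<in> carrier G" and n: "normalises G g x" "normalises G h x"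
  shows "comm g h \<otimes> x = x \<otimes> comm g h"
proof -
  obtain s t :: int where st: "conj (inv g) x = x [^] s" "conj (inv h) x = x [^] t"
    using normalises_inv[OF c(1,3) n(1)] normalises_inv[OF c(2,3) n(2)] unfolding normalises_def by blast
  have 1: "conj (inv g) (conj (inv h) x) = x [^] (s * t)" 
    using st c by (metis conj_int_pow int_pow_pow inv_closed)
  have 2: "conj (inv h) (conj (inv g) x) = x [^] (s * t)" 
    using st c by (metis conj_int_pow int_pow_pow inv_closed mult.commute)
  have "conj (comm g h) x = conj g (conj h (conj (inv g) (conj (inv h) x)))" using c by (simp add: grp_word)
  also have "\<dots> = conj g (conj h (conj (inv h) (conj (inv g) x)))" using 1 2 by simp
  also have "\<dots> = x" using c by (simp add: grp_word)
  finally show ?thesis using c conj_eq_iff_comm by (metis inv_closed m_closed)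
qed

lemma ord_p_elem:
  assumes "prime p" "p_elem G p x"
  obtains m where "ord x = p ^ m"
proof -
  obtain k where "x [^] (p ^ k) = \<one>" "x \<in> carrier G" using assms(2) unfolding p_elem_def by blast
  then have "ord x dvd p ^ k" using pow_eq_id by blast
  then show ?thesis using that divides_primepow_nat[OF assms(1)] by blast
qed

lemma prime_dvd_ord:
  assumes "prime p" "p_elem G p x" "x \<noteq> \<one>"
  shows "p dvd ord x"
proof -
  obtain m where m: "ord x = p ^ m" using ord_p_elem assms by blast
  then have "m \<noteq> 0" using assms ord_eq_1[OF p_elem_in_carrier[OF assms(2)]] by (metis power_0)
  then show ?thesis using m by simp
qed

lemma p_elem_prime_dvd:
  assumes "prime r" "subgroup S G" "x \<in> S" "p_elem G r x" "x \<noteq> \<one>"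
  shows "r dvd card S"
proof -
  have xc: "x \<in> carrier G" using assms(4) by (rule p_elem_in_carrier)
  have "card (generate G {x}) dvd card S"
    using assms(2,3) xc by (intro sub_card_dvd generate_is_subgroup generate_subgroup_incl) auto
  moreover have "card (generate G {x}) = ord x" using generate_pow_card[OF xc] by simp
  ultimately show ?thesis using prime_dvd_ord[OF assms(1,4,5)] dvd_trans by metis
qed

lemma p_elem_generator:
  fixes j :: int
  assumes p: "prime p" and x: "p_elem G p x" and j: "\<not> int p dvd j"
  obtains l :: int where "x = (x [^] j) [^] l"
proof -
  have xc: "x \<in> carrier G" using x by (rule p_elem_in_carrier)
  obtain m where m: "ord x = p ^ m" using ord_p_elem p x by blast
  have "coprime (int p) j" using p j by (intro prime_imp_coprime) auto
  then have "coprime j (int (ord x))" using m by (simp add: coprime_commute)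
  then obtain l where "[j * l = 1] (mod int (ord x))" using cong_solve_coprime_int by blast
  then have "x [^] (j * l) = x [^] (1::int)" using int_pow_eq[OF xc] by (metis cong_iff_dvd_diff dvd_diff_commute)
  then show ?thesis using that[of l] xc by (simp add: int_pow_pow)
qed

text \<open>An automorphism of <a> with exponent 1 modulo p has p-power order, whereas b induces one
  of r-power order.\<close>

lemma p_elem_conj_trivial:
  fixes i :: int
  assumes p: "prime p" "prime r" "p \<noteq> r" and a: "p_elem G p a" and b: "p_elem G r b"
    and i: "conj b a = a [^] i" "int p dvd i - 1"
  shows "b \<otimes> a = a \<otimes> b"
proof -
  have c: "a \<in> carrier G" "b \<in> carrier G" using a b by (auto simp: p_elem_in_carrier)
  obtain m where m: "ord a = p ^ m" using ord_p_elem p a by blast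
  obtain k where k: "b [^] (r ^ k) = \<one>" using b unfolding p_elem_def by blast
  have "a [^] (1::int) = a [^] (i ^ (r ^ k))" using conj_pow_pow[OF c(2,1) i(1), of "r ^ k"] k c by simp
  then have "int (p ^ m) dvd i ^ (r ^ k) - 1" using int_pow_eq[OF c(1)] m by metis
  moreover have "\<not> p dvd r ^ k" using p by (metis prime_dvd_power primes_dvd_imp_eq)
  ultimately have "int (p ^ m) dvd i - 1" using one_mod_prime_power_lift p i(2) by blast
  then have "a [^] (1::int) = a [^] i" using int_pow_eq[OF c(1)] m by metis
  then show ?thesis using i(1) c conj_eq_iff_comm(1) by (metis int_pow_1)
qed

text \<open>Permutability writes a^j b as b^c a^d, and c matters only modulo q because b^q is in H;
  this gives f j < q with b^(-f j) a^j b in H. Two indices j < l < p with the same value yield b^-1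
  a^(l-j) b in H, and a^(l-j) generates <a>.\<close>

lemma cyclic_permuting_pigeonhole:
  assumes p: "prime p" and a: "p_elem G p a" and b: "b \<in> carrier G"
    and perm: "generate G {a} <#> generate G {b} = generate G {b} <#> generate G {a}"
    and H: "subgroup H G" "a \<in> H" "b [^] q \<in> H" and q: "0 < q" "q < p \<or> q = p \<and> b \<notin> H"
  shows "conj (inv b) a \<in> H"
proof -
  have ac: "a \<in> carrier G" using a by (rule p_elem_in_carrier)
  interpret H: subgroup H G by fact
  have ex: "\<exists>c. c < q \<and> inv (b [^] c) \<otimes> (a [^] j \<otimes> b) \<in> H" for j :: nat
  proof -
    have "a [^] int j \<otimes> b [^] (1::int) \<in> generate G {a} <#> generate G {b}"
      using generate_pow[OF ac] generate_pow[OF b] by (intro set_multI) blast+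
    then have "a [^] j \<otimes> b \<in> generate G {b} <#> generate G {a}" using perm b by (simp add: int_pow_int)
    then obtain c d :: int where cd: "a [^] j \<otimes> b = b [^] c \<otimes> a [^] d"
      using generate_pow[OF ac] generate_pow[OF b] by (auto elim!: set_multE)
    define e where "e = nat (c mod int q)"
    have e: "int e = c mod int q" using q unfolding e_def by simp
    have c: "c = int e + int q * (c div int q)" using e by simp
    have "b [^] c = b [^] e \<otimes> (b [^] q) [^] (c div int q)"
      by (subst c) (simp add: int_pow_mult int_pow_int b flip: int_pow_pow)
    then have "inv (b [^] e) \<otimes> (a [^] j \<otimes> b) = (b [^] q) [^] (c div int q) \<otimes> a [^] d"
      using cd ac b by (simp add: m_assoc)
    moreover have "(b [^] q) [^] (c div int q) \<otimes> a [^] d \<in> H"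
      using H by (simp add: subgroup_int_pow_closed)
    moreover have "e < q" using e q by (metis of_nat_0_less_iff of_nat_less_iff pos_mod_bound)
    ultimately show ?thesis by metis
  qed
  have "\<exists>f. \<forall>j::nat. f j < q \<and> inv (b [^] f j) \<otimes> (a [^] j \<otimes> b) \<in> H"
    by (rule choice) (use ex in blast)
  then obtain f where f': "\<forall>j. f j < q \<and> inv (b [^] f j) \<otimes> (a [^] (j::nat) \<otimes> b) \<in> H" ..
  then have f: "\<And>j. f j < q" "\<And>j. inv (b [^] f j) \<otimes> (a [^] j \<otimes> b) \<in> H" by blast+
  have "\<not> inj_on f {..<p}"
  proof
    assume inj: "inj_on f {..<p}"
    consider "q < p" | "q = p" "b \<notin> H" using q by blast
    then show False
    proof cases
      case 1
      have "card {..<p} \<le> card {..<q}" using inj f(1) by (intro card_inj_on_le) auto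
      then show False using 1 by simp
    next
      case 2
      \<comment> \<open>When q = p there are as many values as indices; the value 0 is excluded
        because it would put b into H, and this leaves p - 1 values.\<close>
      have "f j \<noteq> 0" for j
      proof
        assume "f j = 0"
        then have "a [^] j \<otimes> b \<in> H" using f(2)[of j] ac b by simp
        then have "inv (a [^] j) \<otimes> (a [^] j \<otimes> b) \<in> H" using H sub_nat_pow_closed by (meson H.m_closed H.m_inv_closed)
        then show False using 2 ac b by simp
      qed
      then have "f ` {..<p} \<subseteq> {0<..<p}" using f(1) 2 by auto
      then have "card {..<p} \<le> card {0<..<p}" using inj by (intro card_inj_on_le) auto
      then show False using prime_gt_0_nat[OF p] by simp
    qed
  qed
  then obtain j l where jl: "j < l" "l < p" "f j = f l"
    unfolding inj_on_def by (metis lessThan_iff linorder_neqE_nat)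
  let ?u = "inv (b [^] f j) \<otimes> (a [^] j \<otimes> b)" and ?v = "inv (b [^] f j) \<otimes> (a [^] l \<otimes> b)"
  have "?u \<in> H" "?v \<in> H" using f(2) jl(3) by metis+
  then have "inv ?u \<otimes> ?v \<in> H" by simp
  moreover have "inv ?u \<otimes> ?v = inv b \<otimes> (inv (a [^] j) \<otimes> a [^] l) \<otimes> b" using ac b by (simp add: grp_word)
  moreover have "a [^] l = a [^] j \<otimes> a [^] (l - j)" using ac jl(1) by (simp add: nat_pow_mult)
  ultimately have 1: "conj (inv b) (a [^] (l - j)) \<in> H" using ac b by (simp add: m_assoc)
  have "\<not> p dvd l - j" using jl by (auto dest: dvd_imp_le)
  then have "\<not> int p dvd int (l - j)" by (simp only: int_dvd_int_iff not_False_eq_True)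
  then obtain t :: int where "a = (a [^] int (l - j)) [^] t" using p_elem_generator[OF p a] by blast
  then have "conj (inv b) a = (conj (inv b) (a [^] (l - j))) [^] t"
    using ac b conj_int_pow by (metis int_pow_int inv_closed nat_pow_closed)
  then show ?thesis using 1 H subgroup_int_pow_closed by metis
qed

end

section \<open>Two totally permutable subgroups\<close>

lemma (in group) commutes_mult:
  assumes "b \<in> carrier G" "x \<in> carrier G" "y \<in> carrier G" "b \<otimes> x = x \<otimes> b" "b \<otimes> y = y \<otimes> b"
  shows "b \<otimes> (x \<otimes> y) = (x \<otimes> y) \<otimes> b"
  using assms by (metis m_assoc)

lemma totally_permutable_sym: "totally_permutable G A B \<Longrightarrow> totally_permutable G B A"
  unfolding totally_permutable_def by metis

lemma (in fin_group) totally_permutable_subgroups: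
  "totally_permutable G A B \<Longrightarrow> subgroup C G \<Longrightarrow> C \<subseteq> A \<Longrightarrow> subgroup D G \<Longrightarrow> D \<subseteq> B \<Longrightarrow> C <#> D = D <#> C"
  unfolding totally_permutable_def by blast

locale tp_subgroups = fin_group +
  fixes A B
  assumes A: "subgroup A G" and B: "subgroup B G" and tp: "totally_permutable G A B"
begin

lemma swap: "tp_subgroups G B A"
  by (simp add: tp_subgroups_def tp_subgroups_axioms_def fin_group_axioms A B totally_permutable_sym[OF tp])

lemma A_carrier [simp]: "a \<in> A \<Longrightarrow> a \<in> carrier G"
  using subgroup.mem_carrier[OF A] .

lemma B_carrier [simp]: "b \<in> B \<Longrightarrow> b \<in> carrier G"
  using subgroup.mem_carrier[OF B] .

lemma conj_in_A: "a \<in> A \<Longrightarrow> b \<in> A \<Longrightarrow> conj a b \<in> A"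
  using A by (simp add: subgroup.m_closed subgroup.m_inv_closed)

lemma cyclic_permute:
  assumes "a \<in> A" "b \<in> B"
  shows "generate G {a} <#> generate G {b} = generate G {b} <#> generate G {a}"
  using assms A B
  by (intro totally_permutable_subgroups[OF tp] generate_is_subgroup generate_subgroup_incl) auto

text \<open>Induction on the order of b. By pigeonhole b^-1 a b lies in <a><b^q>, say it is a^s w
  with w a power of b^q, which normalises <a> by induction. Raising the p-element a^s w to a
  suitable power of p puts a p-power of the q-element w into <a>; this forces w = 1.\<close>

lemma larger_prime_normalised:
  assumes p: "prime p" "prime q" "q < p" and a: "a \<in> A" "p_elem G p a" and b: "b \<in> B" "p_elem G q b"
  shows "normalises G b a"
proof -
  obtain k where "b [^] (q ^ k) = \<one>" using b unfolding p_elem_def by blast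
  then show ?thesis using b
  proof (induction k arbitrary: b)
    case 0
    then have "b = a [^] (0::int)" by simp
    then show ?case using normalises_self_pow[of a 0] a by simp
  next
    case (Suc k)
    let ?c = "b [^] q"
    have c: "?c \<in> B" "p_elem G q ?c" using Suc.prems sub_nat_pow_closed[OF B] p_elem_nat_pow by auto
    have "?c [^] (q ^ k) = \<one>" using Suc.prems by (simp add: nat_pow_pow)
    then have nc: "normalises G ?c a" using Suc.IH c by blast
    let ?H = "generate G {a} <#> generate G {?c}"
    have s: "subgroup (generate G {a}) G" "subgroup (generate G {?c}) G"
      using a Suc.prems by (auto intro!: generate_is_subgroup)
    have H: "subgroup ?H G" using set_mult_permute_subgroup[OF s cyclic_permute[OF a(1) c(1)]] .
    have "a \<in> ?H" "?c \<in> ?H" using set_mult_subset_left[OF s] by (auto intro: generate.incl)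
    then have "conj (inv b) a \<in> ?H"
      using cyclic_permuting_pigeonhole[OF p(1) a(2) _ cyclic_permute[OF a(1) Suc.prems(2)] H] Suc.prems p prime_gt_0_nat by simp
    then obtain s t :: int where st: "conj (inv b) a = a [^] s \<otimes> ?c [^] t"
      using generate_pow[of a] generate_pow[of ?c] a c by (auto elim!: set_multE)
    let ?w = "?c [^] t"
    have wc: "?w \<in> carrier G" using c by simp
    have nw: "normalises G ?w a" using normalises_int_pow nc a c by simp
    have "p_elem G p (conj (inv b) a)" using p_elem_conj[OF a(2), of "inv b"] Suc.prems by simp
    then obtain m where m: "(a [^] s \<otimes> ?w) [^] (p ^ m) = \<one>" unfolding st p_elem_def by blast
    obtain u :: int where "(a [^] s \<otimes> ?w) [^] (p ^ m) = a [^] u \<otimes> ?w [^] (p ^ m)"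
      using normalised_mult_pow[OF wc _ nw] a by fastforce
    then have "inv (a [^] u) = ?w [^] (p ^ m)" using m wc a by (metis A_carrier inv_equality inv_inv int_pow_closed inv_closed nat_pow_closed)
    then have "?w [^] (p ^ m) = inv (a [^] u)" by simp
    then have "p_elem G p (?w [^] (p ^ m))" using a p_elem_int_pow p_elem_inv by metis
    moreover have wq: "p_elem G q ?w" using c p_elem_int_pow by blast
    ultimately have "?w [^] (p ^ m) = \<one>" using p_elem_two_primes p p_elem_nat_pow by blast
    then have "p_elem G p ?w" unfolding p_elem_def using wc by blast
    then have "?w = \<one>" using p_elem_two_primes p wq by blast
    then have "normalises G (inv b) a" unfolding normalises_def using st a by auto
    then show ?case using normalises_inv[of "inv b" a] Suc.prems a by simp
  qed
qed

text \<open>The exponent by which b acts on <a> has, modulo p, an order dividing both a power of q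
  and p - 1, hence is 1 modulo p.\<close>

lemma larger_prime_commute:
  assumes p: "prime p" "prime q" "q < p" and a: "a \<in> A" "p_elem G p a" and b: "b \<in> B" "p_elem G q b"
    and nd: "\<not> q dvd p - 1"
  shows "b \<otimes> a = a \<otimes> b"
proof (cases "a = \<one>")
  case False
  obtain i :: int where i: "conj b a = a [^] i"
    using larger_prime_normalised assms unfolding normalises_def by blast
  obtain k where k: "b [^] (q ^ k) = \<one>" using b unfolding p_elem_def by blast
  have ac: "a \<in> carrier G" using a by simp
  have pd: "int p dvd int (ord a)" using prime_dvd_ord[OF p(1) a(2) False] by simp
  have "a [^] (1::int) = a [^] (i ^ (q ^ k))" using conj_pow_pow[OF B_carrier[OF b(1)] ac i, of "q ^ k"] k ac by simp
  then have "int (ord a) dvd i ^ (q ^ k) - 1" using int_pow_eq[OF ac] by metis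
  then have 1: "int p dvd i ^ (q ^ k) - 1" using pd dvd_trans by blast
  have "\<not> int p dvd i"
  proof
    assume "int p dvd i"
    then have "int p dvd i ^ (q ^ k)" using p(2) by (meson dvd_power dvd_trans prime_gt_0_nat zero_less_power)
    then have "int p dvd i ^ (q ^ k) - (i ^ (q ^ k) - 1)" using 1 by (rule dvd_diff)
    then show False using prime_gt_1_nat[OF p(1)] by simp
  qed
  then have 2: "int p dvd i ^ (p - 1) - 1" using fermat_int p(1) by blast
  have "coprime (q ^ k) (p - 1)" using p(2) nd by (simp add: prime_imp_coprime)
  then have "int p dvd i - 1" using coprime_exponents_cong_one[OF 1 2] by blast
  then show ?thesis using p_elem_conj_trivial[OF p(1,2) _ a(2) b(2) i] p(3) by blast
qed (use b in simp)

text \<open>A smaller-prime element of \<open>B\<close> moving \<open>x2\<close> makes \<open>x2\<close> a power of a commutator of two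
  elements normalising \<open>\<langle>x1\<rangle>\<close>, and automorphisms of a cyclic group commute.\<close>

lemma moved_elem_commutes:
  assumes pr: "prime p1" "prime p2" "prime r" "r < p1" "r < p2"
    and x1: "x1 \<in> A" "p_elem G p1 x1" and x2: "x2 \<in> A" "p_elem G p2 x2" and b: "b \<in> B" "p_elem G r b"
    and moved: "b \<otimes> x2 \<noteq> x2 \<otimes> b"
  shows "x2 \<otimes> x1 = x1 \<otimes> x2"
proof -
  have c: "x1 \<in> carrier G" "x2 \<in> carrier G" "b \<in> carrier G" using x1 x2 b by auto
  obtain i :: int where i: "conj b x2 = x2 [^] i"
    using larger_prime_normalised[OF pr(2,3,5) x2 b] unfolding normalises_def by blast
  have "\<not> int p2 dvd i - 1" using p_elem_conj_trivial[OF pr(2,3) _ x2(2) b(2) i] moved pr by blast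
  then obtain l :: int where l: "x2 = (x2 [^] (i - 1)) [^] l" using p_elem_generator[OF pr(2) x2(2)] by blast
  have com: "comm b x2 = x2 [^] (i - 1)" using i c by (simp add: int_pow_diff)
  have n1: "normalises G b x1" using larger_prime_normalised[OF pr(1,3,4) x1 b] .
  \<comment> \<open>The conjugate of x1 by x2 is again a p1-element of A, so b normalises it too.
    Moved back, x2^-1 b x2 normalises <x1>, and therefore so does x2^-1 (b x2 b^-1), a power of x2
    that generates <x2>.\<close>
  have "normalises G b (conj x2 x1)"
    using larger_prime_normalised[OF pr(1,3,4) _ p_elem_conj[OF x1(2)] b] conj_in_A x1 x2 c by blast
  then have n2: "normalises G (conj (inv x2) b) x1" using normalises_conj c by blast
  have "normalises G (conj (inv x2) b \<otimes> inv b) x1"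
    using normalises_mult[OF _ _ _ n2 normalises_inv[OF _ _ n1]] c by simp
  moreover have "conj (inv x2) b \<otimes> inv b = inv x2 \<otimes> conj b x2" using c by (simp add: grp_word)
  moreover have "inv x2 \<otimes> x2 [^] i = x2 [^] (i - 1)"
    using c int_pow_mult[of x2 "-1" i] by (simp add: int_pow_neg)
  ultimately have "normalises G (x2 [^] (i - 1)) x1" using i by simp
  then have "normalises G ((x2 [^] (i - 1)) [^] l) x1" using normalises_int_pow c by (meson int_pow_closed)
  then have "normalises G x2 x1" by (simp only: flip: l)
  then have "comm b x2 \<otimes> x1 = x1 \<otimes> comm b x2" using normalising_commutator_centralises c n1 by blast
  then have "(x2 [^] (i - 1)) [^] l \<otimes> x1 = x1 \<otimes> (x2 [^] (i - 1)) [^] l"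
    unfolding com using commutes_int_pow c by (meson int_pow_closed)
  then show ?thesis by (simp only: flip: l)
qed

text \<open>By \<open>moved_elem_commutes\<close> a p-element of A moved by b commutes with all
  p-elements of A. If b fixes u, then x u is moved; both x u and x commute with v, hence u
  does.\<close>

lemma moved_p_elems_commute:
  assumes pr: "prime p" "prime r" "r < p" and b: "b \<in> B" "p_elem G r b"
    and moved: "x \<in> A" "p_elem G p x" "b \<otimes> x \<noteq> x \<otimes> b"
    and u: "u \<in> A" "p_elem G p u" and v: "v \<in> A" "p_elem G p v"
  shows "u \<otimes> v = v \<otimes> u"
proof -
  have m: "y \<otimes> z = z \<otimes> y" if "y \<in> A" "p_elem G p y" "b \<otimes> y \<noteq> y \<otimes> b" "z \<in> A" "p_elem G p z" for y z
    using moved_elem_commutes[OF pr(1,1,2,3,3) that(4,5,1,2) b that(3)] .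
  show ?thesis
  proof (cases "b \<otimes> u = u \<otimes> b")
    case True
    have c: "x \<in> carrier G" "u \<in> carrier G" "b \<in> carrier G" "v \<in> carrier G" using moved u b v by auto
    have xu: "x \<otimes> u = u \<otimes> x" using m moved u by blast
    have xv: "x \<otimes> v = v \<otimes> x" using m moved v by blast
    have "x \<otimes> u \<in> A" "p_elem G p (x \<otimes> u)"
      using moved u A xu p_elem_mult_commuting by (auto simp: subgroup.m_closed)
    moreover have "b \<otimes> (x \<otimes> u) \<noteq> (x \<otimes> u) \<otimes> b"
    proof
      assume "b \<otimes> (x \<otimes> u) = (x \<otimes> u) \<otimes> b"
      also have "\<dots> = x \<otimes> b \<otimes> u" using c True by (simp add: m_assoc)
      finally have "(b \<otimes> x) \<otimes> u = (x \<otimes> b) \<otimes> u" using c by (simp add: m_assoc)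
      then show False using moved c by simp
    qed
    ultimately have "(x \<otimes> u) \<otimes> v = v \<otimes> (x \<otimes> u)" using m v by blast
    also have "\<dots> = x \<otimes> (v \<otimes> u)" using xv c by (metis m_assoc)
    finally show ?thesis using c by (simp add: m_assoc)
  qed (use m u v in blast)
qed

lemma same_prime_product:
  assumes p: "prime p" and a: "a \<in> A" "p_elem G p a" and b: "b \<in> B" "p_elem G p b"
    and x: "x \<in> generate G {a} <#> generate G {b}"
  shows "p_elem G p x"
proof -
  have s: "subgroup (generate G {a}) G" "subgroup (generate G {b}) G"
    using a b by (auto intro!: generate_is_subgroup)
  have H: "subgroup (generate G {a} <#> generate G {b}) G"
    using set_mult_permute_subgroup[OF s cyclic_permute[OF a(1) b(1)]] .
  obtain k l where "card (generate G {a}) = p ^ k" "card (generate G {b}) = p ^ l" using cyclic_p_group p a b by metis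
  then have "card (generate G {a} <#> generate G {b}) dvd p ^ (k + l)"
    using card_set_mult[OF s] by (metis dvd_triv_left power_add)
  then obtain j where "card (generate G {a} <#> generate G {b}) = p ^ j" using divides_primepow_nat[OF p] by blast
  then show ?thesis using p_group_p_elem[OF H _ x] by blast
qed

lemma comm_in_cyclic_product:
  assumes a: "a \<in> A" and b: "b \<in> B"
  shows "comm a b \<in> generate G {a} <#> generate G {b}"
proof -
  have s: "subgroup (generate G {a}) G" "subgroup (generate G {b}) G"
    using a b by (auto intro!: generate_is_subgroup)
  interpret H: subgroup "generate G {a} <#> generate G {b}" G
    using set_mult_permute_subgroup[OF s cyclic_permute[OF a b]] .
  have "a \<in> generate G {a} <#> generate G {b}" "b \<in> generate G {a} <#> generate G {b}"
    using set_mult_subset_left[OF s] by (auto intro: generate.incl)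
  then show ?thesis by simp
qed

section \<open>The commutator of x and y in A against b in B, by the position of the prime of
  b\<close>

lemma comm_central_both_smaller:
  assumes pr: "prime p" "prime q" "prime r" "p < r" "q < r"
    and x: "x \<in> A" "p_elem G p x" and y: "y \<in> A" "p_elem G q y" and b: "b \<in> B" "p_elem G r b"
  shows "comm x y \<otimes> b = b \<otimes> comm x y"
proof -
  interpret BA: tp_subgroups G B A by (rule swap)
  show ?thesis
    using normalising_commutator_centralises[of x y b] BA.larger_prime_normalised[OF pr(3,1,4) b x]
      BA.larger_prime_normalised[OF pr(3,2,5) b y] x y b by simp
qed

text \<open>Either b centralises x and y, or it moves one of them; in the second case x and y
  commute with each other by \<open>moved_elem_commutes\<close>.\<close>

lemma comm_central_both_larger:
  assumes pr: "prime p" "prime q" "prime r" "r < p" "r < q"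
    and x: "x \<in> A" "p_elem G p x" and y: "y \<in> A" "p_elem G q y" and b: "b \<in> B" "p_elem G r b"
  shows "comm x y \<otimes> b = b \<otimes> comm x y"
proof -
  have c: "x \<in> carrier G" "y \<in> carrier G" "b \<in> carrier G" using x y b by auto
  show ?thesis
  proof (cases "b \<otimes> x = x \<otimes> b \<and> b \<otimes> y = y \<otimes> b")
    case True
    then have f: "b \<otimes> x = x \<otimes> b" "b \<otimes> y = y \<otimes> b" by blast+
    have "b \<otimes> comm x y = comm x y \<otimes> b"
      by (intro commutes_mult inv_closed m_closed c f commutes_inv(1))
    then show ?thesis by simp
  next
    case False
    then have "x \<otimes> y = y \<otimes> x"
      using moved_elem_commutes[OF pr(2,1,3,5,4) y x b] moved_elem_commutes[OF pr(1,2,3,4,5) x y b] by metis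
    then have "comm x y = \<one>" using c conj_eq_iff_comm(2) by blast
    then show ?thesis using c by simp
  qed
qed

text \<open>[x, y] = x (y x^-1 y^-1) is a product of two p-elements of A.\<close>

lemma comm_central_p_elems_central:
  assumes x: "x \<in> A" "p_elem G p x" and y: "y \<in> A" and b: "b \<in> B"
    and cen: "\<And>v. v \<in> A \<Longrightarrow> p_elem G p v \<Longrightarrow> b \<otimes> v = v \<otimes> b"
  shows "comm x y \<otimes> b = b \<otimes> comm x y"
proof -
  have c: "x \<in> carrier G" "y \<in> carrier G" "b \<in> carrier G" using x y b by auto
  have xi: "inv x \<in> A" "p_elem G p (inv x)" using x A p_elem_inv by (auto simp: subgroup.m_inv_closed)
  have eq: "comm x y = x \<otimes> conj y (inv x)" using c by (simp add: grp_word)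
  have 1: "b \<otimes> conj y (inv x) = conj y (inv x) \<otimes> b" using cen[OF conj_in_A[OF y xi(1)] p_elem_conj[OF xi(2)]] c by blast
  have 2: "b \<otimes> x = x \<otimes> b" using cen x by blast
  have cc: "conj y (inv x) \<in> carrier G" using c by simp
  show ?thesis unfolding eq using commutes_mult[OF c(3,1) cc 2 1] by simp
qed

lemma comm_p_elem_if_commute:
  assumes x: "x \<in> A" "p_elem G p x" and y: "y \<in> A"
    and com: "\<And>u v. u \<in> A \<Longrightarrow> p_elem G p u \<Longrightarrow> v \<in> A \<Longrightarrow> p_elem G p v \<Longrightarrow> u \<otimes> v = v \<otimes> u"
  shows "comm x y \<in> A" "p_elem G p (comm x y)"
proof -
  have c: "x \<in> carrier G" "y \<in> carrier G" using x y by auto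
  have xi: "inv x \<in> A" "p_elem G p (inv x)" using x A p_elem_inv by (auto simp: subgroup.m_inv_closed)
  have eq: "comm x y = x \<otimes> conj y (inv x)" using c by (simp add: grp_word)
  have 1: "conj y (inv x) \<in> A" "p_elem G p (conj y (inv x))" using conj_in_A[OF y xi(1)] p_elem_conj[OF xi(2)] c by auto
  show "comm x y \<in> A" unfolding eq using x 1 A by (simp add: subgroup.m_closed)
  show "p_elem G p (comm x y)" unfolding eq using p_elem_mult_commuting x 1 com by blast
qed

text \<open>Suppose b moves a p-element of A. Then z = [x, y] is a p-element, being a product of
  commuting ones, and b normalises <z>. It is also the product of the q-elements x y x^-1 and y^-1,
  so z normalises <b>. Hence [z, b] lies in both <z> and <b>, which meet trivially.\<close>

lemma comm_central_between:
  assumes pr: "prime p" "prime q" "prime r" "q < r" "r < p"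
    and x: "x \<in> A" "p_elem G p x" and y: "y \<in> A" "p_elem G q y" and b: "b \<in> B" "p_elem G r b"
  shows "comm x y \<otimes> b = b \<otimes> comm x y"
proof (cases "\<forall>v. v \<in> A \<longrightarrow> p_elem G p v \<longrightarrow> b \<otimes> v = v \<otimes> b")
  case True
  then show ?thesis using comm_central_p_elems_central x y b by blast
next
  case False
  interpret BA: tp_subgroups G B A by (rule swap)
  have c: "x \<in> carrier G" "y \<in> carrier G" "b \<in> carrier G" using x y b by auto
  let ?z = "comm x y"
  have z: "?z \<in> A" "p_elem G p ?z"
    using comm_p_elem_if_commute[OF x y(1)] moved_p_elems_commute[OF pr(1,3,5) b] False by blast+
  have zc: "?z \<in> carrier G" using c by simp
  have "normalises G (inv y) b" using normalises_inv BA.larger_prime_normalised[OF pr(3,2,4) b y] c by blast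
  moreover have "normalises G (conj x y) b"
    using BA.larger_prime_normalised[OF pr(3,2,4) b conj_in_A[OF x(1) y(1)] p_elem_conj[OF y(2)]] c by blast
  ultimately have "normalises G ?z b" using normalises_mult[of "conj x y" "inv y" b] c by simp
  then obtain i :: int where i: "conj ?z b = b [^] i" unfolding normalises_def by blast
  have "normalises G b ?z" using larger_prime_normalised[OF pr(1,3,5) z b] .
  then obtain j :: int where j: "conj b ?z = ?z [^] j" unfolding normalises_def by blast
  have 1: "comm ?z b = b [^] i \<otimes> inv b" using i by simp
  have "comm ?z b = ?z \<otimes> inv (conj b ?z)" using zc c by (simp add: grp_word)
  then have "comm ?z b = ?z \<otimes> inv (?z [^] j)" using j by simp
  also have "\<dots> = ?z [^] (1 - j)" using zc by (simp only: int_pow_diff int_pow_1)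
  finally have "p_elem G p (comm ?z b)" using p_elem_int_pow[OF z(2)] by simp
  moreover have "b [^] i \<otimes> inv b = b [^] (i - 1)" using c by (simp add: int_pow_diff)
  then have "p_elem G r (comm ?z b)" using p_elem_int_pow[OF b(2)] 1 by simp
  ultimately have "comm ?z b = \<one>" using p_elem_two_primes pr by blast
  then show ?thesis using conj_eq_iff_comm(2) zc c by blast
qed

end

lemma (in group) conj_eq_one: "g \<in> carrier G \<Longrightarrow> x \<in> carrier G \<Longrightarrow> conj g x = \<one> \<longleftrightarrow> x = \<one>"
  by (metis inv_closed inv_solve_right l_one m_closed r_cancel_one r_one l_cancel_one)

lemma (in group) inv_int_pow_mult:
  assumes "x \<in> carrier G"
  shows "inv (x [^] a) \<otimes> x [^] b = x [^] (b - a :: int)"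
proof -
  have "x [^] (- a + b) = inv (x [^] a) \<otimes> x [^] b" using assms by (simp only: int_pow_mult int_pow_neg)
  then show ?thesis by simp
qed

lemma (in group) conj_inv_fixes_iff:
  assumes "g \<in> carrier G" "x \<in> carrier G"
  shows "conj (inv g) x = x \<longleftrightarrow> g \<otimes> x = x \<otimes> g"
proof -
  have "conj (inv g) x = x \<longleftrightarrow> inv g \<otimes> x = x \<otimes> inv g" using conj_eq_iff_comm(1) assms by blast
  also have "\<dots> \<longleftrightarrow> g \<otimes> x = x \<otimes> g"
    using commutes_inv(2)[of "inv g" x] commutes_inv(2)[of g x] assms by auto
  finally show ?thesis .
qed

context tp_subgroups begin

text \<open>An automorphism that maps each cyclic subgroup of an elementary abelian group to itself
  is a scalar: comparing its effect on e, f and e f gives one exponent, unless f is a power of e,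
  and then i and j agree anyway.\<close>

lemma exponents_agree:
  assumes pr: "prime p" "prime r" "r < p" and b: "b \<in> B" "p_elem G r b"
    and com: "\<And>u v. u \<in> A \<Longrightarrow> p_elem G p u \<Longrightarrow> v \<in> A \<Longrightarrow> p_elem G p v \<Longrightarrow> u \<otimes> v = v \<otimes> u"
    and e: "e \<in> A" "ord e = p" and f: "f \<in> A" "ord f = p"
    and ij: "conj b e = e [^] (i::int)" "conj b f = f [^] (j::int)"
  shows "int p dvd i - j"
proof -
  have c: "e \<in> carrier G" "f \<in> carrier G" "b \<in> carrier G" using e f b by auto
  have pe: "p_elem G p e" "p_elem G p f"
    using c pow_ord_eq_1 e f unfolding p_elem_def by (metis power_one_right)+
  have ef: "e \<otimes> f = f \<otimes> e" using com e f pe by blast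
  have "normalises G b (e \<otimes> f)"
    using larger_prime_normalised[OF pr _ p_elem_mult_commuting[OF pe ef] b] e f A by (simp add: subgroup.m_closed)
  then obtain k :: int where k: "conj b (e \<otimes> f) = (e \<otimes> f) [^] k" unfolding normalises_def by blast
  have "conj b (e \<otimes> f) = conj b e \<otimes> conj b f" using c by (simp add: grp_word)
  then have "e [^] i \<otimes> f [^] j = e [^] k \<otimes> f [^] k"
    using k ij int_pow_mult_distrib[OF ef c(1,2), of k] by (simp only:)
  then have "inv (e [^] k) \<otimes> (e [^] i \<otimes> f [^] j) \<otimes> inv (f [^] j) = inv (e [^] k) \<otimes> (e [^] k \<otimes> f [^] k) \<otimes> inv (f [^] j)" by simp
  then have "inv (e [^] k) \<otimes> e [^] i = f [^] k \<otimes> inv (f [^] j)" using c by (simp add: m_assoc)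
  moreover have "inv (e [^] k) \<otimes> e [^] i = e [^] (i - k)" using c int_pow_mult[of e "-k" i] by (simp add: int_pow_neg)
  ultimately have eq: "e [^] (i - k) = f [^] (k - j)" using c by (simp add: int_pow_diff)
  show ?thesis
  proof (cases "e [^] (i - k) = \<one>")
    case True
    then have "int p dvd i - k" using int_pow_eq_id c e by metis
    moreover have "int p dvd k - j" using True eq int_pow_eq_id c f by metis
    ultimately have "int p dvd (i - k) + (k - j)" by (rule dvd_add)
    then show ?thesis by simp
  next
    case False
    then have "\<not> int p dvd k - j" using eq int_pow_eq_id c f by metis
    then obtain l :: int where l: "f = (f [^] (k - j)) [^] l" using p_elem_generator pr pe by blast
    have "(e [^] (i - k)) [^] l = f" unfolding eq using l by (rule sym)
    then have fe: "f = e [^] ((i - k) * l)" using c by (simp add: int_pow_pow)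
    then have "conj b f = (conj b e) [^] ((i - k) * l)" using c conj_int_pow by metis
    also have "\<dots> = (e [^] ((i - k) * l)) [^] i" using ij c by (simp add: int_pow_pow mult_ac)
    finally have "f [^] j = f [^] i" using ij fe by simp
    then show ?thesis using int_pow_eq c f by metis
  qed
qed

text \<open>Here b acts on <v> by i and on <y^-1 v y> by j, with i = j modulo p by
  \<open>exponents_agree\<close> in the subgroups of order p. So [y, b] acts on <v> by an exponent
  that is 1 modulo p, and as an r-element it acts trivially.\<close>

lemma comm_conj_centralises:
  assumes pr: "prime p" "prime r" "r < p"
    and b: "b \<in> B" "p_elem G r b" and y: "y \<in> A" "p_elem G r y"
    and com: "\<And>u v. u \<in> A \<Longrightarrow> p_elem G p u \<Longrightarrow> v \<in> A \<Longrightarrow> p_elem G p v \<Longrightarrow> u \<otimes> v = v \<otimes> u"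
    and v: "v \<in> A" "p_elem G p v"
  shows "comm y b \<otimes> v = v \<otimes> comm y b"
proof (cases "v = \<one>")
  case False
  have c: "v \<in> carrier G" "b \<in> carrier G" "y \<in> carrier G" using v b y by auto
  let ?w = "comm y b" and ?v' = "conj (inv y) v"
  have v': "?v' \<in> A" "p_elem G p ?v'" "?v' \<in> carrier G"
    using conj_in_A[of "inv y" v] p_elem_conj[OF v(2), of "inv y"] y v A c by (auto simp: subgroup.m_inv_closed)
  obtain i :: int where i: "conj b v = v [^] i" using larger_prime_normalised[OF pr v b] unfolding normalises_def by blast
  obtain j :: int where j: "conj b ?v' = ?v' [^] j" using larger_prime_normalised[OF pr v'(1,2) b] unfolding normalises_def by blast
  obtain m where m: "ord v = p ^ m" using ord_p_elem pr v by blast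
  have m0: "m \<noteq> 0" using m False ord_eq_1 c by (metis power_0)
  \<comment> \<open>This power takes v and its conjugate to elements of order p, to which
    \<open>exponents_agree\<close> applies, without changing the exponents i and j.\<close>
  let ?n = "p ^ (m - 1)"
  let ?e = "v [^] ?n" and ?f = "?v' [^] ?n"
  have p1: "p ^ m = ?n * p" using m0 by (metis power_minus_mult neq0_conv)
  have "ord ?e = p" using ord_pow_gen[OF c(1), of ?n] m p1 pr
    by (simp add: gcd.commute gcd_mult_distrib_nat prime_gt_0_nat)
  moreover have fe: "?f = conj (inv y) ?e" by (rule conj_nat_pow) (use c in auto)
  ultimately have of: "ord ?f = p"
  proof -
    have "?f [^] p = \<one>" using \<open>ord ?e = p\<close> c fe conj_nat_pow[of "inv y" ?e p] by (metis pow_ord_eq_1 inv_closed inv_inv nat_pow_closed r_one r_inv)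
    then have "ord ?f dvd p" using pow_eq_id v'(3) by simp
    moreover have "ord ?f \<noteq> 1"
    proof
      assume "ord ?f = 1"
      then have "?f = \<one>" using ord_eq_1 v'(3) by simp
      then have "?e = \<one>" using conj_eq_one[of "inv y" ?e] fe c by simp
      then show False using \<open>ord ?e = p\<close> prime_gt_1_nat[OF pr(1)] by simp
    qed
    ultimately show ?thesis using pr(1) by (metis One_nat_def prime_nat_iff)
  qed
  have "?e \<in> A" "?f \<in> A" using v v' sub_nat_pow_closed[OF A] by auto
  moreover have "conj b ?e = ?e [^] i" "conj b ?f = ?f [^] j"
  proof -
    have sw: "(x [^] ?n) [^] k = (x [^] k) [^] ?n" if "x \<in> carrier G" for x and k :: int
      using that by (simp add: int_pow_pow mult.commute flip: int_pow_int)
    show "conj b ?e = ?e [^] i" using conj_nat_pow[OF c(2,1), of ?n] i sw[OF c(1)] by simp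
    show "conj b ?f = ?f [^] j" using conj_nat_pow[OF c(2) v'(3), of ?n] j sw[OF v'(3)] by simp
  qed
  ultimately have pij: "int p dvd i - j"
    using exponents_agree[OF pr b com] \<open>ord ?e = p\<close> of by blast
  have "normalises G (conj (inv (inv y)) b) v"
    using normalises_conj[of "inv y" b v] larger_prime_normalised[OF pr v'(1,2) b] c by simp
  then have nw: "normalises G ?w v"
    using normalises_mult[of "conj y b" "inv b" v] normalises_inv[of b v] larger_prime_normalised[OF pr v b] c by simp
  then obtain k :: int where k: "conj ?w v = v [^] k" unfolding normalises_def by blast
  have "conj ?w (conj b v) = conj y (conj b ?v')" using c by (simp add: grp_word)
  also have "\<dots> = conj y (conj (inv y) (v [^] j))" using j c conj_int_pow[of "inv y" v j] by simp
  also have "\<dots> = v [^] j" using c by (simp add: grp_word)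
  finally have "(v [^] k) [^] i = v [^] j" using i k c conj_int_pow[of ?w v i] by simp
  then have "int (ord v) dvd j - k * i" using int_pow_eq c by (simp add: int_pow_pow)
  moreover have "int p dvd int (ord v)" using prime_dvd_ord[OF pr(1) v(2) False] unfolding int_dvd_int_iff .
  ultimately have "int p dvd j - k * i" by (rule dvd_trans[rotated])
  with pij have "int p dvd (i - j) + (j - k * i)" by (rule dvd_add)
  then have "int p dvd (1 - k) * i" by (simp add: algebra_simps)
  moreover have "\<not> int p dvd i"
  proof
    assume "int p dvd i"
    then obtain t where t: "i = int p * t" by blast
    have "conj b ?e = ?e [^] i" by fact
    also have "\<dots> = \<one>" using t \<open>ord ?e = p\<close> int_pow_eq_id[of ?e i] c by simp
    finally have "?e = \<one>" using conj_eq_one[of b ?e] c by simp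
    then show False using \<open>ord ?e = p\<close> prime_gt_1_nat[OF pr(1)] by simp
  qed
  ultimately have "int p dvd 1 - k" using pr(1) by (simp add: prime_dvd_mult_iff)
  then have "int p dvd k - 1" by (simp add: dvd_diff_commute)
  moreover have "p_elem G r ?w" using same_prime_product[OF pr(2) y b comm_in_cyclic_product] y b by blast
  ultimately show ?thesis using p_elem_conj_trivial[OF pr(1,2) _ v(2) _ k] pr(3) by blast
qed (use b y in simp)

text \<open>With z = [x, y], w = [y, b] and d = [z, b]: w centralises z by
  \<open>comm_conj_centralises\<close>, so [x y x^-1, b] = w d. This and w are r-elements because
  each lies in a product of two cyclic r-groups, and they commute. So d is an r-element; as a power
  of z it is also a p-element, hence trivial.\<close>

lemma comm_central_equal_smaller:
  assumes pr: "prime p" "prime r" "r < p"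
    and x: "x \<in> A" "p_elem G p x" and y: "y \<in> A" "p_elem G r y" and b: "b \<in> B" "p_elem G r b"
  shows "comm x y \<otimes> b = b \<otimes> comm x y"
proof (cases "\<forall>v. v \<in> A \<longrightarrow> p_elem G p v \<longrightarrow> b \<otimes> v = v \<otimes> b")
  case True
  then show ?thesis using comm_central_p_elems_central x y b by blast
next
  case False
  have c: "x \<in> carrier G" "y \<in> carrier G" "b \<in> carrier G" using x y b by auto
  have com: "u \<otimes> v = v \<otimes> u" if "u \<in> A" "p_elem G p u" "v \<in> A" "p_elem G p v" for u v
    using moved_p_elems_commute[OF pr b] False that by blast
  let ?z = "comm x y"
  have z: "?z \<in> A" "p_elem G p ?z" using comm_p_elem_if_commute[OF x y(1) com] by blast+
  have zc: "?z \<in> carrier G" using z by simp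
  let ?w = "comm y b" and ?d = "comm ?z b" and ?y = "conj x y"
  have wc: "?w \<in> carrier G" "?d \<in> carrier G" using c by simp_all
  have "normalises G b ?z" using larger_prime_normalised[OF pr z b] .
  then obtain j :: int where j: "conj b ?z = ?z [^] j" unfolding normalises_def by blast
  have "?d = ?z \<otimes> inv (conj b ?z)" using c by (simp add: grp_word)
  also have "\<dots> = ?z [^] (1 - j)" unfolding j using zc by (simp only: int_pow_diff int_pow_1)
  finally have d: "?d = ?z [^] (1 - j)" .
  have wz: "?w \<otimes> ?z = ?z \<otimes> ?w" using comm_conj_centralises[OF pr b y com z] by blast
  then have wd: "?w \<otimes> ?d = ?d \<otimes> ?w" unfolding d using commutes_int_pow[OF zc wc(1)] by metis
  have "comm ?y b = ?z \<otimes> ?w \<otimes> (b \<otimes> inv ?z \<otimes> inv b)" using c by (simp add: grp_word)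
  also have "\<dots> = ?w \<otimes> ?z \<otimes> (b \<otimes> inv ?z \<otimes> inv b)" using wz by simp
  also have "\<dots> = ?w \<otimes> ?d" using c by (simp add: grp_word)
  finally have yb: "comm ?y b = ?w \<otimes> ?d" .
  have y': "?y \<in> A" "p_elem G r ?y" using conj_in_A x y p_elem_conj c by auto
  have r1: "p_elem G r (?w \<otimes> ?d)"
    unfolding yb[symmetric] using same_prime_product[OF pr(2) y' b comm_in_cyclic_product[OF y'(1) b(1)]] .
  have r2: "p_elem G r (inv ?w)" using same_prime_product[OF pr(2) y b comm_in_cyclic_product] y b p_elem_inv by blast
  have "inv ?w \<otimes> (?w \<otimes> ?d) = (?w \<otimes> ?d) \<otimes> inv ?w"
    using commutes_mult[of "inv ?w" ?w ?d] commutes_inv(2)[OF wc wd] wc by simp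
  then have "p_elem G r (inv ?w \<otimes> (?w \<otimes> ?d))" using p_elem_mult_commuting r1 r2 by blast
  then have "p_elem G r ?d" using wc inv_cancel_left(2)[OF wc] by simp
  moreover have "p_elem G p ?d" unfolding d using p_elem_int_pow z by blast
  ultimately have "?d = \<one>" using p_elem_two_primes pr by blast
  then show ?thesis using conj_eq_iff_comm(2) zc c by blast
qed

text \<open>If \<open>x\<close> and \<open>b\<close> do not commute, then \<open>x\<inverse> b x = b \<tau>\<close> with \<open>\<tau>\<close> of order \<open>p\<close> commuting with \<open>b\<close>. As \<open>y\<close> and
  its conjugates under \<open>x\<close> normalise \<open>\<langle>b\<rangle>\<close>, the element \<open>y\<close> normalises the three lines \<open>\<langle>b\<rangle>\<close>, \<open>\<langle>b \<tau>\<rangle>\<close>,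
  \<open>\<langle>b \<tau>\<^sup>2\<rangle>\<close> of a plane over \<open>GF(p)\<close> and acts on it as a scalar.\<close>

lemma conj_same_exponent:
  assumes pr: "prime p" "prime q" "q < p"
    and x: "x \<in> A" "p_elem G p x" and y: "y \<in> A" "p_elem G q y" and b: "b \<in> B" "ord b = p"
    and ij: "conj y b = b [^] (i::int)" "conj (conj x y) b = b [^] (j::int)"
  shows "int p dvd i - j"
proof -
  interpret BA: tp_subgroups G B A by (rule swap)
  have c: "x \<in> carrier G" "y \<in> carrier G" "b \<in> carrier G" using x y b by auto
  have pb: "p_elem G p b" using c pow_ord_eq_1 b unfolding p_elem_def by (metis power_one_right)
  show ?thesis
  proof (cases "x \<otimes> b = b \<otimes> x")
    case True
    then have xb: "conj (inv x) b = b" "conj x b = b"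
      using conj_eq_iff_comm(1)[OF inv_closed[OF c(1)] c(3)] commutes_inv(2)[OF c(1,3) True]
        conj_eq_iff_comm(1)[OF c(1,3)] by blast+
    have "conj (conj x y) b = conj x (conj y (conj (inv x) b))" using c by (simp add: grp_word)
    also have "\<dots> = conj x (b [^] i)" using xb(1) ij(1) by (simp only:)
    also have "\<dots> = (conj x b) [^] i" by (rule conj_int_pow[OF c(1,3), symmetric])
    also have "\<dots> = b [^] i" by (simp only: xb)
    finally have "b [^] j = b [^] i" using ij by simp
    then show ?thesis using int_pow_eq c b by metis
  next
    case False
    let ?H = "generate G {x}"
    have H: "subgroup ?H G" "x \<in> ?H" using c by (auto intro!: generate_is_subgroup generate.incl)
    have gx: "?H = {x [^] k |k::int. True}" using generate_pow[OF c(1)] by auto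
    \<comment> \<open>The subgroup <b> has prime order and does not commute with x, so it meets <x>
      trivially.\<close>
    have bH: "b [^] (k::int) \<notin> ?H" if "b [^] k \<noteq> \<one>" for k
    proof
      assume "b [^] k \<in> ?H"
      then obtain l :: int where l: "b [^] k = x [^] l" using gx by blast
      have "\<not> int p dvd k" using that int_pow_eq_id c b by metis
      then obtain t :: int where "b = (b [^] k) [^] t" using p_elem_generator pr pb by blast
      then have "b = x [^] (l * t)" using l c by (simp add: int_pow_pow)
      then show False using False commutes_int_pow[OF c(1,1)] by metis
    qed
    have b1: "b \<noteq> \<one>" using b(2) pr by (metis ord_eq_1 c(3) not_prime_1)
    then have "b \<notin> ?H" using bH[of 1] c by simp
    moreover have "b [^] p \<in> ?H" using b pow_ord_eq_1 c H subgroup.one_closed by metis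
    \<comment> \<open>The equal-prime case of the pigeonhole lemma, with x in the role of a: b
      normalises <x>.\<close>
    ultimately have "conj (inv b) x \<in> ?H"
      using cyclic_permuting_pigeonhole[OF pr(1) x(2) c(3) cyclic_permute[OF x(1) b(1)] H] pr prime_gt_0_nat by blast
    then obtain s :: int where s: "conj (inv b) x = x [^] s" using gx by blast
    obtain m where m: "ord x = p ^ m" using ord_p_elem pr x by blast
    have x1: "x \<noteq> \<one>" using False c by auto
    have "inv b [^] p = \<one>" using b c pow_ord_eq_1 by (metis nat_pow_inv inv_one)
    then have "x [^] (1::int) = x [^] (s ^ p)" using conj_pow_pow[OF inv_closed[OF c(3)] c(1), of s p] s c by simp
    then have sp: "int (p ^ m) dvd s ^ p - 1" using int_pow_eq[OF c(1)] m by metis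
    have "int p dvd int (p ^ m)" using prime_dvd_ord[OF pr(1) x(2) x1] unfolding m int_dvd_int_iff .
    then have "int p dvd s ^ p - 1" using sp by (rule dvd_trans)
    then have s1: "int p dvd s - 1" using power_prime_cong_one pr by blast
    \<comment> \<open>This comes from q < p. It makes p (s - 1) a multiple of the order of x, so
      that x^(1-s) has order dividing p.\<close>
    have podd: "odd p" using pr by (metis prime_odd_nat prime_ge_2_nat le_less_trans)
    have lift: "int (p ^ m) dvd int p * (s - 1)" using prime_power_dvd_lift[OF pr(1) podd s1 sp] .
    define \<tau> where "\<tau> = x [^] (1 - s)"
    have tc: "\<tau> \<in> carrier G" unfolding \<tau>_def using c by simp
    have tH: "\<tau> [^] (k::int) \<in> ?H" for k unfolding \<tau>_def gx using c by (auto simp: int_pow_pow)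
    have tp: "\<tau> [^] int p = \<one>"
    proof -
      have "int (ord x) dvd (1 - s) * int p" using lift m by (metis dvd_minus_iff minus_diff_eq mult.commute mult_minus_left)
      then show ?thesis unfolding \<tau>_def using c int_pow_eq_id by (simp add: int_pow_pow)
    qed
    then have otp: "ord \<tau> dvd p" using int_pow_eq_id[OF tc] by simp
    have tb: "\<tau> \<otimes> b = b \<otimes> \<tau>"
    proof -
      have "conj (inv b) \<tau> = (x [^] s) [^] (1 - s)" unfolding \<tau>_def using c s conj_int_pow[of "inv b" x "1 - s"] by simp
      also have "\<dots> = \<tau> [^] s" unfolding \<tau>_def using c by (simp add: int_pow_pow mult.commute)
      also have "\<dots> = \<tau> [^] (1::int)"
      proof -
        have "int (ord \<tau>) dvd 1 - s" using otp s1 by (metis dvd_diff_commute dvd_trans int_dvd_int_iff)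
        then show ?thesis using int_pow_eq[OF tc] by metis
      qed
      finally have "conj (inv b) \<tau> = \<tau>" by (simp only: int_pow_1[OF tc])
      then show ?thesis using conj_inv_fixes_iff[OF c(3) tc] by simp
    qed
    have xt: "x \<otimes> \<tau> = \<tau> \<otimes> x" unfolding \<tau>_def using commutes_int_pow[OF c(1,1)] by simp
    have b\<tau>: "conj (inv x) b = b \<otimes> \<tau>"
    proof -
      have "conj (inv x) b = b \<otimes> inv (conj (inv b) x) \<otimes> x" using c by (simp add: grp_word)
      also have "\<dots> = b \<otimes> (inv (x [^] s) \<otimes> x)" unfolding s using c by (simp add: m_assoc)
      also have "inv (x [^] s) \<otimes> x = \<tau>" unfolding \<tau>_def using c int_pow_mult[of x "-s" 1] by (simp add: int_pow_neg)
      finally show ?thesis .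
    qed
    have b\<tau>2: "conj (inv (x \<otimes> x)) b = b \<otimes> \<tau> \<otimes> \<tau>"
    proof -
      have "conj (inv (x \<otimes> x)) b = conj (inv x) (conj (inv x) b)" using c by (simp add: grp_word)
      also have "\<dots> = conj (inv x) (b \<otimes> \<tau>)" unfolding b\<tau> ..
      also have "\<dots> = conj (inv x) b \<otimes> conj (inv x) \<tau>" using c tc by (simp add: grp_word)
      also have "conj (inv x) \<tau> = \<tau>" using xt conj_inv_fixes_iff[OF c(1) tc] by blast
      finally show ?thesis using b\<tau> by simp
    qed
    have j': "conj y (b \<otimes> \<tau>) = (b \<otimes> \<tau>) [^] j"
    proof -
      have "conj y (conj (inv x) b) = conj (inv x) (conj (conj x y) b)" using c by (simp add: grp_word)
      also have "\<dots> = (conj (inv x) b) [^] j" unfolding ij(2) by (rule conj_int_pow[symmetric]) (use c in auto)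
      finally show ?thesis unfolding b\<tau> .
    qed
    have xx: "x \<otimes> x \<in> A" "x \<otimes> x \<in> carrier G" using x A by (auto simp: subgroup.m_closed)
    have "normalises G (conj (x \<otimes> x) y) b"
      using BA.larger_prime_normalised[OF pr b(1) pb conj_in_A[OF xx(1) y(1)] p_elem_conj[OF y(2) xx(2)]] .
    then obtain k :: int where k: "conj (conj (x \<otimes> x) y) b = b [^] k" unfolding normalises_def by blast
    have k': "conj y (b \<otimes> \<tau> \<otimes> \<tau>) = (b \<otimes> \<tau> \<otimes> \<tau>) [^] k"
    proof -
      have "conj y (conj (inv (x \<otimes> x)) b) = conj (inv (x \<otimes> x)) (conj (conj (x \<otimes> x) y) b)" using c by (simp add: grp_word)
      also have "\<dots> = (conj (inv (x \<otimes> x)) b) [^] k" unfolding k by (rule conj_int_pow[symmetric]) (use c xx in auto)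
      finally show ?thesis unfolding b\<tau>2 .
    qed
    have pw: "(b \<otimes> \<tau>) [^] l = b [^] l \<otimes> \<tau> [^] l" for l :: int by (rule int_pow_mult_distrib[OF tb[symmetric] c(3) tc])
    have pw2: "(b \<otimes> \<tau> \<otimes> \<tau>) [^] l = b [^] l \<otimes> \<tau> [^] (2 * l)" for l :: int
    proof -
      have tt: "\<tau> \<otimes> \<tau> = \<tau> [^] (2::int)" using tc int_pow_mult[of \<tau> 1 1] by simp
      have "b \<otimes> (\<tau> \<otimes> \<tau>) = (\<tau> \<otimes> \<tau>) \<otimes> b" using commutes_mult[OF c(3) tc tc tb[symmetric] tb[symmetric]] .
      then have "(b \<otimes> (\<tau> \<otimes> \<tau>)) [^] l = b [^] l \<otimes> (\<tau> \<otimes> \<tau>) [^] l"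
        by (rule int_pow_mult_distrib[OF _ c(3) m_closed[OF tc tc]])
      also have "(\<tau> \<otimes> \<tau>) [^] l = \<tau> [^] (2 * l)" unfolding tt using tc by (rule int_pow_pow)
      finally show ?thesis using tc c by (simp add: m_assoc)
    qed
    \<comment> \<open>Additively 2 (b + tau) = b + (b + 2 tau); applying y to both sides compares
      the scalars j, i and k of the three lines.\<close>
    have sq: "(b \<otimes> \<tau>) [^] (2::int) = b \<otimes> (b \<otimes> \<tau> \<otimes> \<tau>)"
    proof -
      have "(b \<otimes> \<tau>) [^] (2::int) = (b \<otimes> \<tau>) \<otimes> (b \<otimes> \<tau>)" using tc c int_pow_mult[of "b \<otimes> \<tau>" 1 1] by simp
      also have "\<dots> = b \<otimes> (\<tau> \<otimes> b) \<otimes> \<tau>" using tc c by (simp add: m_assoc)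
      finally show ?thesis using tb tc c by (simp add: m_assoc)
    qed
    have "(conj y (b \<otimes> \<tau>)) [^] (2::int) = conj y b \<otimes> conj y (b \<otimes> \<tau> \<otimes> \<tau>)"
      using sq tc c conj_int_pow[of y "b \<otimes> \<tau>" 2] by (simp add: grp_word)
    then have "((b \<otimes> \<tau>) [^] j) [^] (2::int) = b [^] i \<otimes> (b \<otimes> \<tau> \<otimes> \<tau>) [^] k" unfolding j' k' ij(1) .
    then have "b [^] (2 * j) \<otimes> \<tau> [^] (2 * j) = b [^] i \<otimes> (b [^] k \<otimes> \<tau> [^] (2 * k))"
      using pw[of "2 * j"] pw2[of k] tc c by (simp add: int_pow_pow mult.commute)
    then have e1: "b [^] (2 * j) \<otimes> \<tau> [^] (2 * j) = b [^] (i + k) \<otimes> \<tau> [^] (2 * k)" using tc c by (simp add: int_pow_mult m_assoc)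
    have "b [^] (2 * j - (i + k)) = \<tau> [^] (2 * k - 2 * j)"
    proof -
      have "inv (b [^] (i + k)) \<otimes> (b [^] (2 * j) \<otimes> \<tau> [^] (2 * j)) \<otimes> inv (\<tau> [^] (2 * j))
        = inv (b [^] (i + k)) \<otimes> (b [^] (i + k) \<otimes> \<tau> [^] (2 * k)) \<otimes> inv (\<tau> [^] (2 * j))" unfolding e1 ..
      then have "inv (b [^] (i + k)) \<otimes> b [^] (2 * j) = \<tau> [^] (2 * k) \<otimes> inv (\<tau> [^] (2 * j))" using tc c by (simp add: m_assoc)
      moreover have "inv (b [^] (i + k)) \<otimes> b [^] (2 * j) = b [^] (2 * j - (i + k))"
        by (rule inv_int_pow_mult[OF c(3)])
      ultimately show ?thesis using tc by (simp add: int_pow_diff)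
    qed
    \<comment> \<open>The left side is in <b>, the right side in <x>, so both are trivial: 2 j = i +
      k and, once tau is known to have order p, 2 k = 2 j modulo p.\<close>
    then have "b [^] (2 * j - (i + k)) = \<one>" "\<tau> [^] (2 * k - 2 * j) = \<one>" using bH tH by metis+
    then have d1: "int p dvd 2 * j - (i + k)" "int (ord \<tau>) dvd 2 * (k - j)"
      using int_pow_eq_id c tc b by (metis, simp add: int_pow_eq_id right_diff_distrib)
    have "\<tau> \<noteq> \<one>"
    proof
      assume "\<tau> = \<one>"
      then have "conj (inv x) b = b" unfolding b\<tau> using c by simp
      then show False using False conj_inv_fixes_iff[OF c(1,3)] by blast
    qed
    then have "ord \<tau> = p" using otp pr(1) ord_eq_1[OF tc] by (metis One_nat_def prime_nat_iff)
    then have "int p dvd 2 * (k - j)" using d1 by simp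
    moreover have "\<not> int p dvd 2"
    proof
      assume "int p dvd 2"
      then have "p dvd 2" by (metis int_dvd_int_iff of_nat_numeral)
      then have "p = 2" using pr(1) by (simp add: primes_dvd_imp_eq)
      then show False using podd by simp
    qed
    ultimately have "int p dvd k - j" using prime_dvd_mult_iff[of "int p" 2 "k - j"] pr(1) by simp
    with d1(1) have "int p dvd (2 * j - (i + k)) + (k - j)" by (rule dvd_add)
    then have "int p dvd j - i" by simp
    then show ?thesis by (simp add: dvd_diff_commute)
  qed
qed

text \<open>On <b> the elements y and x y x^-1 act by exponents i and j. They agree modulo p by
  \<open>conj_same_exponent\<close> in the subgroup of order p, hence modulo the order of b, because
  both automorphisms have q-power order. So [x, y] fixes y b y^-1, a generator of <b>.\<close>

lemma comm_central_equal_larger: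
  assumes pr: "prime p" "prime q" "q < p"
    and x: "x \<in> A" "p_elem G p x" and y: "y \<in> A" "p_elem G q y" and b: "b \<in> B" "p_elem G p b"
  shows "comm x y \<otimes> b = b \<otimes> comm x y"
proof (cases "b = \<one>")
  case False
  interpret BA: tp_subgroups G B A by (rule swap)
  have c: "x \<in> carrier G" "y \<in> carrier G" "b \<in> carrier G" using x y b by auto
  let ?y = "conj x y"
  have y': "?y \<in> A" "p_elem G q ?y" "?y \<in> carrier G" using conj_in_A x y p_elem_conj c by auto
  obtain i :: int where i: "conj y b = b [^] i" using BA.larger_prime_normalised[OF pr b y] unfolding normalises_def by blast
  obtain j :: int where j: "conj ?y b = b [^] j" using BA.larger_prime_normalised[OF pr b y'(1,2)] unfolding normalises_def by blast
  obtain m where m: "ord b = p ^ m" using ord_p_elem pr b by blast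
  have m0: "m \<noteq> 0" using m False ord_eq_1 c by (metis power_0)
  let ?n = "p ^ (m - 1)"
  let ?e = "b [^] ?n"
  have p1: "p ^ m = ?n * p" using m0 by (metis power_minus_mult neq0_conv)
  have oe: "ord ?e = p" using ord_pow_gen[OF c(3), of ?n] m p1 pr
    by (simp add: gcd.commute gcd_mult_distrib_nat prime_gt_0_nat)
  have sw: "(b [^] ?n) [^] k = (b [^] k) [^] ?n" for k :: int
    using c by (simp add: int_pow_pow mult.commute flip: int_pow_int)
  have "conj y ?e = ?e [^] i" using conj_nat_pow[OF c(2,3), of ?n] i sw by simp
  moreover have "conj ?y ?e = ?e [^] j" using conj_nat_pow[OF y'(3) c(3), of ?n] j sw by simp
  ultimately have pij: "int p dvd i - j"
    using conj_same_exponent[OF pr x y _ oe] sub_nat_pow_closed[OF B b(1)] by blast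
  obtain k1 k2 where k12: "y [^] (q ^ k1) = \<one>" "?y [^] (q ^ k2) = \<one>" using y y' unfolding p_elem_def by blast
  define K where "K = q ^ (k1 + k2)"
  have "y [^] K = \<one>" "?y [^] K = \<one>"
    using k12 c y'(3) unfolding K_def power_add by (metis nat_pow_one nat_pow_pow, metis nat_pow_one nat_pow_pow mult.commute)
  then have "b [^] (1::int) = b [^] (i ^ K)" "b [^] (1::int) = b [^] (j ^ K)"
    using conj_pow_pow[OF c(2,3) i, of K] conj_pow_pow[OF y'(3) c(3) j, of K] c by simp_all
  then have iK: "int (p ^ m) dvd i ^ K - 1" and jK: "int (p ^ m) dvd j ^ K - 1" using int_pow_eq[OF c(3)] m by metis+
  have Kp: "\<not> p dvd K" unfolding K_def using pr by (metis less_irrefl prime_dvd_power primes_dvd_imp_eq)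
  have K0: "K > 0" unfolding K_def using pr by (simp add: prime_gt_0_nat)
  \<comment> \<open>Since i^K and j^K are 1 modulo p^m, the factor i^(K-1) is an inverse of i and t
    stands for j / i.\<close>
  let ?t = "j * i ^ (K - 1)"
  have ii: "i * i ^ (K - 1) = i ^ K" using K0 by (metis power_minus_mult mult.commute)
  have "int p dvd int (p ^ m)" using m0 by simp
  then have "int p dvd i ^ K - 1" using iK dvd_trans by blast
  moreover have "int p dvd (i - j) * i ^ (K - 1)" using pij by simp
  ultimately have "int p dvd (i ^ K - 1) - (i - j) * i ^ (K - 1)" by (rule dvd_diff)
  moreover have "(i ^ K - 1) - (i - j) * i ^ (K - 1) = ?t - 1" by (simp add: algebra_simps flip: ii)
  ultimately have t1: "int p dvd ?t - 1" by (simp only:)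
  have "[j ^ K * (i ^ K) ^ (K - 1) = 1 * 1 ^ (K - 1)] (mod int (p ^ m))"
    using iK jK by (intro cong_mult cong_pow) (simp_all add: cong_iff_dvd_diff)
  moreover have "?t ^ K = j ^ K * (i ^ K) ^ (K - 1)" by (simp add: power_mult_distrib mult.commute flip: power_mult)
  ultimately have "int (p ^ m) dvd ?t ^ K - 1" by (simp add: cong_iff_dvd_diff)
  then have "int (p ^ m) dvd ?t - 1" using one_mod_prime_power_lift[OF pr(1) t1 _ Kp] by blast
  then have "int (p ^ m) dvd (?t - 1) * i" by simp
  moreover have "int (p ^ m) dvd j * (i ^ K - 1)" using iK by simp
  ultimately have "int (p ^ m) dvd (?t - 1) * i - j * (i ^ K - 1)" by (rule dvd_diff)
  moreover have "(?t - 1) * i - j * (i ^ K - 1) = j - i" by (simp add: algebra_simps flip: ii)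
  ultimately have "b [^] i = b [^] j" using int_pow_eq[OF c(3)] m by metis
  then have eq: "conj y b = conj ?y b" using i j by simp
  have "conj (comm x y) (conj y b) = conj ?y b" using c by (simp add: grp_word)
  then have "comm x y \<otimes> b [^] i = b [^] i \<otimes> comm x y" using eq i c conj_eq_iff_comm(1)[of "comm x y" "b [^] i"] by simp
  moreover have "\<not> int p dvd i"
  proof
    assume "int p dvd i"
    then have "int p dvd i * i ^ (K - 1)" by simp
    then have "int p dvd i ^ K - (i ^ K - 1)" using \<open>int p dvd i ^ K - 1\<close> ii dvd_diff by metis
    then show False using prime_gt_1_nat[OF pr(1)] by simp
  qed
  then obtain l :: int where l: "b = (b [^] i) [^] l" using p_elem_generator[OF pr(1) b(2)] by blast
  ultimately have "comm x y \<otimes> (b [^] i) [^] l = (b [^] i) [^] l \<otimes> comm x y"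
    using commutes_int_pow[of "b [^] i" "comm x y" l] c by simp
  then show ?thesis by (simp only: flip: l)
qed (use x y in simp)

text \<open>In classical terms: the nilpotent residual of \<open>A\<close> centralises \<open>B\<close>.\<close>

theorem comm_coprime_centralises:
  assumes pr: "prime p" "prime q" "p \<noteq> q" "prime r"
    and x: "x \<in> A" "p_elem G p x" and y: "y \<in> A" "p_elem G q y" and b: "b \<in> B" "p_elem G r b"
  shows "comm x y \<otimes> b = b \<otimes> comm x y"
proof -
  have main: "comm x y \<otimes> b = b \<otimes> comm x y"
    if pr: "prime p" "prime q" "q < p" "prime r"
    and x: "x \<in> A" "p_elem G p x" and y: "y \<in> A" "p_elem G q y" for p q x y
  proof -
    consider "p < r" | "r = p" | "q < r" "r < p" | "r = q" | "r < q" using pr(3) by linarith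
    then show ?thesis
    proof cases
      case 1 then show ?thesis using comm_central_both_smaller[OF pr(1,2,4) _ _ x y b] pr(3) by linarith
    next
      case 2 then show ?thesis using comm_central_equal_larger[OF pr(1-3) x y] b by blast
    next
      case 3 then show ?thesis using comm_central_between[OF pr(1,2,4) _ _ x y b] by blast
    next
      case 4 then show ?thesis using comm_central_equal_smaller[OF pr(1-3) x y] b by blast
    next
      case 5 then show ?thesis using comm_central_both_larger[OF pr(1,2,4) _ _ x y b] pr(3) by linarith
    qed
  qed
  have c: "x \<in> carrier G" "y \<in> carrier G" "b \<in> carrier G" using x y b by auto
  show ?thesis
  proof (cases "q < p")
    case True
    then show ?thesis using main pr x y by blast
  next
    case False
    then have "comm y x \<otimes> b = b \<otimes> comm y x" using main[of q p y x] pr x y by simp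
    moreover have "comm x y = inv (comm y x)" using c by (simp add: grp_word)
    ultimately show ?thesis using commutes_inv(2)[of "comm y x" b] c by simp
  qed
qed

lemma comm_coprime_centralises_all:
  assumes pr: "prime p" "prime q" "p \<noteq> q"
    and x: "x \<in> A" "p_elem G p x" and y: "y \<in> A" "p_elem G q y" and b: "b \<in> B"
  shows "comm x y \<otimes> b = b \<otimes> comm x y"
proof -
  let ?K = "{b \<in> carrier G. comm x y \<otimes> b = b \<otimes> comm x y}"
  have c: "comm x y \<in> carrier G" using x y by simp
  have "subgroup ?K G"
    by (rule subgroupI) (use c commutes_inv(1) commutes_mult in \<open>auto intro: one_closed\<close>)
  then have "B \<subseteq> ?K"
    using subgroup_contains_if_p_elems[OF B, of ?K] comm_coprime_centralises[OF pr _ x y] p_elem_in_carrier by blast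
  then show ?thesis using b by blast
qed

end

section \<open>Products of pairwise totally permutable subgroups\<close>

text \<open>For a subgroup H this is O^{q'}(H), and the \<open>pp_core\<close> defined from it is
  O^p(O^{q'}(H)).\<close>

definition q_gen :: "('a, 'b) monoid_scheme \<Rightarrow> 'a set \<Rightarrow> nat \<Rightarrow> 'a set" where
  "q_gen G H q = generate G {x \<in> H. p_elem G q x}"

text \<open>A pair \<open>(p, q)\<close> is an edge of the Hawkes graph of \<open>G\<close> iff the order of \<open>pp_core G (carrier G) p q\<close> is
  divisible by \<open>p\<close>. For \<open>p \<noteq> q\<close> this subgroup coincides with \<open>q_gen G (carrier G) q\<close>.\<close>

definition pp_core :: "('a, 'b) monoid_scheme \<Rightarrow> 'a set \<Rightarrow> nat \<Rightarrow> nat \<Rightarrow> 'a set" where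
  "pp_core G H p q = generate G {x \<in> q_gen G H q. pp_elem G p x}"

text \<open>For normal N this is the preimage in G of the centraliser of M N / N in G/N; stating it
  with commutators keeps the later arguments inside G.\<close>

definition central_mod :: "('a, 'b) monoid_scheme \<Rightarrow> 'a set \<Rightarrow> 'a set \<Rightarrow> 'a set" where
  "central_mod G M N = {g \<in> carrier G. \<forall>m\<in>M. g \<otimes>\<^bsub>G\<^esub> m \<otimes>\<^bsub>G\<^esub> inv\<^bsub>G\<^esub> g \<otimes>\<^bsub>G\<^esub> inv\<^bsub>G\<^esub> m \<in> N}"

context fin_group begin

lemma conj_preimage_subgroup:
  assumes S: "subgroup S G" and g: "g \<in> carrier G"
  shows "subgroup {x \<in> carrier G. conj g x \<in> S} G"
proof (rule subgroupI)
  show "{x \<in> carrier G. conj g x \<in> S} \<noteq> {}" using g subgroup.one_closed[OF S] by (auto intro!: exI[of _ \<one>])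
  fix a assume a: "a \<in> {x \<in> carrier G. conj g x \<in> S}"
  have "conj g (inv a) = inv (conj g a)" using a g by (simp add: grp_word)
  then show "inv a \<in> {x \<in> carrier G. conj g x \<in> S}" using a subgroup.m_inv_closed[OF S] by simp
  fix b assume b: "b \<in> {x \<in> carrier G. conj g x \<in> S}"
  have "conj g (a \<otimes> b) = conj g a \<otimes> conj g b" using a b g by (simp add: grp_word)
  then show "a \<otimes> b \<in> {x \<in> carrier G. conj g x \<in> S}" using a b subgroup.m_closed[OF S] by simp
qed auto

lemma conj_stab_generateI:
  assumes T: "T \<subseteq> carrier G" and g: "g \<in> carrier G" and cl: "\<And>t. t \<in> T \<Longrightarrow> conj g t \<in> generate G T"
  shows "g \<in> conj_stab G (generate G T)"
proof -
  have "generate G T \<subseteq> {x \<in> carrier G. conj g x \<in> generate G T}"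
    using T cl by (intro generate_subgroup_incl conj_preimage_subgroup generate_is_subgroup g) auto
  then show ?thesis unfolding conj_stab_def using g by blast
qed

lemma central_mod_subgroup:
  assumes N: "N \<lhd> G" and M: "M \<subseteq> carrier G"
  shows "subgroup (central_mod G M N) G"
proof (rule subgroupI)
  have sN: "subgroup N G" using normal_imp_subgroup[OF N] .
  have "\<one> \<in> central_mod G M N" unfolding central_mod_def using M subgroup.one_closed[OF sN] by (auto simp: subset_iff)
  then show "central_mod G M N \<noteq> {}" by blast
  fix g assume g: "g \<in> central_mod G M N"
  then have gc: "g \<in> carrier G" unfolding central_mod_def by blast
  have "comm (inv g) m \<in> N" if m: "m \<in> M" for m
  proof -
    have mc: "m \<in> carrier G" using m M by blast
    have "comm g m \<in> N" using g m unfolding central_mod_def by blast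
    then have "conj (inv g) (inv (comm g m)) \<in> N"
      using normal_invE(2)[OF N] subgroup.m_inv_closed[OF sN] gc by blast
    moreover have "conj (inv g) (inv (comm g m)) = comm (inv g) m" using gc mc by (simp add: grp_word)
    ultimately show ?thesis by simp
  qed
  then show "inv g \<in> central_mod G M N" unfolding central_mod_def using gc by blast
  fix h assume h: "h \<in> central_mod G M N"
  then have hc: "h \<in> carrier G" unfolding central_mod_def by blast
  have "comm (g \<otimes> h) m \<in> N" if m: "m \<in> M" for m
  proof -
    have mc: "m \<in> carrier G" using m M by blast
    have 1: "comm g m \<in> N" "comm h m \<in> N" using g h m unfolding central_mod_def by blast+
    have "comm (g \<otimes> h) m = conj g (comm h m) \<otimes> comm g m" using gc hc mc by (simp add: grp_word)
    then show ?thesis using 1 normal_invE(2)[OF N gc] subgroup.m_closed[OF sN] by metis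
  qed
  then show "g \<otimes> h \<in> central_mod G M N" unfolding central_mod_def using gc hc by blast
qed (auto simp: central_mod_def)

lemma central_mod_normal:
  assumes N: "N \<lhd> G" and M: "M \<lhd> G"
  shows "central_mod G M N \<lhd> G"
proof (rule normal_invI)
  have sM: "subgroup M G" using normal_imp_subgroup[OF M] .
  then have Mc: "M \<subseteq> carrier G" by (rule subgroup.subset)
  show "subgroup (central_mod G M N) G" using central_mod_subgroup[OF N Mc] .
  fix h g assume h: "h \<in> carrier G" and g: "g \<in> central_mod G M N"
  then have gc: "g \<in> carrier G" unfolding central_mod_def by blast
  have "comm (conj h g) m \<in> N" if m: "m \<in> M" for m
  proof -
    have mc: "m \<in> carrier G" using m Mc by blast
    have "conj (inv h) m \<in> M" using normal_invE(2)[OF M] h m by blast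
    then have "conj h (comm g (conj (inv h) m)) \<in> N"
      using g normal_invE(2)[OF N h] unfolding central_mod_def by blast
    moreover have "conj h (comm g (conj (inv h) m)) = comm (conj h g) m" using h gc mc by (simp add: grp_word)
    ultimately show ?thesis by simp
  qed
  then show "conj h g \<in> central_mod G M N" unfolding central_mod_def using h gc by blast
qed

lemma comm_preimage_subgroup:
  assumes N: "N \<lhd> G" and x: "x \<in> carrier G"
  shows "subgroup {m \<in> carrier G. comm x m \<in> N} G"
proof (rule subgroupI)
  have sN: "subgroup N G" using normal_imp_subgroup[OF N] .
  show "{m \<in> carrier G. comm x m \<in> N} \<noteq> {}" using x subgroup.one_closed[OF sN] by (auto intro!: exI[of _ \<one>])
  fix a assume "a \<in> {m \<in> carrier G. comm x m \<in> N}"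
  then have a: "a \<in> carrier G" "comm x a \<in> N" by auto
  have "conj (inv a) (inv (comm x a)) \<in> N"
    using normal_invE(2)[OF N] subgroup.m_inv_closed[OF sN] a by blast
  moreover have "conj (inv a) (inv (comm x a)) = comm x (inv a)" using a x by (simp add: grp_word)
  ultimately show "inv a \<in> {m \<in> carrier G. comm x m \<in> N}" using a by simp
  fix b assume "b \<in> {m \<in> carrier G. comm x m \<in> N}"
  then have b: "b \<in> carrier G" "comm x b \<in> N" by auto
  have "comm x (a \<otimes> b) = comm x a \<otimes> conj a (comm x b)" using a b x by (simp add: grp_word)
  then have "comm x (a \<otimes> b) \<in> N" using a b normal_invE(2)[OF N] subgroup.m_closed[OF sN] by metis
  then show "a \<otimes> b \<in> {m \<in> carrier G. comm x m \<in> N}" using a b by simp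
qed auto

lemma normal_comm_closed:
  assumes N: "N \<lhd> G" and "x \<in> carrier G" "m \<in> carrier G" "x \<in> N \<or> m \<in> N"
  shows "comm x m \<in> N"
proof -
  have sN: "subgroup N G" using normal_imp_subgroup[OF N] .
  from assms(4) show ?thesis
  proof
    assume x: "x \<in> N"
    have "conj m (inv x) \<in> N" using normal_invE(2)[OF N assms(3)] subgroup.m_inv_closed[OF sN x] by blast
    then have "x \<otimes> conj m (inv x) \<in> N" using subgroup.m_closed[OF sN x] by blast
    then show ?thesis using assms by (simp add: grp_word)
  next
    assume m: "m \<in> N"
    then have "conj x m \<otimes> inv m \<in> N" using normal_invE(2)[OF N assms(2)] subgroup.m_closed[OF sN] subgroup.m_inv_closed[OF sN] by blast
    then show ?thesis .
  qed
qed

lemma comm_swap_mem: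
  assumes "subgroup N G" "x \<in> carrier G" "m \<in> carrier G" "comm x m \<in> N"
  shows "comm m x \<in> N"
proof -
  have "comm m x = inv (comm x m)" using assms by (simp add: grp_word)
  then show ?thesis using assms subgroup.m_inv_closed by metis
qed

lemma set_mult_normal:
  assumes "A \<lhd> G" "B \<lhd> G"
  shows "A <#> B \<lhd> G"
proof (rule normal_invI)
  have s: "subgroup A G" "subgroup B G" using assms normal_imp_subgroup by blast+
  show "subgroup (A <#> B) G"
    using set_mult_permute_subgroup[OF s commut_normal[OF s(1) assms(2)]] .
  fix x h assume x: "x \<in> carrier G" and h: "h \<in> A <#> B"
  obtain a b where ab: "a \<in> A" "b \<in> B" "h = a \<otimes> b" using h by (rule set_multE)
  have c: "a \<in> carrier G" "b \<in> carrier G" using ab s subgroup.mem_carrier by metis+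
  have "conj x h = conj x a \<otimes> conj x b" using ab(3) c x by (simp add: grp_word)
  then show "conj x h \<in> A <#> B"
    using normal_invE(2)[OF assms(1) x ab(1)] normal_invE(2)[OF assms(2) x ab(2)] set_multI by metis
qed

lemma prod_sets_normal:
  assumes "\<And>i. i < n \<Longrightarrow> H i \<lhd> G"
  shows "prod_sets G H n \<lhd> G"
  using assms by (induction n) (simp_all add: one_is_normal set_mult_normal)

lemma prod_sets_contains_normal:
  assumes "\<And>i. i < n \<Longrightarrow> H i \<lhd> G" "i < n"
  shows "H i \<subseteq> prod_sets G H n"
  using prod_sets_contains[of n H n i] assms commut_normal normal_imp_subgroup by blast

lemma prod_sets_coprime_card:
  assumes "prime p" "\<And>i. i < n \<Longrightarrow> H i \<lhd> G" "\<And>i. i < n \<Longrightarrow> \<not> p dvd card (H i)"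
  shows "\<not> p dvd card (prod_sets G H n)"
  using assms(2,3)
proof (induction n)
  case 0
  then show ?case using prime_gt_1_nat[OF assms(1)] by simp
next
  case (Suc n)
  have "\<not> p dvd card (prod_sets G H n) * card (H n)" using Suc assms(1) by (simp add: prime_dvd_mult_iff)
  moreover have s: "subgroup (prod_sets G H n) G" "subgroup (H n) G"
    using prod_sets_normal[of n H] Suc.prems normal_imp_subgroup by auto
  ultimately show ?case using card_set_mult[OF s] by (metis dvd_mult2 prod_sets.simps(2))
qed

lemma mem_of_coprime_powers:
  assumes N: "subgroup N G" and x: "x \<in> carrier G" and ab: "x [^] (a::nat) \<in> N" "x [^] (b::nat) \<in> N" "coprime a b"
  shows "x \<in> N"
proof -
  have "coprime (int a) (int b)" using ab(3) by simp
  then obtain u v where uv: "u * int a + v * int b = 1" by (metis bezout_int coprime_imp_gcd_eq_1)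
  have "(x [^] a) [^] u \<otimes> (x [^] b) [^] v \<in> N"
    using ab(1,2) N subgroup_int_pow_closed subgroup.m_closed by metis
  moreover have "(x [^] a) [^] u \<otimes> (x [^] b) [^] v = x [^] (int a * u + int b * v)"
    using x by (simp add: int_pow_mult int_pow_pow flip: int_pow_int)
  moreover have "int a * u + int b * v = 1" using uv by (simp add: mult.commute)
  ultimately show ?thesis using x by simp
qed

lemma normal_mult_pow:
  assumes N: "N \<lhd> G" and n: "n \<in> N" and h: "h \<in> carrier G"
  shows "\<exists>m\<in>N. (n \<otimes> h) [^] (k::nat) = m \<otimes> h [^] k"
proof (induction k)
  case 0
  then show ?case using subgroup.one_closed[OF normal_imp_subgroup[OF N]] by (auto intro!: bexI[of _ \<one>])
next
  case (Suc k)
  have sN: "subgroup N G" using normal_imp_subgroup[OF N] .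
  obtain m where m: "m \<in> N" "(n \<otimes> h) [^] k = m \<otimes> h [^] k" using Suc by blast
  have c: "m \<in> carrier G" "n \<in> carrier G" using m n sN subgroup.mem_carrier by metis+
  have "(n \<otimes> h) [^] Suc k = (m \<otimes> conj (h [^] k) n) \<otimes> h [^] Suc k" using m(2) c h by (simp add: grp_word)
  moreover have "m \<otimes> conj (h [^] k) n \<in> N" using m normal_invE(2)[OF N] n h subgroup.m_closed[OF sN] by simp
  ultimately show ?case by blast
qed

lemma pp_elem_mem_of_p_index:
  assumes N: "N \<lhd> G" and P: "subgroup P G" "card P = r ^ k"
    and x: "x \<in> N <#> P" "pp_elem G r x"
  shows "x \<in> N"
proof -
  obtain m h where mh: "m \<in> N" "h \<in> P" "x = m \<otimes> h" using x(1) by (rule set_multE)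
  have hc: "h \<in> carrier G" using mh(2) P subgroup.mem_carrier by metis
  have sN: "subgroup N G" using normal_imp_subgroup[OF N] .
  obtain j where j: "h [^] (r ^ j) = \<one>" using p_group_p_elem[OF P mh(2)] unfolding p_elem_def by blast
  obtain m' where m': "m' \<in> N" "x [^] (r ^ j) = m' \<otimes> h [^] (r ^ j)" using normal_mult_pow[OF N mh(1) hc] mh(3) by blast
  have "x [^] (r ^ j) \<in> N" using m' j subgroup.mem_carrier[OF sN] by simp
  moreover obtain l where l: "coprime l r" "x [^] l = \<one>" "x \<in> carrier G" using x(2) unfolding pp_elem_def by blast
  moreover have "x [^] l \<in> N" using l subgroup.one_closed[OF sN] by simp
  moreover have "coprime (r ^ j) l" using l(1) by (simp add: coprime_commute)
  ultimately show ?thesis using mem_of_coprime_powers[OF sN] by blast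
qed

section \<open>The subgroups O^{q'}(H) and O^p(O^{q'}(H))\<close>

lemma q_gen_subgroup: "subgroup (q_gen G H q) G"
  unfolding q_gen_def by (rule generate_is_subgroup) (auto simp: p_elem_def)

lemma q_gen_le: "subgroup H G \<Longrightarrow> q_gen G H q \<subseteq> H"
  unfolding q_gen_def by (rule generate_subgroup_incl) auto

lemma q_gen_mem: "x \<in> H \<Longrightarrow> p_elem G q x \<Longrightarrow> x \<in> q_gen G H q"
  unfolding q_gen_def by (rule generate.incl) auto

lemma q_gen_conj:
  assumes H: "subgroup H G"
  shows "H \<subseteq> conj_stab G (q_gen G H q)"
proof
  fix h assume h: "h \<in> H"
  show "h \<in> conj_stab G (q_gen G H q)"
    unfolding q_gen_def
  proof (rule conj_stab_generateI)
    fix t assume "t \<in> {x \<in> H. p_elem G q x}"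
    then have "conj h t \<in> {x \<in> H. p_elem G q x}"
      using h H p_elem_conj subgroup.mem_carrier[OF H h] by (simp add: subgroup.m_closed subgroup.m_inv_closed)
    then show "conj h t \<in> generate G {x \<in> H. p_elem G q x}" by (rule generate.incl)
  qed (use h H in \<open>auto simp: p_elem_def subgroup.mem_carrier\<close>)
qed

lemma pp_core_subgroup: "subgroup (pp_core G H p q) G"
  unfolding pp_core_def by (rule generate_is_subgroup) (auto simp: pp_elem_def)

lemma pp_core_le: "pp_core G H p q \<subseteq> q_gen G H q"
  unfolding pp_core_def by (rule generate_subgroup_incl[OF _ q_gen_subgroup]) auto

lemma pp_core_mem: "x \<in> q_gen G H q \<Longrightarrow> pp_elem G p x \<Longrightarrow> x \<in> pp_core G H p q"
  unfolding pp_core_def by (rule generate.incl) auto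

lemma pp_core_conj:
  assumes H: "subgroup H G"
  shows "H \<subseteq> conj_stab G (pp_core G H p q)"
proof
  fix h assume h: "h \<in> H"
  show "h \<in> conj_stab G (pp_core G H p q)"
    unfolding pp_core_def
  proof (rule conj_stab_generateI)
    fix t assume "t \<in> {x \<in> q_gen G H q. pp_elem G p x}"
    then have "conj h t \<in> {x \<in> q_gen G H q. pp_elem G p x}"
      using h q_gen_conj[OF H] pp_elem_conj subgroup.mem_carrier[OF H h] unfolding conj_stab_def by blast
    then show "conj h t \<in> generate G {x \<in> q_gen G H q. pp_elem G p x}" by (rule generate.incl)
  qed (use h H in \<open>auto simp: pp_elem_def subgroup.mem_carrier\<close>)
qed

text \<open>The subgroup O^p(O^{q'}(H)) is generated by p'-elements, so the transfer result
  \<open>central_p_elems_mod_normal\<close> applies inside it, modulo its intersection with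
  N.\<close>

lemma pp_core_p_elems_in_normal:
  assumes p: "prime p" and N: "N \<lhd> G"
    and cen: "\<And>x g. p_elem G p x \<Longrightarrow> x \<in> pp_core G H p q \<Longrightarrow> g \<in> pp_core G H p q \<Longrightarrow> comm x g \<in> N"
    and z: "p_elem G p z" "z \<in> pp_core G H p q"
  shows "z \<in> N"
proof -
  let ?D = "pp_core G H p q"
  let ?G = "G\<lparr>carrier := ?D\<rparr>"
  have D: "subgroup ?D G" by (rule pp_core_subgroup)
  interpret D: fin_group ?G using sub_fin_group[OF D] .
  have sN: "subgroup N G" using normal_imp_subgroup[OF N] .
  have inv: "inv\<^bsub>?G\<^esub> x = inv x" if "x \<in> ?D" for x using m_inv_consistent[OF D that] by simp
  have nN: "(?D \<inter> N) \<lhd> ?G" using normal_Int_subgroup[OF D N] by (simp add: Int_commute)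
  have "z \<in> ?D \<inter> N"
  proof (rule D.central_p_elems_mod_normal[OF p nN])
    show "p_elem ?G p z" using z p_elem_restrict[OF D] by blast
    fix x g assume x: "p_elem ?G p x" and g: "g \<in> carrier ?G"
    have "p_elem G p x" "x \<in> ?D" "g \<in> ?D" using x g p_elem_restrict[OF D] by auto
    then show "x \<otimes>\<^bsub>?G\<^esub> g \<otimes>\<^bsub>?G\<^esub> inv\<^bsub>?G\<^esub> x \<otimes>\<^bsub>?G\<^esub> inv\<^bsub>?G\<^esub> g \<in> ?D \<inter> N"
      using cen inv subgroup.m_closed[OF D] subgroup.m_inv_closed[OF D] by simp
  next
    fix K assume K: "subgroup K ?G" "\<And>x. pp_elem ?G p x \<Longrightarrow> x \<in> K"
    have KG: "subgroup K G" using incl_subgroup[OF D K(1)] .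
    have "{x \<in> q_gen G H q. pp_elem G p x} \<subseteq> K"
      using K(2) pp_elem_restrict[OF D] pp_core_mem by blast
    from generate_subgroup_incl[OF this KG] show "carrier ?G \<subseteq> K" by (simp add: pp_core_def)
  qed
  then show ?thesis by blast
qed

end

locale tp_product = fin_group +
  fixes Gs :: "nat \<Rightarrow> 'a set" and n :: nat
  assumes Gs: "\<And>i. i < n \<Longrightarrow> subgroup (Gs i) G"
    and tps: "\<And>i j. i < n \<Longrightarrow> j < n \<Longrightarrow> i \<noteq> j \<Longrightarrow> totally_permutable G (Gs i) (Gs j)"
    and prod: "carrier G = prod_sets G Gs n"
begin

lemma Gs_carrier: "i < n \<Longrightarrow> x \<in> Gs i \<Longrightarrow> x \<in> carrier G"
  using subgroup.mem_carrier[OF Gs] .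

lemma carrier_le:
  assumes "subgroup K G" "\<And>i. i < n \<Longrightarrow> Gs i \<subseteq> K"
  shows "carrier G \<subseteq> K"
  using prod_sets_least[OF assms] prod by simp

lemma tp_pair: "i < n \<Longrightarrow> j < n \<Longrightarrow> i \<noteq> j \<Longrightarrow> tp_subgroups G (Gs i) (Gs j)"
  using Gs tps by (simp add: tp_subgroups_def tp_subgroups_axioms_def fin_group_axioms)

lemma normalI_factors:
  assumes S: "subgroup S G" and cl: "\<And>i. i < n \<Longrightarrow> Gs i \<subseteq> conj_stab G S"
  shows "S \<lhd> G"
  using normal_iff_conj_stab S carrier_le[OF conj_stab_subgroup[OF S] cl] by blast

section \<open>Nilpotent residuals and Sylow subgroups of the factors\<close>

definition coprime_comms :: "nat \<Rightarrow> 'a set" where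
  "coprime_comms i = {comm x y |x y p q. x \<in> Gs i \<and> y \<in> Gs i \<and> prime p \<and> prime q \<and> p \<noteq> q
      \<and> p_elem G p x \<and> p_elem G q y}"

text \<open>This is the nilpotent residual of G_i: a finite group is nilpotent iff its elements of
  prime power orders for distinct primes commute, and such elements lift from quotients.\<close>

definition Rs :: "nat \<Rightarrow> 'a set" where
  "Rs i = generate G (coprime_comms i)"

lemma Rs_gens_carrier:
  assumes "i < n"
  shows "coprime_comms i \<subseteq> Gs i"
  unfolding coprime_comms_def using Gs[OF assms] by (auto simp: subgroup.m_closed subgroup.m_inv_closed)

lemma Rs_le: "i < n \<Longrightarrow> Rs i \<subseteq> Gs i"
  unfolding Rs_def by (rule generate_subgroup_incl[OF Rs_gens_carrier Gs])

lemma Rs_subgroup: "i < n \<Longrightarrow> subgroup (Rs i) G"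
  unfolding Rs_def using Rs_gens_carrier[of i] Gs_carrier[of i] by (intro generate_is_subgroup) blast

lemma comm_in_Rs:
  assumes "x \<in> Gs i" "y \<in> Gs i" "prime p" "prime q" "p \<noteq> q" "p_elem G p x" "p_elem G q y"
  shows "comm x y \<in> Rs i"
  unfolding Rs_def by (rule generate.incl) (use assms in \<open>auto simp: coprime_comms_def\<close>)

lemma Rs_centralised:
  assumes ij: "i < n" "j < n" "i \<noteq> j" and r: "r \<in> Rs i" and b: "b \<in> Gs j"
  shows "r \<otimes> b = b \<otimes> r"
proof -
  interpret tp_subgroups G "Gs i" "Gs j" using tp_pair ij by blast
  have bc: "b \<in> carrier G" using b by simp
  have "subgroup {r \<in> carrier G. b \<otimes> r = r \<otimes> b} G"
    by (rule subgroupI) (use bc commutes_inv(1) commutes_mult in \<open>auto intro: one_closed\<close>)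
  moreover have "coprime_comms i \<subseteq> {r \<in> carrier G. b \<otimes> r = r \<otimes> b}"
    unfolding coprime_comms_def using comm_coprime_centralises_all[OF _ _ _ _ _ _ _ b] by auto
  ultimately have "Rs i \<subseteq> {r \<in> carrier G. b \<otimes> r = r \<otimes> b}" unfolding Rs_def using generate_subgroup_incl by blast
  then show ?thesis using r by auto
qed

text \<open>G_i permutes the generating commutators by conjugation, and the other factors centralise
  them.\<close>

lemma Rs_normal:
  assumes i: "i < n"
  shows "Rs i \<lhd> G"
proof (rule normalI_factors[OF Rs_subgroup[OF i]])
  fix j assume j: "j < n"
  show "Gs j \<subseteq> conj_stab G (Rs i)"
  proof
    fix g assume g: "g \<in> Gs j"
    have gc: "g \<in> carrier G" using g j Gs_carrier by blast
    show "g \<in> conj_stab G (Rs i)"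
    proof (cases "i = j")
      case True
      show ?thesis
        unfolding Rs_def
      proof (rule conj_stab_generateI)
        show "g \<in> carrier G" by (rule gc)
        show "coprime_comms i \<subseteq> carrier G" using Rs_gens_carrier[OF i] Gs_carrier[OF i] by blast
        fix t assume "t \<in> coprime_comms i"
        then obtain x y p q where t: "t = comm x y" "x \<in> Gs i" "y \<in> Gs i" "prime p" "prime q" "p \<noteq> q"
          "p_elem G p x" "p_elem G q y" unfolding coprime_comms_def by blast
        have "conj g t = comm (conj g x) (conj g y)"
          using t(1) gc Gs_carrier[OF i t(2)] Gs_carrier[OF i t(3)] by (simp add: grp_word)
        moreover have "conj g x \<in> Gs i" "conj g y \<in> Gs i"
          using t g True Gs[OF i] by (simp_all add: subgroup.m_closed subgroup.m_inv_closed)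
        moreover have "p_elem G p (conj g x)" "p_elem G q (conj g y)" using t p_elem_conj gc by blast+
        ultimately have "conj g t \<in> Rs i" using comm_in_Rs t(4-6) by metis
        then show "conj g t \<in> generate G (coprime_comms i)" unfolding Rs_def .
      qed
    next
      case False
      have "conj g r = r" if r: "r \<in> Rs i" for r
        using Rs_centralised[OF i j False r g] conj_eq_iff_comm(1) gc r Rs_le[OF i] Gs_carrier[OF i] by (metis subsetD)
      then show ?thesis unfolding conj_stab_def using gc by auto
    qed
  qed
qed

text \<open>Total permutability makes any chosen Sylow subgroups of the factors permute with each
  other, so every choice multiplies up to a Sylow subgroup of G.\<close>

lemma sylow_factors:
  assumes p: "prime p"
    and P: "\<And>i. i < n \<Longrightarrow> subgroup (P i) G" "\<And>i. i < n \<Longrightarrow> P i \<subseteq> Gs i"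
      "\<And>i. i < n \<Longrightarrow> card (P i) = p ^ multiplicity p (card (Gs i))"
  shows "subgroup (prod_sets G P n) G" "card (prod_sets G P n) = p ^ multiplicity p (card (carrier G))"
    "\<And>i. i < n \<Longrightarrow> P i \<subseteq> prod_sets G P n"
proof -
  have perm: "P i <#> P j = P j <#> P i" if "i < n" "j < n" "i \<noteq> j" for i j
    using totally_permutable_subgroups[OF tps[OF that]] P that by blast
  have permG: "Gs i <#> Gs j = Gs j <#> Gs i" if "i < n" "j < n" "i \<noteq> j" for i j
    using totally_permutable_subgroups[OF tps[OF that]] Gs that by blast
  show "subgroup (prod_sets G P n) G" using prod_sets_permuting(1)[of n P n] P(1) perm by blast
  show "\<And>i. i < n \<Longrightarrow> P i \<subseteq> prod_sets G P n" using prod_sets_contains[of n P n] P(1) perm by blast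
  show "card (prod_sets G P n) = p ^ multiplicity p (card (carrier G))"
    using sylow_prod_sets[of p n Gs P n, OF p Gs permG P(1) perm P(2,3)] prod by simp
qed

lemma sylow_factors_exist:
  assumes p: "prime p"
  obtains P where "\<And>i. i < n \<Longrightarrow> subgroup (P i) G" "\<And>i. i < n \<Longrightarrow> P i \<subseteq> Gs i"
      "\<And>i. i < n \<Longrightarrow> card (P i) = p ^ multiplicity p (card (Gs i))"
proof -
  have "\<forall>i. \<exists>Q. i < n \<longrightarrow> subgroup Q G \<and> Q \<subseteq> Gs i \<and> card Q = p ^ multiplicity p (card (Gs i))"
    using sylow_exists[OF p Gs] by metis
  from choice[OF this] obtain P where "\<forall>i. i < n \<longrightarrow> subgroup (P i) G \<and> P i \<subseteq> Gs i \<and> card (P i) = p ^ multiplicity p (card (Gs i))" ..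
  then show ?thesis using that[of P] by blast
qed

text \<open>Induction on the index of \<open>N\<close>: adjoin to \<open>N\<close> the Sylow \<open>r\<close>-subgroups of the factors for the largest prime
  \<open>r\<close> dividing the index. Only the step \<open>r = p\<close> needs an argument.\<close>

theorem p_elems_of_core_mod_residuals:
  assumes p: "prime p" and q: "prime q" and nd: "\<not> q dvd p - 1"
    and N: "N \<lhd> G" "\<And>i. i < n \<Longrightarrow> Rs i \<subseteq> N"
    and z: "z \<in> pp_core G (carrier G) p q" "p_elem G p z"
  shows "z \<in> N"
  using N z
proof (induction "card (carrier G) - card N" arbitrary: N z rule: less_induct)
  case less
  note N = less.prems(1) and RN = less.prems(2) and z = less.prems(3,4)
  let ?D = "pp_core G (carrier G) p q"
  have sN: "subgroup N G" using normal_imp_subgroup[OF N] .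
  have zc: "z \<in> carrier G" using z(2) by (rule p_elem_in_carrier)
  let ?idx = "card (carrier G) div card N"
  have dN: "card N dvd card (carrier G)" using sub_card_dvd_order[OF sN] .
  have idx: "?idx > 0" using dN card_sub_pos[OF sN] card_sub_pos[OF subgroup_self] by (simp add: div_greater_zero_iff dvd_imp_le)
  show "z \<in> N"
  proof (cases "?idx = 1")
    case True
    then have "\<not> p dvd ?idx" using prime_gt_1_nat[OF p] by simp
    then show ?thesis using p_elem_in_normal_of_coprime_index[OF p N _ z(2)] by blast
  next
    case False
    define r where "r = Max {s. prime s \<and> s dvd ?idx}"
    have fin: "finite {s. prime s \<and> s dvd ?idx}" using idx by (auto intro: finite_subset[of _ "{s. s dvd ?idx}"])
    have "{s. prime s \<and> s dvd ?idx} \<noteq> {}" using prime_factor_nat[OF False] by blast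
    then have "r \<in> {s. prime s \<and> s dvd ?idx}" unfolding r_def using Max_in[OF fin] by blast
    then have r: "prime r" "r dvd ?idx" by auto
    \<comment> \<open>Maximality of r removes the primes for which
      \<open>larger_prime_normalised\<close> points the wrong way.\<close>
    have big: "x \<in> N" if "prime s" "s > r" "p_elem G s x" for s x
    proof -
      have "\<not> s dvd ?idx" using Max_ge[OF fin, of s] that r_def by fastforce
      then show ?thesis using p_elem_in_normal_of_coprime_index[OF that(1) N _ that(3)] by blast
    qed
    obtain P where P: "\<And>i. i < n \<Longrightarrow> subgroup (P i) G" "\<And>i. i < n \<Longrightarrow> P i \<subseteq> Gs i"
      "\<And>i. i < n \<Longrightarrow> card (P i) = r ^ multiplicity r (card (Gs i))" using sylow_factors_exist[OF r(1)] by blast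
    let ?P = "prod_sets G P n"
    have PP: "subgroup ?P G" "card ?P = r ^ multiplicity r (card (carrier G))" "\<And>i. i < n \<Longrightarrow> P i \<subseteq> ?P"
      by (rule sylow_factors[of r P]; use r(1) P in blast)+
    have Pel: "p_elem G r h" if "i < n" "h \<in> P i" for i h using p_group_p_elem[OF P(1,3)] that by blast
    define M where "M = N <#> ?P"
    have sM: "subgroup M G" unfolding M_def
      using set_mult_permute_subgroup[OF sN PP(1)] commut_normal[OF PP(1) N] by simp
    have NM: "N \<subseteq> M" "?P \<subseteq> M" unfolding M_def using set_mult_subset_left[OF sN PP(1)] by auto
    have Mle: "M \<subseteq> K" if "subgroup K G" "N \<subseteq> K" "\<And>i. i < n \<Longrightarrow> P i \<subseteq> K" for K
      unfolding M_def using set_mult_subset_subgroup[OF that(2) prod_sets_least[of K n P, OF that(1,3)] that(1)] by blast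
    \<comment> \<open>Each factor is tested on its chosen Sylow r-subgroup and its elements x of
      s-power order, s other than r. Such an x moves h in P_i within M for one of three reasons:
      [x, h] is in R_j when both come from the same factor; x normalises <h> when s < r; x is in N
      when s > r.\<close>
    have nM: "M \<lhd> G"
    proof (rule normalI_factors[OF sM])
      fix j assume j: "j < n"
      show "Gs j \<subseteq> conj_stab G M"
      proof (rule generate_sylow_and_coprime[OF r(1) Gs[OF j] P[OF j] conj_stab_subgroup[OF sM]])
        show "P j \<subseteq> conj_stab G M" using subgroup_le_conj_stab[OF sM] NM PP(3)[OF j] by blast
        fix s x assume s: "prime s" "s \<noteq> r" and x: "p_elem G s x" "x \<in> Gs j"
        have xc: "x \<in> carrier G" using x(1) by (rule p_elem_in_carrier)
        have "M \<subseteq> {h \<in> carrier G. conj x h \<in> M}"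
        proof (rule Mle[OF conj_preimage_subgroup[OF sM xc]])
          show "N \<subseteq> {h \<in> carrier G. conj x h \<in> M}"
            using normal_invE(2)[OF N xc] NM subgroup.mem_carrier[OF sN] by blast
          fix i assume i: "i < n"
          show "P i \<subseteq> {h \<in> carrier G. conj x h \<in> M}"
          proof
            fix h assume h: "h \<in> P i"
            have hG: "h \<in> Gs i" "h \<in> carrier G" using h P(2)[OF i] Gs_carrier[OF i] by blast+
            have hM: "h \<in> M" using h PP(3)[OF i] NM by blast
            have split: "conj x h = comm x h \<otimes> h" using xc hG by (simp add: grp_word)
            have viaN: "conj x h \<in> M" if "comm x h \<in> N"
            proof -
              have "comm x h \<otimes> h \<in> M" using that NM hM subgroup.m_closed[OF sM] by blast
              then show ?thesis by (rule ssubst[OF split, where P = "\<lambda>y. y \<in> M"])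
            qed
            have "conj x h \<in> M"
            proof (cases "i = j")
              case True
              then have "comm x h \<in> N" using comm_in_Rs[OF x(2) _ s(1) r(1) s(2) x(1) Pel[OF i h]] hG RN[OF j] by blast
              then show ?thesis by (rule viaN)
            next
              case ij: False
              show ?thesis
              proof (cases "s < r")
                case True
                interpret tp_subgroups G "Gs i" "Gs j" using tp_pair[OF i j ij] .
                have "normalises G x h" using larger_prime_normalised[OF r(1) s(1) True hG(1) Pel[OF i h] x(2,1)] .
                then obtain k :: int where "conj x h = h [^] k" unfolding normalises_def by blast
                then show ?thesis using subgroup_int_pow_closed[OF sM hM] by simp
              next
                case False
                then have "x \<in> N" using big[OF s(1) _ x(1)] s(2) by simp
                then have "comm x h \<in> N" using normal_comm_closed[OF N xc hG(2)] by blast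
                then show ?thesis by (rule viaN)
              qed
            qed
            then show "h \<in> {h \<in> carrier G. conj x h \<in> M}" using hG by blast
          qed
        qed
        then show "x \<in> conj_stab G M" unfolding conj_stab_def using xc by blast
      qed
    qed
    have "M \<noteq> N"
    proof
      assume "M = N"
      then have "\<not> r dvd ?idx"
        using sylow_index[OF r(1) subgroup_self sN subgroup.subset[OF sN] PP(1) _ PP(2)] NM by simp
      then show False using r by blast
    qed
    then have "card N < card M" using NM(1) sM by (intro psubset_card_mono) auto
    moreover have "card M \<le> card (carrier G)" using subgroup.subset[OF sM] by (intro card_mono) auto
    ultimately have "card (carrier G) - card M < card (carrier G) - card N" by linarith
    then have IH: "y \<in> M" if "y \<in> ?D" "p_elem G p y" for y
      using less.hyps[of M] nM RN NM(1) that by blast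
    have ppN: "x \<in> N" if "x \<in> M" "pp_elem G r x" for x
      using pp_elem_mem_of_p_index[OF N PP(1,2) _ that(2)] that(1) unfolding M_def by blast
    show ?thesis
    proof (cases "r = p")
      case False
      then show ?thesis using ppN[OF IH[OF z]] p_elem_imp_pp_elem[OF z(2) r(1) p] by blast
    next
      case True
      show ?thesis
      proof (cases "q = p")
        case qp: True
        \<comment> \<open>The normal subgroup M contains a Sylow p-subgroup, so for q = p it
          contains O^{p'}(G); the p'-elements of the latter lie in N because M/N is a
          p-group.\<close>
        have "q_gen G (carrier G) q \<subseteq> M" unfolding q_gen_def
          using sylow_normal_contains_p_elems[OF r(1) nM PP(1) NM(2) PP(2)] True qp
          by (intro generate_subgroup_incl[OF _ sM]) blast
        then have "?D \<subseteq> N" unfolding pp_core_def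
          using ppN True by (intro generate_subgroup_incl[OF _ sN]) blast
        then show ?thesis using z by blast
      next
        case qp: False
        \<comment> \<open>This normal subgroup contains the q-elements of every factor, hence a
          Sylow q-subgroup of G, hence all q-elements and \<open>?D\<close>. By induction the
          p-elements of \<open>?D\<close> lie in M, so they are central in \<open>?D\<close> modulo
          N, and the transfer puts them into N.\<close>
        let ?C = "central_mod G M N"
        have nC: "?C \<lhd> G" using central_mod_normal[OF N nM] .
        have qC: "x \<in> ?C" if i: "i < n" and x: "x \<in> Gs i" "p_elem G q x" for i x
        proof -
          have xc: "x \<in> carrier G" using x(2) by (rule p_elem_in_carrier)
          have "M \<subseteq> {m \<in> carrier G. comm x m \<in> N}"
          proof (rule Mle[OF comm_preimage_subgroup[OF N xc]])
            show "N \<subseteq> {m \<in> carrier G. comm x m \<in> N}"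
              using normal_comm_closed[OF N xc] subgroup.mem_carrier[OF sN] by blast
            fix j assume j: "j < n"
            show "P j \<subseteq> {m \<in> carrier G. comm x m \<in> N}"
            proof
              fix h assume h: "h \<in> P j"
              have hG: "h \<in> Gs j" "h \<in> carrier G" using h P(2)[OF j] Gs_carrier[OF j] by blast+
              have hp: "p_elem G p h" using Pel[OF j h] True by simp
              have "comm x h \<in> N"
              proof (cases "i = j")
                case True
                then show ?thesis using comm_in_Rs[OF x(1) _ q p qp x(2) hp] hG RN[OF i] by blast
              next
                case ij: False
                show ?thesis
                proof (cases "q < p")
                  case True
                  interpret tp_subgroups G "Gs j" "Gs i" using tp_pair[OF j i] ij by blast
                  have "x \<otimes> h = h \<otimes> x" using larger_prime_commute[OF p q True hG(1) hp x nd] .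
                  then have "comm x h = \<one>" using conj_eq_iff_comm(2) xc hG by blast
                  then show ?thesis using subgroup.one_closed[OF sN] by simp
                next
                  case False
                  then have "x \<in> N" using big[OF q _ x(2)] qp True by simp
                  then show ?thesis using normal_comm_closed[OF N xc hG(2)] by blast
                qed
              qed
              then show "h \<in> {m \<in> carrier G. comm x m \<in> N}" using hG by blast
            qed
          qed
          then show ?thesis unfolding central_mod_def using xc by blast
        qed
        obtain Q where Q: "\<And>i. i < n \<Longrightarrow> subgroup (Q i) G" "\<And>i. i < n \<Longrightarrow> Q i \<subseteq> Gs i"
          "\<And>i. i < n \<Longrightarrow> card (Q i) = q ^ multiplicity q (card (Gs i))" using sylow_factors_exist[OF q] by blast
        have QQ: "subgroup (prod_sets G Q n) G" "card (prod_sets G Q n) = q ^ multiplicity q (card (carrier G))"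
          by (rule sylow_factors[of q Q]; use q Q in blast)+
        have "prod_sets G Q n \<subseteq> ?C"
          using qC Q(2) p_group_p_elem[OF Q(1,3)] by (intro prod_sets_least[OF normal_imp_subgroup[OF nC], of n Q]) blast
        then have "q_gen G (carrier G) q \<subseteq> ?C" unfolding q_gen_def
          using sylow_normal_contains_p_elems[OF q nC QQ(1) _ QQ(2)]
          by (intro generate_subgroup_incl[OF _ normal_imp_subgroup[OF nC]]) blast
        then have DC: "?D \<subseteq> ?C" using pp_core_le by blast
        show ?thesis
        proof (rule pp_core_p_elems_in_normal[OF p N _ z(2,1)])
          fix x g assume x: "p_elem G p x" "x \<in> ?D" and g: "g \<in> ?D"
          have c: "x \<in> carrier G" "g \<in> carrier G" using x g subgroup.mem_carrier[OF pp_core_subgroup] by blast+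
          have "comm g x \<in> N" using IH[OF x(2,1)] g DC unfolding central_mod_def by blast
          then show "comm x g \<in> N" using comm_swap_mem[OF sN c(2,1)] by blast
        qed
      qed
    qed
  qed
qed

text \<open>A relation between g and y, since y is determined only modulo the centraliser of R_i in
  G_i. It is compatible with products, inverses and powers, which suffices for passing to parts of
  an element.\<close>

definition acts :: "nat \<Rightarrow> 'a \<Rightarrow> 'a \<Rightarrow> bool" where
  "acts i g y \<longleftrightarrow> g \<in> carrier G \<and> y \<in> Gs i \<and> (\<forall>r\<in>Rs i. conj g r = conj y r)"

lemma Rs_carrier: "i < n \<Longrightarrow> r \<in> Rs i \<Longrightarrow> r \<in> carrier G"
  using Rs_le Gs_carrier by blast

lemma acts_mult:
  assumes i: "i < n" and 1: "acts i g y" "acts i h z"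
  shows "acts i (g \<otimes> h) (y \<otimes> z)"
proof -
  have c: "g \<in> carrier G" "h \<in> carrier G" "y \<in> carrier G" "z \<in> carrier G"
    using 1 Gs_carrier[OF i] unfolding acts_def by auto
  have "conj (g \<otimes> h) r = conj (y \<otimes> z) r" if r: "r \<in> Rs i" for r
  proof -
    have rc: "r \<in> carrier G" using Rs_carrier[OF i r] .
    have zr: "conj z r \<in> Rs i" using normal_invE(2)[OF Rs_normal[OF i] c(4) r] .
    have "conj (g \<otimes> h) r = conj g (conj h r)" by (rule conj_conj[symmetric]) (use c rc in auto)
    also have "\<dots> = conj g (conj z r)" using 1(2) r unfolding acts_def by simp
    also have "\<dots> = conj y (conj z r)" using 1(1) zr unfolding acts_def by simp
    also have "\<dots> = conj (y \<otimes> z) r" by (rule conj_conj) (use c rc in auto)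
    finally show ?thesis .
  qed
  then show ?thesis using 1 c subgroup.m_closed[OF Gs[OF i]] unfolding acts_def by simp
qed

lemma acts_inv:
  assumes i: "i < n" and 1: "acts i g y"
  shows "acts i (inv g) (inv y)"
proof -
  have c: "g \<in> carrier G" "y \<in> carrier G" using 1 Gs_carrier[OF i] unfolding acts_def by auto
  have "conj (inv g) r = conj (inv y) r" if r: "r \<in> Rs i" for r
  proof -
    have rc: "r \<in> carrier G" using Rs_carrier[OF i r] .
    have s: "conj (inv y) r \<in> Rs i" using normal_invE(2)[OF Rs_normal[OF i] _ r] c by blast
    have "conj g (conj (inv y) r) = conj y (conj (inv y) r)" using 1 s unfolding acts_def by simp
    also have "\<dots> = r" using c rc by (simp add: grp_word)
    finally show ?thesis using conj_inv_eq[of g "conj (inv y) r" r] c rc by simp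
  qed
  then show ?thesis using 1 c subgroup.m_inv_closed[OF Gs[OF i]] unfolding acts_def by simp
qed

lemma acts_one: "i < n \<Longrightarrow> acts i \<one> \<one>"
  unfolding acts_def using subgroup.one_closed[OF Gs] by simp

lemma acts_pow: "i < n \<Longrightarrow> acts i g y \<Longrightarrow> acts i (g [^] (k::nat)) (y [^] k)"
  by (induction k) (simp_all add: acts_one acts_mult)

lemma acts_subgroup:
  assumes i: "i < n" and K: "subgroup K G"
  shows "subgroup {g \<in> carrier G. \<exists>y\<in>K. acts i g y} G"
proof (rule subgroupI)
  show "{g \<in> carrier G. \<exists>y\<in>K. acts i g y} \<noteq> {}" using acts_one[OF i] subgroup.one_closed[OF K] by blast
  fix a assume a: "a \<in> {g \<in> carrier G. \<exists>y\<in>K. acts i g y}"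
  then show "inv a \<in> {g \<in> carrier G. \<exists>y\<in>K. acts i g y}"
    using acts_inv[OF i] subgroup.m_inv_closed[OF K] by blast
  fix b assume "b \<in> {g \<in> carrier G. \<exists>y\<in>K. acts i g y}"
  then show "a \<otimes> b \<in> {g \<in> carrier G. \<exists>y\<in>K. acts i g y}"
    using a acts_mult[OF i] subgroup.m_closed[OF K] by blast
qed auto

text \<open>G_i acts as itself and the other factors act trivially; the elements that are imitated
  by some y form a subgroup.\<close>

lemma acts_exists:
  assumes i: "i < n" and g: "g \<in> carrier G"
  obtains y where "acts i g y"
proof -
  have "carrier G \<subseteq> {g \<in> carrier G. \<exists>y\<in>Gs i. acts i g y}"
  proof (rule carrier_le[OF acts_subgroup[OF i Gs[OF i]]])
    fix j assume j: "j < n"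
    show "Gs j \<subseteq> {g \<in> carrier G. \<exists>y\<in>Gs i. acts i g y}"
    proof
      fix x assume x: "x \<in> Gs j"
      have xc: "x \<in> carrier G" using Gs_carrier[OF j x] .
      have "acts i x (if i = j then x else \<one>)"
      proof (cases "i = j")
        case False
        have "conj x r = r" if r: "r \<in> Rs i" for r
          using Rs_centralised[OF i j False r x] conj_eq_iff_comm(1)[OF xc Rs_carrier[OF i r]] by simp
        then show ?thesis using False xc subgroup.one_closed[OF Gs[OF i]] Rs_carrier[OF i] unfolding acts_def by simp
      qed (use x xc in \<open>simp add: acts_def\<close>)
      then show "x \<in> {g \<in> carrier G. \<exists>y\<in>Gs i. acts i g y}" using xc unfolding acts_def by blast
    qed
  qed
  then show ?thesis using g that by blast
qed

text \<open>Raising both sides to the exponent of the q-part fixes x and turns y into a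
  q-element.\<close>

lemma acts_p_elem:
  assumes i: "i < n" and q: "prime q" and x: "p_elem G q x"
  obtains y where "acts i x y" "p_elem G q y"
proof -
  obtain y where y: "acts i x y" using acts_exists[OF i p_elem_in_carrier[OF x]] .
  obtain m :: nat where m: "\<And>x. x \<in> carrier G \<Longrightarrow> p_elem G q (x [^] m)" "\<And>x. p_elem G q x \<Longrightarrow> x [^] m = x"
    using p_part_exponent[OF q] by metis
  have "y \<in> carrier G" using y Gs_carrier[OF i] unfolding acts_def by blast
  then show ?thesis using that[of "y [^] m"] acts_pow[OF i y, of m] m x by simp
qed

lemma acts_pp_core:
  assumes i: "i < n" and p: "prime p" and q: "prime q" and d: "d \<in> pp_core G (carrier G) p q"
  obtains y where "y \<in> pp_core G (Gs i) p q" "acts i d y"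
proof -
  have 1: "q_gen G (carrier G) q \<subseteq> {g \<in> carrier G. \<exists>y\<in>q_gen G (Gs i) q. acts i g y}"
    unfolding q_gen_def[of G "carrier G"]
  proof (rule generate_subgroup_incl[OF subsetI acts_subgroup[OF i q_gen_subgroup]])
    fix x assume "x \<in> {x \<in> carrier G. p_elem G q x}"
    then have x: "x \<in> carrier G" "p_elem G q x" by auto
    obtain y where "acts i x y" "p_elem G q y" using acts_p_elem[OF i q x(2)] .
    then show "x \<in> {g \<in> carrier G. \<exists>y\<in>q_gen G (Gs i) q. acts i g y}"
      using q_gen_mem[of y "Gs i" q] x unfolding acts_def by blast
  qed
  obtain m :: nat where m: "\<And>x. x \<in> carrier G \<Longrightarrow> pp_elem G p (x [^] m)" "\<And>x. pp_elem G p x \<Longrightarrow> x [^] m = x"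
    using pp_part_exponent[OF p] by metis
  have "pp_core G (carrier G) p q \<subseteq> {g \<in> carrier G. \<exists>y\<in>pp_core G (Gs i) p q. acts i g y}"
    unfolding pp_core_def[of G "carrier G"]
  proof (rule generate_subgroup_incl[OF subsetI acts_subgroup[OF i pp_core_subgroup]])
    fix x assume "x \<in> {x \<in> q_gen G (carrier G) q. pp_elem G p x}"
    then have x: "x \<in> q_gen G (carrier G) q" "pp_elem G p x" by auto
    obtain y where y: "y \<in> q_gen G (Gs i) q" "acts i x y" using 1 x(1) by blast
    have yc: "y \<in> carrier G" using y(1) subgroup.mem_carrier[OF q_gen_subgroup] by blast
    have "y [^] m \<in> pp_core G (Gs i) p q"
      using pp_core_mem[OF sub_nat_pow_closed[OF q_gen_subgroup y(1)] m(1)[OF yc]] .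
    moreover have "acts i x (y [^] m)" using acts_pow[OF i y(2), of m] m(2)[OF x(2)] by simp
    ultimately show "x \<in> {g \<in> carrier G. \<exists>y\<in>pp_core G (Gs i) p q. acts i g y}"
      using pp_elem_in_carrier[OF x(2)] by blast
  qed
  then show ?thesis using d that by blast
qed

definition residual :: "'a set" where
  "residual = prod_sets G Rs n"

lemma residual_normal: "residual \<lhd> G"
  unfolding residual_def using prod_sets_normal[of n Rs] Rs_normal by blast

lemma Rs_le_residual: "i < n \<Longrightarrow> Rs i \<subseteq> residual"
  unfolding residual_def using prod_sets_contains_normal[of n Rs] Rs_normal by blast

lemma residual_least:
  assumes "subgroup K G" "\<And>i. i < n \<Longrightarrow> Rs i \<subseteq> K"
  shows "residual \<subseteq> K"
  unfolding residual_def using prod_sets_least[of K n Rs] assms by blast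

lemma p_elems_of_core_in_residual:
  assumes "prime p" "prime q" "\<not> q dvd p - 1" "z \<in> pp_core G (carrier G) p q" "p_elem G p z"
  shows "z \<in> residual"
  using p_elems_of_core_mod_residuals[OF assms(1-3) residual_normal Rs_le_residual assms(4,5)] by blast

text \<open>By \<open>triv\<close> the intersections Y_i of R_i with O^p(O^{q'}(G_i)) have order
  prime to p, and they are normal in G. On R_i the group D = O^p(O^{q'}(G)) acts through
  O^p(O^{q'}(G_i)), so [D, R] lies in the product of the Y_i. The p-elements of D lie in R, so they
  are central in D modulo this product, and the transfer puts them into it.\<close>

theorem pp_core_coprime:
  assumes p: "prime p" and q: "prime q" and nd: "\<not> q dvd p - 1"
    and triv: "\<And>i x. i < n \<Longrightarrow> x \<in> pp_core G (Gs i) p q \<Longrightarrow> p_elem G p x \<Longrightarrow> x = \<one>"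
    and z: "z \<in> pp_core G (carrier G) p q" "p_elem G p z"
  shows "z = \<one>"
proof -
  let ?D = "pp_core G (carrier G) p q"
  define Y where "Y i = Rs i \<inter> pp_core G (Gs i) p q" for i
  have sY: "subgroup (Y i) G" if "i < n" for i
    unfolding Y_def using subgroups_Inter_pair[OF Rs_subgroup[OF that] pp_core_subgroup] .
  have nY: "Y i \<lhd> G" if i: "i < n" for i
  proof (rule normalI_factors[OF sY[OF i]])
    fix j assume j: "j < n"
    show "Gs j \<subseteq> conj_stab G (Y i)"
    proof
      fix g assume g: "g \<in> Gs j"
      have gc: "g \<in> carrier G" using Gs_carrier[OF j g] .
      have "conj g y \<in> Y i" if y: "y \<in> Y i" for y
      proof (cases "i = j")
        case True
        have "conj g y \<in> pp_core G (Gs i) p q"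
          using pp_core_conj[OF Gs[OF i], of p q] g y True unfolding conj_stab_def Y_def by blast
        then show ?thesis using normal_invE(2)[OF Rs_normal[OF i] gc] y unfolding Y_def by blast
      next
        case False
        have r: "y \<in> Rs i" using y unfolding Y_def by blast
        have "conj g y = y" using Rs_centralised[OF i j False r g] conj_eq_iff_comm(1)[OF gc Rs_carrier[OF i r]] by simp
        then show ?thesis using y by simp
      qed
      then show "g \<in> conj_stab G (Y i)" unfolding conj_stab_def using gc by blast
    qed
  qed
  let ?Y = "prod_sets G Y n"
  have nYY: "?Y \<lhd> G" using prod_sets_normal[of n Y] nY by blast
  have YY: "Y i \<subseteq> ?Y" if "i < n" for i using prod_sets_contains_normal[of n Y i] nY that by blast
  have cop: "\<not> p dvd card ?Y"
  proof (rule prod_sets_coprime_card[OF p])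
    fix i assume i: "i < n"
    show "Y i \<lhd> G" using nY[OF i] .
    show "\<not> p dvd card (Y i)"
    proof
      assume "p dvd card (Y i)"
      then obtain x where "x \<in> Y i" "p_elem G p x" "x \<noteq> \<one>" using cauchy_p_elem[OF p sY[OF i]] by blast
      then show False using triv[OF i] unfolding Y_def by blast
    qed
  qed
  have cen: "comm d m \<in> ?Y" if d: "d \<in> ?D" and m: "m \<in> residual" for d m
  proof -
    have dc: "d \<in> carrier G" using d subgroup.mem_carrier[OF pp_core_subgroup] by blast
    have "residual \<subseteq> {m \<in> carrier G. comm d m \<in> ?Y}"
    proof (rule residual_least[OF comm_preimage_subgroup[OF nYY dc]])
      fix i assume i: "i < n"
      obtain y where y: "y \<in> pp_core G (Gs i) p q" "acts i d y" using acts_pp_core[OF i p q d] .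
      have yG: "y \<in> Gs i" "y \<in> carrier G" using y Gs_carrier[OF i] unfolding acts_def by auto
      show "Rs i \<subseteq> {m \<in> carrier G. comm d m \<in> ?Y}"
      proof
        fix r assume r: "r \<in> Rs i"
        have rc: "r \<in> carrier G" "r \<in> Gs i" using Rs_carrier[OF i r] Rs_le[OF i] r by auto
        have "comm d r = comm y r" using y(2) r unfolding acts_def by simp
        moreover have "comm y r \<in> Rs i" using normal_comm_closed[OF Rs_normal[OF i] yG(2) rc(1)] r by blast
        moreover have "comm y r \<in> pp_core G (Gs i) p q"
        proof -
          have "conj r (inv y) \<in> pp_core G (Gs i) p q"
            using pp_core_conj[OF Gs[OF i], of p q] rc(2) subgroup.m_inv_closed[OF pp_core_subgroup y(1)]
            unfolding conj_stab_def by blast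
          then have "y \<otimes> conj r (inv y) \<in> pp_core G (Gs i) p q" using y(1) subgroup.m_closed[OF pp_core_subgroup] by blast
          then show ?thesis using yG rc by (simp add: grp_word)
        qed
        ultimately have "comm d r \<in> Y i" unfolding Y_def by simp
        then show "r \<in> {m \<in> carrier G. comm d m \<in> ?Y}" using YY[OF i] rc by blast
      qed
    qed
    then show ?thesis using m by blast
  qed
  have "z \<in> ?Y"
  proof (rule pp_core_p_elems_in_normal[OF p nYY _ z(2,1)])
    fix x g assume x: "p_elem G p x" "x \<in> ?D" and g: "g \<in> ?D"
    have c: "x \<in> carrier G" "g \<in> carrier G" using x g subgroup.mem_carrier[OF pp_core_subgroup] by blast+
    have "comm g x \<in> ?Y" using cen[OF g p_elems_of_core_in_residual[OF p q nd x(2,1)]] .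
    then show "comm x g \<in> ?Y" using comm_swap_mem[OF normal_imp_subgroup[OF nYY] c(2,1)] by blast
  qed
  have sYY: "subgroup ?Y G" using normal_imp_subgroup[OF nYY] .
  show ?thesis
  proof (rule ccontr)
    assume "z \<noteq> \<one>"
    then show False using p_elem_prime_dvd[OF p sYY \<open>z \<in> ?Y\<close> z(2)] cop by blast
  qed
qed

end

section \<open>Automorphisms induced on p-subgroups\<close>

context fin_group begin

text \<open>With c = [u, x] one has u x u^-1 = c x; since c and x commute, c = (c x) x^-1 is a
  q-element as well as a p-element. This is the coprime action fact that [u, x, x] = 1 implies
  [u, x] = 1.\<close>

lemma stable_commute:
  assumes p: "prime p" "prime q" "p \<noteq> q"
    and u: "u \<in> carrier G" and x: "p_elem G q x" and c: "p_elem G p (comm u x)" "x \<otimes> comm u x = comm u x \<otimes> x"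
  shows "x \<otimes> u = u \<otimes> x"
proof -
  have xc: "x \<in> carrier G" using x by (rule p_elem_in_carrier)
  let ?c = "comm u x"
  have cc: "?c \<in> carrier G" using u xc by simp
  have "conj u x = ?c \<otimes> x" using u xc by (simp add: grp_word)
  then have "p_elem G q (?c \<otimes> x)" using p_elem_conj[OF x u] by simp
  moreover have "inv x \<otimes> (?c \<otimes> x) = (?c \<otimes> x) \<otimes> inv x"
    using commutes_mult[of "inv x" ?c x] commutes_inv(2)[OF xc cc c(2)] xc cc by simp
  ultimately have "p_elem G q ((?c \<otimes> x) \<otimes> inv x)" using p_elem_mult_commuting p_elem_inv[OF x] by metis
  moreover have "(?c \<otimes> x) \<otimes> inv x = ?c" using cc xc by (simp add: m_assoc)
  ultimately have "p_elem G q ?c" by metis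
  then have "?c = \<one>" using p_elem_two_primes c(1) p by blast
  then show ?thesis using conj_eq_iff_comm(2)[OF u xc] by simp
qed

lemma centralizer_subgroup: "S \<subseteq> carrier G \<Longrightarrow> subgroup (centralizer G S) G"
proof (rule subgroupI)
  assume S: "S \<subseteq> carrier G"
  show "centralizer G S \<noteq> {}" unfolding centralizer_def using S by (auto intro!: exI[of _ \<one>])
  fix a assume a: "a \<in> centralizer G S"
  have ac: "a \<in> carrier G" "\<And>s. s \<in> S \<Longrightarrow> a \<otimes> s = s \<otimes> a" using a unfolding centralizer_def by auto
  show "inv a \<in> centralizer G S" unfolding centralizer_def using ac commutes_inv(2) S by blast
  fix b assume b: "b \<in> centralizer G S"
  have bc: "b \<in> carrier G" "\<And>s. s \<in> S \<Longrightarrow> b \<otimes> s = s \<otimes> b" using b unfolding centralizer_def by auto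
  have "a \<otimes> b \<otimes> s = s \<otimes> (a \<otimes> b)" if s: "s \<in> S" for s
  proof -
    have sc: "s \<in> carrier G" using s S by blast
    show ?thesis using commutes_mult[OF sc ac(1) bc(1)] ac(2)[OF s] bc(2)[OF s] by simp
  qed
  then show "a \<otimes> b \<in> centralizer G S" unfolding centralizer_def using ac bc by blast
qed (auto simp: centralizer_def)

lemma centralizer_normal:
  assumes N: "N \<lhd> G"
  shows "centralizer G N \<lhd> G"
proof (rule normal_invI)
  have sN: "subgroup N G" using normal_imp_subgroup[OF N] .
  show "subgroup (centralizer G N) G" by (rule centralizer_subgroup[OF subgroup.subset[OF sN]])
  fix g c assume g: "g \<in> carrier G" and c: "c \<in> centralizer G N"
  have cc: "c \<in> carrier G" using c unfolding centralizer_def by blast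
  have "conj g c \<otimes> r = r \<otimes> conj g c" if r: "r \<in> N" for r
  proof -
    have rc: "r \<in> carrier G" using subgroup.mem_carrier[OF sN r] .
    have "conj (inv g) r \<in> N" using normal_invE(2)[OF N _ r] g by blast
    then have "c \<otimes> conj (inv g) r = conj (inv g) r \<otimes> c" using c unfolding centralizer_def by blast
    then have "g \<otimes> (c \<otimes> conj (inv g) r) \<otimes> inv g = g \<otimes> (conj (inv g) r \<otimes> c) \<otimes> inv g" by simp
    then show ?thesis using g cc rc by (simp add: grp_word)
  qed
  then show "conj g c \<in> centralizer G N" unfolding centralizer_def using g cc by simp
qed

text \<open>An element of L of s-power order, s other than p, has a power of p-power exponent in Z,
  so it lies in Z itself and centralises a Sylow p-subgroup T of L. Hence T is normal in L and
  consists of all its p-elements.\<close>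

lemma p_elems_of_central_extension:
  assumes p: "prime p" and L: "subgroup L G" and Z: "subgroup Z G"
    and cen: "\<And>z g. z \<in> Z \<Longrightarrow> g \<in> L \<Longrightarrow> z \<otimes> g = g \<otimes> z"
    and pw: "\<And>g. g \<in> L \<Longrightarrow> \<exists>k. g [^] (p ^ k) \<in> Z"
  shows "subgroup {x \<in> L. p_elem G p x} G"
proof -
  obtain T where T: "subgroup T G" "T \<subseteq> L" "card T = p ^ multiplicity p (card L)" using sylow_exists[OF p L] .
  have "L \<subseteq> conj_stab G T"
  proof (rule generate_sylow_and_coprime[OF p L T conj_stab_subgroup[OF T(1)] subgroup_le_conj_stab[OF T(1)]])
    fix s x assume s: "prime s" "s \<noteq> p" and x: "p_elem G s x" "x \<in> L"
    have xc: "x \<in> carrier G" using x(1) by (rule p_elem_in_carrier)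
    obtain k where k: "x [^] (p ^ k) \<in> Z" using pw x(2) by blast
    obtain j where "x [^] (s ^ j) = \<one>" using x(1) unfolding p_elem_def by blast
    then have j: "x [^] (s ^ j) \<in> Z" using subgroup.one_closed[OF Z] by simp
    have "coprime (p ^ k) (s ^ j)" using primes_coprime[OF p s(1)] s(2) by simp
    then have xZ: "x \<in> Z" using mem_of_coprime_powers[OF Z xc k j] by blast
    have "conj x t = t" if t: "t \<in> T" for t
      using cen[OF xZ, of t] t T(2) conj_eq_iff_comm(1)[OF xc subgroup.mem_carrier[OF T(1) t]] by blast
    then show "x \<in> conj_stab G T" unfolding conj_stab_def using xc by simp
  qed
  then have "{x \<in> L. p_elem G p x} = T"
    using sylow_overgroup_contains_p_elems[OF p L T(1,2) _ T(1) _ T(3)] p_group_p_elem[OF T(1,3)] T(2) by blast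
  then show ?thesis using T(1) by simp
qed

text \<open>Otherwise the product formula would give the subgroup P N an order divisible by a higher
  power of p than |G|.\<close>

lemma sylow_inter_normal:
  assumes p: "prime p" and N: "N \<lhd> G" and P: "subgroup P G" "card P = p ^ multiplicity p (card (carrier G))"
  shows "card (P \<inter> N) = p ^ multiplicity p (card N)"
proof -
  have sN: "subgroup N G" using normal_imp_subgroup[OF N] .
  have sPN: "subgroup (P \<inter> N) G" using subgroups_Inter_pair[OF P(1) sN] .
  have PP: "x \<in> P \<inter> N" if x: "x \<in> N" "p_elem G p x" "x \<in> P" for x using x by blast
  have "\<not> p dvd card N div card (P \<inter> N)"
  proof
    assume pd: "p dvd card N div card (P \<inter> N)"
    have sub: "subgroup (P <#> N) G" using set_mult_permute_subgroup[OF P(1) sN commut_normal[OF P(1) N]] .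
    have "card (P <#> N) * card (P \<inter> N) = card P * card N" by (rule card_set_mult[OF P(1) sN])
    moreover obtain c where c: "card N = card (P \<inter> N) * c" using sub_card_dvd[OF sN sPN] by blast
    moreover have "card P * card N = (card P * c) * card (P \<inter> N)" by (subst c) (simp only: mult_ac)
    ultimately have "card (P <#> N) * card (P \<inter> N) = (card P * c) * card (P \<inter> N)" by (simp only:)
    then have "card (P <#> N) = card P * c" using mult_right_cancel[of "card (P \<inter> N)"] card_sub_pos[OF sPN] by (metis less_not_refl)
    moreover have "p dvd c" using pd c card_sub_pos[OF sPN] by simp
    ultimately have "card P * p dvd card (P <#> N)" by simp
    then have "p ^ Suc (multiplicity p (card (carrier G))) dvd card (carrier G)"
      using P(2) sub_card_dvd_order[OF sub] dvd_trans by (metis mult.commute power_Suc)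
    then show False using card_sub_pos[OF subgroup_self] p
      by (metis power_dvd_iff_le_multiplicity not_less_eq_eq order_refl less_not_refl not_prime_unit)
  qed
  then show ?thesis using p_group_card_iff_sylow[OF p sPN _ sN] p_group_p_elem[OF P] by blast
qed

end

context tp_product begin

text \<open>[u, x] = (u x u^-1) x^-1 is a product of q-elements, so it lies in O^p(O^{q'}(G)); being
  in P it is a p-element, and such elements are in R.\<close>

lemma commutator_in_residual:
  assumes p: "prime p" "prime q" "p \<noteq> q" "\<not> q dvd p - 1"
    and P: "subgroup P G" "\<And>u. u \<in> P \<Longrightarrow> p_elem G p u"
    and x: "p_elem G q x" "x \<in> conj_stab G P" and u: "u \<in> P"
  shows "comm u x \<in> P \<inter> residual"
proof -
  have xc: "x \<in> carrier G" using x(1) by (rule p_elem_in_carrier)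
  have uc: "u \<in> carrier G" using subgroup.mem_carrier[OF P(1) u] .
  have "u \<otimes> conj x (inv u) \<in> P"
    using u x(2) subgroup.m_closed[OF P(1)] subgroup.m_inv_closed[OF P(1)] unfolding conj_stab_def by blast
  then have cP: "comm u x \<in> P" using uc xc by (simp add: grp_word)
  let ?D = "pp_core G (carrier G) p q"
  have mem: "y \<in> ?D" if y: "p_elem G q y" for y
    using pp_core_mem[OF q_gen_mem[OF p_elem_in_carrier[OF y] y]] p_elem_imp_pp_elem[OF y p(1,2,3)] by blast
  have "conj u x \<otimes> inv x \<in> ?D"
    using mem[OF p_elem_conj[OF x(1) uc]] mem[OF p_elem_inv[OF x(1)]] subgroup.m_closed[OF pp_core_subgroup] by blast
  then have "comm u x \<in> residual" using p_elems_of_core_in_residual[OF p(1,2,4)] P(2)[OF cP] by blast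
  then show ?thesis using cP by blast
qed

text \<open>If v is the product of the r_i, then r_i agrees with v modulo the centraliser of R_i,
  since the other R_j centralise R_i. They also commute with each other, so v^m is the product of
  the r_i^m; the exponent m serves to pass to p-parts of the components.\<close>

lemma residual_components:
  assumes "k \<le> n" "v \<in> prod_sets G Rs k"
  shows "\<exists>r. (\<forall>i<k. r i \<in> Rs i \<and> inv (r i) \<otimes> v \<in> centralizer G (Rs i)) \<and>
    (\<forall>x m::nat. x \<in> carrier G \<longrightarrow> (\<forall>i<k. x \<otimes> r i [^] m = r i [^] m \<otimes> x) \<longrightarrow> x \<otimes> v [^] m = v [^] m \<otimes> x)"
  using assms
proof (induction k arbitrary: v)
  case 0
  then show ?case by simp
next
  case (Suc k)
  have kn: "k < n" using Suc by simp
  obtain w s where ws: "w \<in> prod_sets G Rs k" "s \<in> Rs k" "v = w \<otimes> s" using Suc.prems(2) by (auto elim: set_multE)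
  obtain r where r: "\<And>i. i < k \<Longrightarrow> r i \<in> Rs i \<and> inv (r i) \<otimes> w \<in> centralizer G (Rs i)"
    "\<And>x m. x \<in> carrier G \<Longrightarrow> (\<forall>i<k. x \<otimes> r i [^] (m::nat) = r i [^] m \<otimes> x) \<Longrightarrow> x \<otimes> w [^] m = w [^] m \<otimes> x"
    using Suc.IH[OF _ ws(1)] kn by (metis less_imp_le_nat)
  have cs: "subgroup (centralizer G (Rs i)) G" if "i < n" for i
    using centralizer_subgroup[OF subgroup.subset[OF Rs_subgroup[OF that]]] .
  have cross: "t \<in> centralizer G (Rs i)" if "i < n" "j < n" "i \<noteq> j" "t \<in> Rs j" for i j t
    using Rs_centralised[OF that(2,1) _ that(4)] that(3) Rs_le[OF that(1)] Rs_carrier[OF that(2,4)]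
    unfolding centralizer_def by blast
  have "prod_sets G Rs k \<subseteq> centralizer G (Rs k)"
    using kn cross by (intro prod_sets_least[OF cs[OF kn]]) (metis less_trans less_irrefl subsetI)
  then have wC: "w \<in> centralizer G (Rs k)" using ws by blast
  have c: "s \<in> carrier G" "w \<in> carrier G" using Rs_carrier[OF kn ws(2)] wC unfolding centralizer_def by auto
  have wsc: "w \<otimes> s = s \<otimes> w" using wC ws(2) unfolding centralizer_def by blast
  let ?r = "r(k := s)"
  have 1: "?r i \<in> Rs i \<and> inv (?r i) \<otimes> v \<in> centralizer G (Rs i)" if i: "i < Suc k" for i
  proof (cases "i = k")
    case True
    have "inv s \<otimes> v = w" unfolding ws(3) wsc using c by simp
    then show ?thesis using True ws wC by simp
  next
    case False
    then have ik: "i < k" "i < n" using i kn by auto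
    have "inv (r i) \<otimes> w \<otimes> s \<in> centralizer G (Rs i)"
      using r(1)[OF ik(1)] cross[OF ik(2) kn False ws(2)] subgroup.m_closed[OF cs[OF ik(2)]] by blast
    moreover have "inv (r i) \<otimes> w \<otimes> s = inv (r i) \<otimes> v" unfolding ws(3)
      using c Rs_carrier[OF ik(2)] r(1)[OF ik(1)] by (simp add: m_assoc)
    ultimately show ?thesis using False r(1)[OF ik(1)] by simp
  qed
  have 2: "x \<otimes> v [^] m = v [^] m \<otimes> x"
    if x: "x \<in> carrier G" and h: "\<forall>i<Suc k. x \<otimes> ?r i [^] m = ?r i [^] m \<otimes> x" for x and m :: nat
  proof -
    have "x \<otimes> r i [^] m = r i [^] m \<otimes> x" if "i < k" for i using h[rule_format, of i] that by simp
    then have "x \<otimes> w [^] m = w [^] m \<otimes> x" using r(2)[OF x] by blast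
    moreover have "x \<otimes> s [^] m = s [^] m \<otimes> x" using h[rule_format, of k] by simp
    moreover have "v [^] m = w [^] m \<otimes> s [^] m" unfolding ws(3) by (rule pow_mult_distrib[OF wsc c(2,1)])
    ultimately show ?thesis using commutes_mult[OF x, of "w [^] m" "s [^] m"] c by simp
  qed
  show ?case by (rule exI[of _ ?r]) (use 1 2 in blast)
qed

text \<open>Since [u, x] lies in P and R, \<open>stable_commute\<close> reduces the claim to the
  intersection of P and R. Its components in R_i form a group \<open>L\<close> that is a p-group
  modulo central elements, so the p-elements of \<open>L\<close> form a subgroup \<open>?T\<close>.
  A q-element y of G_i that acts on R_i as x does normalises \<open>?T\<close>, and
  \<open>hyp\<close> applies to \<open>?T\<close> and y.\<close>

theorem ncrit_commute:
  assumes p: "prime p" "prime q" "p \<noteq> q" "\<not> q dvd p - 1"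
    and hyp: "\<And>i T y t. i < n \<Longrightarrow> subgroup T G \<Longrightarrow> T \<subseteq> Gs i \<Longrightarrow> (\<And>t. t \<in> T \<Longrightarrow> p_elem G p t) \<Longrightarrow>
      y \<in> Gs i \<Longrightarrow> p_elem G q y \<Longrightarrow> y \<in> conj_stab G T \<Longrightarrow> t \<in> T \<Longrightarrow> y \<otimes> t = t \<otimes> y"
    and P: "subgroup P G" "\<And>u. u \<in> P \<Longrightarrow> p_elem G p u"
    and x: "p_elem G q x" "x \<in> conj_stab G P" and u: "u \<in> P"
  shows "x \<otimes> u = u \<otimes> x"
proof -
  have xc: "x \<in> carrier G" using x(1) by (rule p_elem_in_carrier)
  have sR: "subgroup residual G" using normal_imp_subgroup[OF residual_normal] .
  let ?P = "P \<inter> residual"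
  have sP: "subgroup ?P G" using subgroups_Inter_pair[OF P(1) sR] .
  have xP: "conj x v \<in> ?P" if "v \<in> ?P" for v
    using that x(2) normal_invE(2)[OF residual_normal xc] unfolding conj_stab_def by blast
  have main: "x \<otimes> v = v \<otimes> x" if v: "v \<in> ?P" for v
  proof -
    obtain m :: nat where m: "\<And>x. x \<in> carrier G \<Longrightarrow> p_elem G p (x [^] m)" "\<And>x. p_elem G p x \<Longrightarrow> x [^] m = x"
      using p_part_exponent[OF p(1)] by metis
    obtain r where r: "\<And>i. i < n \<Longrightarrow> r i \<in> Rs i \<and> inv (r i) \<otimes> v \<in> centralizer G (Rs i)"
      "\<And>x m. x \<in> carrier G \<Longrightarrow> (\<forall>i<n. x \<otimes> r i [^] (m::nat) = r i [^] m \<otimes> x) \<Longrightarrow> x \<otimes> v [^] m = v [^] m \<otimes> x"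
      using residual_components[of n v] v unfolding residual_def by blast
    have "x \<otimes> r i [^] m = r i [^] m \<otimes> x" if i: "i < n" for i
    proof -
      let ?C = "centralizer G (Rs i)"
      have nC: "?C \<lhd> G" using centralizer_normal[OF Rs_normal[OF i]] .
      have sC: "subgroup ?C G" using normal_imp_subgroup[OF nC] .
      have Cc: "c \<in> carrier G" "\<And>h. h \<in> Rs i \<Longrightarrow> c \<otimes> h = h \<otimes> c" if "c \<in> ?C" for c
        using that unfolding centralizer_def by auto
      \<comment> \<open>The components of \<open>?P\<close> in \<open>Rs i\<close>, which are only determined up to central elements of \<open>Rs i\<close>.\<close>
      define L where "L = {h \<in> Rs i. \<exists>w\<in>?P. inv h \<otimes> w \<in> ?C}"
      have sL: "subgroup L G"
      proof (rule subgroupI)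
        show "L \<subseteq> carrier G" unfolding L_def using Rs_carrier[OF i] by blast
        have "\<one> \<in> L" unfolding L_def
          using subgroup.one_closed[OF Rs_subgroup[OF i]] subgroup.one_closed[OF sP] subgroup.one_closed[OF sC] by (auto intro!: bexI[of _ \<one>])
        then show "L \<noteq> {}" by blast
        fix a assume "a \<in> L"
        then obtain w where a: "a \<in> Rs i" "w \<in> ?P" "inv a \<otimes> w \<in> ?C" unfolding L_def by blast
        have ac: "a \<in> carrier G" "w \<in> carrier G" using Rs_carrier[OF i a(1)] subgroup.mem_carrier[OF sP a(2)] by auto
        let ?c = "inv a \<otimes> w"
        have wa: "w = ?c \<otimes> a" using Cc(2)[OF a(3,1)] ac by simp
        have "inv (inv a) \<otimes> inv w = inv ?c"
        proof -
          have "inv (inv a) \<otimes> inv w = a \<otimes> inv (?c \<otimes> a)" using ac by (subst wa) simp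
          also have "\<dots> = inv ?c" using ac Cc(1)[OF a(3)] by (simp add: grp_word)
          finally show ?thesis .
        qed
        then have "inv (inv a) \<otimes> inv w \<in> ?C" using subgroup.m_inv_closed[OF sC a(3)] by simp
        then show "inv a \<in> L" unfolding L_def
          using subgroup.m_inv_closed[OF Rs_subgroup[OF i] a(1)] subgroup.m_inv_closed[OF sP a(2)] by blast
        fix b assume "b \<in> L"
        then obtain z where b: "b \<in> Rs i" "z \<in> ?P" "inv b \<otimes> z \<in> ?C" unfolding L_def by blast
        have bc: "b \<in> carrier G" "z \<in> carrier G" using Rs_carrier[OF i b(1)] subgroup.mem_carrier[OF sP b(2)] by auto
        have "inv (a \<otimes> b) \<otimes> (w \<otimes> z) = inv b \<otimes> (?c \<otimes> b) \<otimes> (inv b \<otimes> z)" using ac bc by (simp add: grp_word)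
        also have "\<dots> = inv b \<otimes> (b \<otimes> ?c) \<otimes> (inv b \<otimes> z)" using Cc(2)[OF a(3) b(1)] by simp
        also have "\<dots> = ?c \<otimes> (inv b \<otimes> z)" using ac bc by (simp add: m_assoc)
        finally have "inv (a \<otimes> b) \<otimes> (w \<otimes> z) \<in> ?C" using subgroup.m_closed[OF sC a(3) b(3)] by simp
        then show "a \<otimes> b \<in> L" unfolding L_def
          using subgroup.m_closed[OF Rs_subgroup[OF i] a(1) b(1)] subgroup.m_closed[OF sP a(2) b(2)] by blast
      qed
      have pw: "\<exists>k. g [^] (p ^ k) \<in> Rs i \<inter> ?C" if g: "g \<in> L" for g
      proof -
        obtain w where a: "g \<in> Rs i" "w \<in> ?P" "inv g \<otimes> w \<in> ?C" using g unfolding L_def by blast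
        have c: "g \<in> carrier G" "w \<in> carrier G" using Rs_carrier[OF i a(1)] subgroup.mem_carrier[OF sP a(2)] by auto
        let ?c = "inv g \<otimes> w"
        have cc: "?c \<in> carrier G" using c by simp
        have w: "w = g \<otimes> ?c" using c by simp
        obtain k where k: "w [^] (p ^ k) = \<one>" using P(2) a(2) unfolding p_elem_def by blast
        have "(g \<otimes> ?c) [^] (p ^ k) = g [^] (p ^ k) \<otimes> ?c [^] (p ^ k)"
          by (rule pow_mult_distrib[OF _ c(1) cc]) (rule Cc(2)[OF a(3,1), symmetric])
        then have "g [^] (p ^ k) \<otimes> ?c [^] (p ^ k) = \<one>" using k w by simp
        then have "g [^] (p ^ k) = inv (?c [^] (p ^ k))" using c cc by (simp add: inv_equality)
        then have "g [^] (p ^ k) \<in> ?C" using subgroup.m_inv_closed[OF sC] sub_nat_pow_closed[OF sC a(3)] by simp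
        then show ?thesis using sub_nat_pow_closed[OF Rs_subgroup[OF i] a(1)] by blast
      qed
      let ?T = "{t \<in> L. p_elem G p t}"
      have LR: "L \<subseteq> Rs i" unfolding L_def by blast
      have sT: "subgroup ?T G"
        using p_elems_of_central_extension[OF p(1) sL subgroups_Inter_pair[OF Rs_subgroup[OF i] sC] _ pw] Cc(2) LR by blast
      obtain y where y: "acts i x y" "p_elem G q y" using acts_p_elem[OF i p(2) x(1)] .
      have yx: "y \<in> Gs i" "\<And>h. h \<in> Rs i \<Longrightarrow> conj x h = conj y h" using y(1) unfolding acts_def by auto
      have yc: "y \<in> carrier G" using y(2) by (rule p_elem_in_carrier)
      have "y \<in> conj_stab G ?T"
      proof -
        have "conj y t \<in> ?T" if t: "t \<in> ?T" for t
        proof -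
          obtain w where a: "t \<in> Rs i" "w \<in> ?P" "inv t \<otimes> w \<in> ?C" using t unfolding L_def by blast
          have c: "t \<in> carrier G" "w \<in> carrier G" using Rs_carrier[OF i a(1)] subgroup.mem_carrier[OF sP a(2)] by auto
          have "conj x (inv t \<otimes> w) \<in> ?C" using normal_invE(2)[OF nC xc a(3)] .
          moreover have "conj x (inv t \<otimes> w) = inv (conj x t) \<otimes> conj x w" using xc c by (simp add: grp_word)
          ultimately have "inv (conj x t) \<otimes> conj x w \<in> ?C" by simp
          then have "conj x t \<in> L" unfolding L_def using normal_invE(2)[OF Rs_normal[OF i] xc a(1)] xP[OF a(2)] by blast
          then show ?thesis using yx(2)[OF a(1)] p_elem_conj[of p t y] t yc by simp
        qed
        then show ?thesis unfolding conj_stab_def using yc by simp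
      qed
      then have com: "y \<otimes> t = t \<otimes> y" if "t \<in> ?T" for t
        using hyp[OF i sT _ _ yx(1) y(2) _ that] LR Rs_le[OF i] by blast
      have rc: "r i \<in> carrier G" using r(1)[OF i] Rs_carrier[OF i] by blast
      have rL: "r i \<in> L" using r(1)[OF i] v unfolding L_def by blast
      have "r i [^] m \<in> ?T" using sub_nat_pow_closed[OF sL rL] m(1)[OF rc] by simp
      moreover have "r i [^] m \<in> Rs i" using sub_nat_pow_closed[OF Rs_subgroup[OF i]] r(1)[OF i] by blast
      ultimately have "conj x (r i [^] m) = r i [^] m"
        using com yx(2) conj_eq_iff_comm(1)[OF yc, of "r i [^] m"] rc by simp
      then show ?thesis using conj_eq_iff_comm(1)[OF xc, of "r i [^] m"] rc by simp
    qed
    then have "x \<otimes> v [^] m = v [^] m \<otimes> x" using r(2)[OF xc] by blast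
    then show ?thesis using m(2) P(2) v by simp
  qed
  have c: "comm u x \<in> ?P" using commutator_in_residual[OF p P x u] .
  then show ?thesis using stable_commute[OF p(1-3) subgroup.mem_carrier[OF P(1) u] x(1)] P(2) main by blast
qed

text \<open>The reduction to the intersection of P and R is that of \<open>ncrit_commute\<close>,
  but \<open>hyp\<close> now speaks only of full Sylow subgroups of G_i, and the q-element y of G_i
  imitating x need not normalise \<open>Ps i\<close>. With P a product of Sylow subgroups of the
  factors, the intersection splits into the groups \<open>P0 i\<close>, by comparison of
  orders.\<close>

lemma sylow_commute_factors:
  assumes p: "prime p" "prime q" "p \<noteq> q" "\<not> q dvd p - 1"
    and hyp: "\<And>i T y t. i < n \<Longrightarrow> subgroup T G \<Longrightarrow> T \<subseteq> Gs i \<Longrightarrow> card T = p ^ multiplicity p (card (Gs i)) \<Longrightarrow>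
      y \<in> Gs i \<Longrightarrow> p_elem G q y \<Longrightarrow> y \<in> conj_stab G T \<Longrightarrow> t \<in> T \<Longrightarrow> y \<otimes> t = t \<otimes> y"
    and Ps: "\<And>i. i < n \<Longrightarrow> subgroup (Ps i) G" "\<And>i. i < n \<Longrightarrow> Ps i \<subseteq> Gs i"
      "\<And>i. i < n \<Longrightarrow> card (Ps i) = p ^ multiplicity p (card (Gs i))"
    and x: "p_elem G q x" "x \<in> conj_stab G (prod_sets G Ps n)" and u: "u \<in> prod_sets G Ps n"
  shows "x \<otimes> u = u \<otimes> x"
proof -
  let ?P = "prod_sets G Ps n"
  have P: "subgroup ?P G" "card ?P = p ^ multiplicity p (card (carrier G))" "\<And>i. i < n \<Longrightarrow> Ps i \<subseteq> ?P"
    by (rule sylow_factors[of p Ps]; use p(1) Ps in blast)+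
  have Pel: "p_elem G p u" if "u \<in> ?P" for u using p_group_p_elem[OF P(1,2) that] .
  have xc: "x \<in> carrier G" using x(1) by (rule p_elem_in_carrier)
  have sR: "subgroup residual G" using normal_imp_subgroup[OF residual_normal] .
  define P0 where "P0 i = ?P \<inter> Rs i" for i
  have sP0: "subgroup (P0 i) G" if "i < n" for i
    unfolding P0_def using subgroups_Inter_pair[OF P(1) Rs_subgroup[OF that]] .
  have cP0: "card (P0 i) = p ^ multiplicity p (card (Rs i))" if "i < n" for i
    unfolding P0_def using sylow_inter_normal[OF p(1) Rs_normal[OF that] P(1,2)] .
  \<comment> \<open>The intersection of P with G_i is a p-subgroup of G_i containing the Sylow
    subgroup \<open>Ps i\<close>, so it equals \<open>Ps i\<close>.\<close>
  have P0Ps: "P0 i \<subseteq> Ps i" if i: "i < n" for i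
  proof -
    have s: "subgroup (?P \<inter> Gs i) G" using subgroups_Inter_pair[OF P(1) Gs[OF i]] .
    obtain k where k: "card (?P \<inter> Gs i) = p ^ k" using p_group_card[OF p(1) s] Pel by blast
    have "p ^ k dvd card (Gs i)" using sub_card_dvd[OF Gs[OF i] s] k by simp
    then have "k \<le> multiplicity p (card (Gs i))"
      using p(1) card_sub_pos[OF Gs[OF i]] by (metis multiplicity_geI not_prime_unit less_not_refl)
    then have "card (?P \<inter> Gs i) \<le> card (Ps i)" unfolding k Ps(3)[OF i] using prime_gt_0_nat[OF p(1)] by (simp add: power_increasing)
    then have "Ps i = ?P \<inter> Gs i" using Ps(2)[OF i] P(3)[OF i] finite_sub[OF s] by (intro card_seteq) auto
    then show ?thesis unfolding P0_def using Rs_le[OF i] by blast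
  qed
  have perm0: "P0 i <#> P0 j = P0 j <#> P0 i" if "i < n" "j < n" "i \<noteq> j" for i j
    using totally_permutable_subgroups[OF tps[OF that]] sP0 P0Ps Ps(2) that by blast
  have permR: "Rs i <#> Rs j = Rs j <#> Rs i" if "i < n" "j < n" for i j
    using commut_normal[OF Rs_subgroup Rs_normal] that by blast
  have sPP: "subgroup (prod_sets G P0 n) G" using prod_sets_permuting(1)[of n P0 n] sP0 perm0 by blast
  have sub: "prod_sets G P0 n \<subseteq> ?P \<inter> residual"
    unfolding P0_def using Rs_le_residual by (intro prod_sets_least[OF subgroups_Inter_pair[OF P(1) sR], of n "\<lambda>i. ?P \<inter> Rs i"]) blast
  have "card (prod_sets G P0 n) = p ^ multiplicity p (card residual)"
    using sylow_prod_sets[of p n Rs P0 n] p(1) Rs_subgroup permR sP0 perm0 cP0 unfolding residual_def P0_def by blast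
  moreover have "card (?P \<inter> residual) = p ^ multiplicity p (card residual)"
    using sylow_inter_normal[OF p(1) residual_normal P(1,2)] .
  ultimately have "card (prod_sets G P0 n) = card (?P \<inter> residual)" by (rule trans[OF _ sym])
  then have PR: "prod_sets G P0 n = ?P \<inter> residual"
    by (rule card_subset_eq[OF finite_sub[OF subgroups_Inter_pair[OF P(1) sR]] sub])
  have com: "x \<otimes> r = r \<otimes> x" if i: "i < n" and r: "r \<in> P0 i" for i r
  proof -
    let ?C0 = "centralizer G (Rs i)"
    have nC0: "?C0 \<lhd> G" using centralizer_normal[OF Rs_normal[OF i]] .
    have sC0: "subgroup ?C0 G" using normal_imp_subgroup[OF nC0] .
    obtain y where y: "acts i x y" "p_elem G q y" using acts_p_elem[OF i p(2) x(1)] .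
    have yx: "y \<in> Gs i" "\<And>h. h \<in> Rs i \<Longrightarrow> conj x h = conj y h" using y(1) unfolding acts_def by auto
    have yc: "y \<in> carrier G" using y(2) by (rule p_elem_in_carrier)
    have P0R: "P0 i \<subseteq> Rs i" "P0 i \<subseteq> ?P" unfolding P0_def by auto
    have P0c: "h \<in> carrier G" if "h \<in> P0 i" for h using subgroup.mem_carrier[OF sP0[OF i] that] .
    have xP0: "conj x h \<in> P0 i" if h: "h \<in> P0 i" for h
      using h x(2) normal_invE(2)[OF Rs_normal[OF i] xc] unfolding P0_def conj_stab_def by blast
    have yP0: "conj y h \<in> P0 i" if h: "h \<in> P0 i" for h using xP0[OF h] yx(2) h P0R by auto
    have xiP0: "conj (inv x) h \<in> P0 i" if h: "h \<in> P0 i" for h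
    proof -
      have "x \<in> conj_stab G (P0 i)" using xP0 xc unfolding conj_stab_def by blast
      then have "inv x \<in> conj_stab G (P0 i)" using subgroup.m_inv_closed[OF conj_stab_subgroup[OF sP0[OF i]]] by blast
      then show ?thesis using h unfolding conj_stab_def by blast
    qed
    have gP0: "conj g h \<in> P0 i" if g: "g \<in> ?P" and h: "h \<in> P0 i" for g h
      using g h normal_invE(2)[OF Rs_normal[OF i] subgroup.mem_carrier[OF P(1) g]]
        subgroup.m_closed[OF P(1)] subgroup.m_inv_closed[OF P(1)] unfolding P0_def by blast
    define C where "C = Gs i \<inter> centralizer G (P0 i)"
    have sC: "subgroup C G" unfolding C_def
      using subgroups_Inter_pair[OF Gs[OF i] centralizer_subgroup[OF subgroup.subset[OF sP0[OF i]]]] .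
    have CI: "c \<in> C" if "c \<in> Gs i" "\<And>h. h \<in> P0 i \<Longrightarrow> conj c h = h" for c
      using that conj_eq_iff_comm(1) P0c Gs_carrier[OF i] unfolding C_def centralizer_def by blast
    have Cfix: "conj c h = h" if "c \<in> C" "h \<in> P0 i" for c h
      using that conj_eq_iff_comm(1) P0c unfolding C_def centralizer_def by blast
    have PsG: "g \<in> Gs i" "g \<in> carrier G" "g \<in> ?P" if "g \<in> Ps i" for g
      using that Ps(2)[OF i] Gs_carrier[OF i] P(3)[OF i] by auto
    have Cc: "c \<in> carrier G" "c \<in> Gs i" if "c \<in> C" for c using that Gs_carrier[OF i] unfolding C_def by auto
    have conjC: "conj g c \<in> C" if g: "g \<in> Ps i" and c: "c \<in> C" for g c
    proof (rule CI)
      show "conj g c \<in> Gs i" using PsG[OF g] Cc[OF c] Gs[OF i] by (simp add: subgroup.m_closed subgroup.m_inv_closed)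
      fix h assume h: "h \<in> P0 i"
      have "inv g \<in> ?P" using subgroup.m_inv_closed[OF P(1)] PsG[OF g] by blast
      then have "conj (inv g) h \<in> P0 i" using gP0 h by blast
      then have "conj c (conj (inv g) h) = conj (inv g) h" using Cfix[OF c] by blast
      then have "conj g (conj c (conj (inv g) h)) = conj g (conj (inv g) h)" by simp
      then show "conj (conj g c) h = h" using PsG[OF g] Cc[OF c] P0c[OF h] by (simp add: grp_word)
    qed
    have permC: "C <#> Ps i = Ps i <#> C"
    proof
      show "C <#> Ps i \<subseteq> Ps i <#> C"
      proof
        fix z assume "z \<in> C <#> Ps i"
        then obtain c g where cg: "c \<in> C" "g \<in> Ps i" "z = c \<otimes> g" by (rule set_multE)
        have "z = g \<otimes> conj (inv g) c" using cg Cc[OF cg(1)] PsG[OF cg(2)] by (simp add: grp_word)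
        then show "z \<in> Ps i <#> C" using conjC[OF subgroup.m_inv_closed[OF Ps(1)[OF i] cg(2)] cg(1)] cg(2) set_multI by metis
      qed
      show "Ps i <#> C \<subseteq> C <#> Ps i"
      proof
        fix z assume "z \<in> Ps i <#> C"
        then obtain g c where cg: "g \<in> Ps i" "c \<in> C" "z = g \<otimes> c" by (rule set_multE)
        have "z = conj g c \<otimes> g" using cg Cc[OF cg(2)] PsG[OF cg(1)] by (simp add: grp_word)
        then show "z \<in> C <#> Ps i" using conjC[OF cg(1,2)] cg(1) set_multI by metis
      qed
    qed
    let ?H = "C <#> Ps i"
    have sH: "subgroup ?H G" using set_mult_permute_subgroup[OF sC Ps(1)[OF i] permC] .
    have HG: "?H \<subseteq> Gs i" using set_mult_subset_subgroup[OF _ Ps(2)[OF i] Gs[OF i]] unfolding C_def by blast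
    have PsH: "Ps i \<subseteq> ?H" using set_mult_subset_left[OF sC Ps(1)[OF i]] by blast
    \<comment> \<open>Since \<open>[x, Ps i]\<close> acts on \<open>P0 i\<close> by inner automorphisms, \<open>y\<close> normalises \<open>Ps i\<close> modulo the centraliser
      of \<open>P0 i\<close>; Sylow's theorem then corrects \<open>y\<close> to an element normalising \<open>Ps i\<close> itself.\<close>
    have key: "conj y g \<in> ?H" if g: "g \<in> Ps i" for g
    proof -
      have gP: "g \<in> ?P" "g \<in> carrier G" "g \<in> Gs i" using PsG[OF g] by auto
      have "comm g x \<in> ?P \<inter> residual" using commutator_in_residual[OF p P(1) Pel x gP(1)] .
      then have "comm x g \<in> prod_sets G P0 n"
        unfolding PR using comm_swap_mem[OF subgroups_Inter_pair[OF P(1) sR] gP(2) xc] by blast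
      moreover have "prod_sets G P0 n \<subseteq> P0 i <#> ?C0"
      proof (rule prod_sets_least)
        show sPC: "subgroup (P0 i <#> ?C0) G"
          using set_mult_permute_subgroup[OF sP0[OF i] sC0 commut_normal[OF sP0[OF i] nC0]] .
        fix j assume j: "j < n"
        show "P0 j \<subseteq> P0 i <#> ?C0"
        proof (cases "i = j")
          case True
          then show ?thesis using set_mult_subset_left(1)[OF sP0[OF i] sC0] by simp
        next
          case False
          have "P0 j \<subseteq> ?C0"
            using Rs_centralised[OF j i] False Rs_le[OF i] Rs_carrier[OF j] unfolding P0_def centralizer_def by blast
          then show ?thesis using set_mult_subset_left(2)[OF sP0[OF i] sC0] by blast
        qed
      qed
      ultimately have "comm x g \<in> P0 i <#> ?C0" by blast
      then obtain e c where ec: "e \<in> P0 i" "c \<in> ?C0" "comm x g = e \<otimes> c" by (rule set_multE)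
      have cc: "c \<in> carrier G" using ec(2) unfolding centralizer_def by blast
      have eG: "e \<in> Ps i" "e \<in> carrier G" "e \<in> ?P" using ec(1) P0Ps[OF i] P0c P0R by auto
      have cfix: "conj c h = h" if "h \<in> Rs i" for h
        using ec(2) that conj_eq_iff_comm(1)[OF cc Rs_carrier[OF i that]] unfolding centralizer_def by blast
      have xg: "conj x g = e \<otimes> c \<otimes> g" using ec(3)[symmetric] xc gP(2) by (simp add: grp_word)
      let ?d = "inv (e \<otimes> g) \<otimes> conj y g"
      have egP: "e \<otimes> g \<in> Ps i" using subgroup.m_closed[OF Ps(1)[OF i] eG(1) g] .
      have "?d \<in> C"
      proof (rule CI)
        show "?d \<in> Gs i" using PsG[OF egP] yx(1) gP(3) Gs[OF i] by (simp add: subgroup.m_closed subgroup.m_inv_closed)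
        fix h assume h: "h \<in> P0 i"
        have hc: "h \<in> carrier G" using P0c[OF h] .
        let ?h = "conj (inv x) h"
        have h': "?h \<in> P0 i" using xiP0[OF h] .
        have yh: "conj (inv y) h = ?h"
        proof -
          have "conj y ?h = conj x ?h" using yx(2) h' P0R by auto
          also have "\<dots> = h" using xc hc by (simp add: grp_word)
          finally show ?thesis using conj_inv_eq[OF yc P0c[OF h'] hc] by simp
        qed
        have "conj (conj y g) h = conj y (conj g (conj (inv y) h))" using yc gP(2) hc by (simp add: grp_word)
        also have "\<dots> = conj y (conj g ?h)" using yh by simp
        also have "\<dots> = conj x (conj g ?h)" using yx(2) gP0[OF gP(1) h'] P0R by auto
        also have "\<dots> = conj (conj x g) h" using xc gP(2) hc by (simp add: grp_word)
        also have "\<dots> = conj e (conj c (conj g h))" unfolding xg using eG(2) cc gP(2) hc by (simp add: grp_word)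
        also have "\<dots> = conj e (conj g h)" using cfix gP0[OF gP(1) h] P0R by auto
        finally have "conj (conj y g) h = conj e (conj g h)" .
        then have "conj (inv (e \<otimes> g)) (conj (conj y g) h) = conj (inv (e \<otimes> g)) (conj e (conj g h))" by simp
        also have "\<dots> = h" using eG(2) gP(2) hc by (simp add: grp_word)
        also have "conj (inv (e \<otimes> g)) (conj (conj y g) h) = conj ?d h"
          using conj_conj[of "inv (e \<otimes> g)" "conj y g" h] eG(2) gP(2) yc hc by simp
        finally show "conj ?d h = h" .
      qed
      then have "(e \<otimes> g) \<otimes> ?d \<in> Ps i <#> C" using egP by (rule set_multI[rotated])
      moreover have "(e \<otimes> g) \<otimes> ?d = conj y g" using eG(2) gP(2) yc by simp
      ultimately show ?thesis using permC by simp
    qed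
    have sQ: "subgroup (conj y ` Ps i) G"
    proof -
      interpret gh: group_hom G G "conj y" using conj_hom[OF yc] .
      show ?thesis using gh.subgroup_img_is_subgroup[OF Ps(1)[OF i]] .
    qed
    have inj: "inj_on (conj y) (Ps i)" using conj_inj_on[OF yc subgroup.subset[OF Ps(1)[OF i]]] .
    have cQ: "card (conj y ` Ps i) = p ^ multiplicity p (card (Gs i))" using card_image[OF inj] Ps(3)[OF i] by simp
    have nd: "\<not> p dvd card ?H div card (Ps i)"
      using sylow_index[OF p(1) sH Ps(1)[OF i] PsH Ps(1)[OF i] subset_refl
        sylow_intermediate[OF p(1) Gs[OF i] sH HG Ps(1)[OF i] PsH Ps(3)[OF i]]] .
    have QH: "conj y ` Ps i \<subseteq> ?H" using key by blast
    obtain h where h: "h \<in> ?H" "\<And>z. z \<in> conj y ` Ps i \<Longrightarrow> conj (inv h) z \<in> Ps i"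
      using sylow_conj[OF p(1) sH Ps(1)[OF i] PsH nd sQ QH cQ] by blast
    obtain c g where cg: "c \<in> C" "g \<in> Ps i" "h = c \<otimes> g" using h(1) by (rule set_multE)
    define t where "t = inv c \<otimes> y"
    have tG: "t \<in> Gs i" "t \<in> carrier G"
      unfolding t_def using Cc[OF cg(1)] yx(1) yc Gs[OF i] by (simp_all add: subgroup.m_closed subgroup.m_inv_closed)
    have "conj t a \<in> Ps i" if a: "a \<in> Ps i" for a
    proof -
      have ac: "a \<in> carrier G" using PsG[OF a] by blast
      have 1: "conj (inv h) (conj y a) \<in> Ps i" using h(2) a by blast
      have "conj g (conj (inv h) (conj y a)) \<in> Ps i"
        using 1 cg(2) subgroup.m_closed[OF Ps(1)[OF i]] subgroup.m_inv_closed[OF Ps(1)[OF i]] by blast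
      moreover have "conj g (conj (inv h) (conj y a)) = conj t a"
        unfolding cg(3) t_def using PsG[OF cg(2)] Cc[OF cg(1)] yc ac by (simp add: grp_word)
      ultimately show ?thesis by simp
    qed
    then have tst: "t \<in> conj_stab G (Ps i)" unfolding conj_stab_def using tG by blast
    have ty: "conj t a = conj y a" if a: "a \<in> P0 i" for a
    proof -
      have "conj t a = conj (inv c) (conj y a)" unfolding t_def by (rule conj_conj[symmetric]) (use Cc[OF cg(1)] yc P0c[OF a] in auto)
      then show ?thesis using Cfix[OF subgroup.m_inv_closed[OF sC cg(1)] yP0[OF a]] by simp
    qed
    have tpow: "conj (t [^] k) a = conj (y [^] k) a" if "a \<in> P0 i" for a and k :: nat
      using that
    proof (induction k arbitrary: a)
      case (Suc k)
      have ac: "a \<in> carrier G" using P0c[OF Suc.prems] .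
      have "conj (t [^] Suc k) a = conj (t [^] k) (conj t a)" using tG(2) ac by (simp add: grp_word)
      also have "\<dots> = conj (t [^] k) (conj y a)" using ty[OF Suc.prems] by simp
      also have "\<dots> = conj (y [^] k) (conj y a)" using Suc.IH[OF yP0[OF Suc.prems]] .
      also have "\<dots> = conj (y [^] Suc k) a" using yc ac by (simp add: grp_word)
      finally show ?case .
    qed (simp add: P0c)
    \<comment> \<open>The q-part of t still normalises Ps_i, and on \<open>P0 i\<close> it acts as
      y^m = y.\<close>
    obtain m :: nat where m: "\<And>x. x \<in> carrier G \<Longrightarrow> p_elem G q (x [^] m)" "\<And>x. p_elem G q x \<Longrightarrow> x [^] m = x"
      using p_part_exponent[OF p(2)] by metis
    have rP: "r \<in> Ps i" using r P0Ps[OF i] by blast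
    have "t [^] m \<otimes> r = r \<otimes> t [^] m"
      using hyp[OF i Ps(1)[OF i] Ps(2)[OF i] Ps(3)[OF i] sub_nat_pow_closed[OF Gs[OF i] tG(1)] m(1)[OF tG(2)]
        sub_nat_pow_closed[OF conj_stab_subgroup[OF Ps(1)[OF i]] tst] rP] .
    then have "conj (t [^] m) r = r" using conj_eq_iff_comm(1)[of "t [^] m" r] tG(2) P0c[OF r] by simp
    then have "conj x r = r" using tpow[OF r, of m] m(2)[OF y(2)] yx(2) r P0R by auto
    then show ?thesis using conj_eq_iff_comm(1)[OF xc P0c[OF r]] by simp
  qed
  have "prod_sets G P0 n \<subseteq> {v \<in> carrier G. x \<otimes> v = v \<otimes> x}"
  proof (rule prod_sets_least)
    show "subgroup {v \<in> carrier G. x \<otimes> v = v \<otimes> x} G"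
      by (rule subgroupI) (use xc commutes_inv(1) commutes_mult in \<open>auto intro: one_closed\<close>)
    show "P0 i \<subseteq> {v \<in> carrier G. x \<otimes> v = v \<otimes> x}" if "i < n" for i
      using com[OF that] subgroup.mem_carrier[OF sP0[OF that]] by blast
  qed
  then have main: "x \<otimes> v = v \<otimes> x" if "v \<in> ?P \<inter> residual" for v using that PR by blast
  have c: "comm u x \<in> ?P \<inter> residual" using commutator_in_residual[OF p P(1) Pel x u] .
  then show ?thesis using stable_commute[OF p(1-3) subgroup.mem_carrier[OF P(1) u] x(1)] Pel main by blast
qed

text \<open>By Sylow's theorem P is conjugate to a product of Sylow subgroups of the factors; x and
  u are conjugated along with it.\<close>

theorem sylow_commute:
  assumes p: "prime p" "prime q" "p \<noteq> q" "\<not> q dvd p - 1"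
    and hyp: "\<And>i T y t. i < n \<Longrightarrow> subgroup T G \<Longrightarrow> T \<subseteq> Gs i \<Longrightarrow> card T = p ^ multiplicity p (card (Gs i)) \<Longrightarrow>
      y \<in> Gs i \<Longrightarrow> p_elem G q y \<Longrightarrow> y \<in> conj_stab G T \<Longrightarrow> t \<in> T \<Longrightarrow> y \<otimes> t = t \<otimes> y"
    and P: "subgroup P G" "card P = p ^ multiplicity p (card (carrier G))"
    and x: "p_elem G q x" "x \<in> conj_stab G P" and u: "u \<in> P"
  shows "x \<otimes> u = u \<otimes> x"
proof -
  obtain Ps where Ps: "\<And>i. i < n \<Longrightarrow> subgroup (Ps i) G" "\<And>i. i < n \<Longrightarrow> Ps i \<subseteq> Gs i"
      "\<And>i. i < n \<Longrightarrow> card (Ps i) = p ^ multiplicity p (card (Gs i))" using sylow_factors_exist[OF p(1)] by blast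
  let ?P = "prod_sets G Ps n"
  have PP: "subgroup ?P G" "card ?P = p ^ multiplicity p (card (carrier G))"
    by (rule sylow_factors[of p Ps]; use p(1) Ps in blast)+
  have xc: "x \<in> carrier G" using x(1) by (rule p_elem_in_carrier)
  have Pc: "v \<in> carrier G" if "v \<in> P" for v using subgroup.mem_carrier[OF P(1) that] .
  have "\<not> p dvd card (carrier G) div card ?P"
    using sylow_index[OF p(1) subgroup_self PP(1) subgroup.subset[OF PP(1)] PP(1) subset_refl PP(2)] .
  then obtain g where g: "g \<in> carrier G" "\<And>v. v \<in> P \<Longrightarrow> conj (inv g) v \<in> ?P"
    using sylow_conj[OF p(1) subgroup_self PP(1) subgroup.subset[OF PP(1)] _ P(1) subgroup.subset[OF P(1)] P(2)] by blast
  have inj: "inj_on (conj (inv g)) P" using conj_inj_on[OF inv_closed[OF g(1)] subgroup.subset[OF P(1)]] .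
  have "card (conj (inv g) ` P) = card ?P" using card_image[OF inj] P(2) PP(2) by simp
  moreover have "conj (inv g) ` P \<subseteq> ?P" using g(2) by blast
  ultimately have img: "conj (inv g) ` P = ?P" by (intro card_subset_eq[OF finite_sub[OF PP(1)]])
  let ?x = "conj (inv g) x"
  have gi: "inv g \<in> carrier G" using g(1) by simp
  have "conj ?x v \<in> ?P" if "v \<in> ?P" for v
  proof -
    have "v \<in> conj (inv g) ` P" using that by (simp only: img)
    then obtain w where w: "w \<in> P" "v = conj (inv g) w" by (rule imageE) 
    have "conj ?x v = conj (inv g) (conj x w)" unfolding w(2) using g(1) xc Pc[OF w(1)] by (simp add: grp_word)
    then show ?thesis using w(1) x(2) g(2) unfolding conj_stab_def by auto
  qed
  then have st: "?x \<in> conj_stab G ?P" unfolding conj_stab_def using gi xc by simp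
  have "?x \<otimes> conj (inv g) u = conj (inv g) u \<otimes> ?x"
    by (rule sylow_commute_factors[of p q Ps]; (rule p_elem_conj[OF x(1) gi] st g(2)[OF u])?; use p hyp Ps in blast)
  then have "g \<otimes> (?x \<otimes> conj (inv g) u) \<otimes> inv g = g \<otimes> (conj (inv g) u \<otimes> ?x) \<otimes> inv g" by simp
  then show ?thesis using g(1) xc Pc[OF u] by (simp add: grp_word)
qed

end

section \<open>The three graphs\<close>

context fin_group begin

section \<open>The Sylow graph in terms of commuting elements\<close>

lemma normalizer_eq:
  assumes P: "subgroup P G"
  shows "normalizer G P = conj_stab G P"
proof -
  have Pc: "P \<subseteq> carrier G" using subgroup.subset[OF P] .
  have img: "g <# P #> inv g = conj g ` P" for g
    unfolding l_coset_def r_coset_def by auto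
  have 1: "g \<in> normalizer G P \<longleftrightarrow> g \<in> carrier G \<and> conj g ` P = P" for g
    unfolding normalizer_def stabilizer_def using Pc by (auto simp: img)
  have "conj g ` P = P" if g: "g \<in> conj_stab G P" for g
  proof
    show "conj g ` P \<subseteq> P" using g unfolding conj_stab_def by blast
    show "P \<subseteq> conj g ` P"
    proof
      fix u assume u: "u \<in> P"
      have gc: "g \<in> carrier G" using g unfolding conj_stab_def by blast
      have "conj (inv g) u \<in> P"
        using subgroup.m_inv_closed[OF conj_stab_subgroup[OF P] g] u unfolding conj_stab_def by blast
      moreover have "u = conj g (conj (inv g) u)" using gc subgroup.mem_carrier[OF P u] by (simp add: grp_word)
      ultimately show "u \<in> conj g ` P" by blast
    qed
  qed
  then have "g \<in> normalizer G P" if "g \<in> conj_stab G P" for g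
    using 1 that unfolding conj_stab_def by simp
  moreover have "g \<in> conj_stab G P" if "g \<in> normalizer G P" for g
  proof -
    have g: "g \<in> carrier G" "conj g ` P = P" using that 1 by auto
    have "conj g u \<in> P" if "u \<in> P" for u using imageI[OF that, of "conj g"] g(2) by simp
    then show ?thesis unfolding conj_stab_def using g(1) by simp
  qed
  ultimately show ?thesis by blast
qed

text \<open>PC is normal in N, so q is prime to its index exactly when PC contains all q-elements of
  N. For q other than p a q-element v c of PC is in C, since a p-power of it is; for q = p the Sylow
  subgroup P contains all p-elements of N, so there are no loops.\<close>

lemma sylow_graph_edge_iff:
  "(p, q) \<in> snd (sylow_graph G) \<longleftrightarrow> p \<in> prime_set G \<and> prime q \<and> p \<noteq> q \<and>
    (\<exists>P. sylow_subgroup G p P \<and> (\<exists>x\<in>conj_stab G P. \<exists>u\<in>P. p_elem G q x \<and> x \<otimes> u \<noteq> u \<otimes> x))"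
proof -
  have main: "q dvd card (normalizer G P) div card (P <#> centralizer G P) \<longleftrightarrow>
      p \<noteq> q \<and> (\<exists>x\<in>conj_stab G P. \<exists>u\<in>P. p_elem G q x \<and> x \<otimes> u \<noteq> u \<otimes> x)"
    if p: "prime p" and q: "prime q" and syl: "sylow_subgroup G p P" for P
  proof -
    have P: "subgroup P G" "card P = p ^ multiplicity p (card (carrier G))"
      using syl unfolding sylow_subgroup_def order_def by auto
    let ?N = "conj_stab G P" and ?C = "centralizer G P"
    have N: "normalizer G P = ?N" by (rule normalizer_eq[OF P(1)])
    have sN: "subgroup ?N G" by (rule conj_stab_subgroup[OF P(1)])
    have Pc: "u \<in> carrier G" if "u \<in> P" for u using subgroup.mem_carrier[OF P(1) that] .
    have sC: "subgroup ?C G" using centralizer_subgroup[OF subgroup.subset[OF P(1)]] .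
    have Cc: "c \<in> carrier G" "\<And>u. u \<in> P \<Longrightarrow> c \<otimes> u = u \<otimes> c" if "c \<in> ?C" for c using that unfolding centralizer_def by auto
    have CN: "?C \<subseteq> ?N"
    proof
      fix c assume c: "c \<in> ?C"
      have "conj c u = u" if "u \<in> P" for u using conj_eq_iff_comm(1)[OF Cc(1)[OF c] Pc[OF that]] Cc(2)[OF c that] by blast
      then show "c \<in> ?N" unfolding conj_stab_def using Cc(1)[OF c] by simp
    qed
    have PN: "P \<subseteq> ?N" using subgroup_le_conj_stab[OF P(1)] .
    have Nc: "g \<in> carrier G" "\<And>u. u \<in> P \<Longrightarrow> conj g u \<in> P" if "g \<in> ?N" for g using that unfolding conj_stab_def by auto
    have PC: "P <#> ?C = ?C <#> P"
    proof -
      have "a \<otimes> b = b \<otimes> a" if "a \<in> P" "b \<in> ?C" for a b using Cc(2)[OF that(2,1)] by simp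
      then show ?thesis unfolding set_mult_def by (auto; metis)
    qed
    have sPC: "subgroup (P <#> ?C) G" using set_mult_permute_subgroup[OF P(1) sC PC] .
    have PCN: "P <#> ?C \<subseteq> ?N" using set_mult_subset_subgroup[OF PN CN sN] .
    have NPC: "?N \<subseteq> conj_stab G (P <#> ?C)"
    proof
      fix g assume g: "g \<in> ?N"
      have "conj g z \<in> P <#> ?C" if z: "z \<in> P <#> ?C" for z
      proof -
        obtain u c where uc: "u \<in> P" "c \<in> ?C" "z = u \<otimes> c" using z by (rule set_multE)
        have eq: "conj g z = conj g u \<otimes> conj g c" using uc Pc Cc Nc(1)[OF g] by (simp add: grp_word)
        have "conj g c \<otimes> v = v \<otimes> conj g c" if v: "v \<in> P" for v
        proof -
          have gi: "inv g \<in> ?N" using subgroup.m_inv_closed[OF sN g] .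
          have "c \<otimes> conj (inv g) v = conj (inv g) v \<otimes> c" using Cc(2)[OF uc(2) Nc(2)[OF gi v]] .
          then have "g \<otimes> (c \<otimes> conj (inv g) v) \<otimes> inv g = g \<otimes> (conj (inv g) v \<otimes> c) \<otimes> inv g" by simp
          then show ?thesis using Nc(1)[OF g] Cc(1)[OF uc(2)] Pc[OF v] by (simp add: grp_word)
        qed
        then have "conj g c \<in> ?C" unfolding centralizer_def using Nc(1)[OF g] Cc(1)[OF uc(2)] by simp
        then show ?thesis unfolding eq using Nc(2)[OF g uc(1)] by (rule set_multI[rotated])
      qed
      then show "g \<in> conj_stab G (P <#> ?C)" unfolding conj_stab_def using Nc(1)[OF g] by blast
    qed
    show ?thesis unfolding N
    proof
      assume qd: "q dvd card ?N div card (P <#> ?C)"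
      then obtain x where x: "p_elem G q x" "x \<in> ?N" "x \<notin> P <#> ?C"
        using coprime_index_if_p_elems_in[OF q sN sPC PCN] by blast
      have xC: "x \<notin> ?C" using x(3) set_mult_subset_left(2)[OF P(1) sC] by blast
      then obtain u where u: "u \<in> P" "x \<otimes> u \<noteq> u \<otimes> x" unfolding centralizer_def using Nc(1)[OF x(2)] by blast
      have "p \<noteq> q"
      proof
        assume "p = q"
        then have "x \<in> P"
          using sylow_overgroup_contains_p_elems[OF p sN P(1) PN _ P(1) _ sylow_intermediate[OF p subgroup_self sN subgroup.subset[OF sN] P(1) PN P(2)] x(2)] x(1) by simp
        then show False using x(3) set_mult_subset_left(1)[OF P(1) sC] by blast
      qed
      then show "p \<noteq> q \<and> (\<exists>x\<in>?N. \<exists>u\<in>P. p_elem G q x \<and> x \<otimes> u \<noteq> u \<otimes> x)" using x u by blast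
    next
      assume r: "p \<noteq> q \<and> (\<exists>x\<in>?N. \<exists>u\<in>P. p_elem G q x \<and> x \<otimes> u \<noteq> u \<otimes> x)"
      then obtain x u where x: "x \<in> ?N" "p_elem G q x" and u: "u \<in> P" "x \<otimes> u \<noteq> u \<otimes> x" by blast
      show "q dvd card ?N div card (P <#> ?C)"
      proof (rule ccontr)
        assume "\<not> q dvd card ?N div card (P <#> ?C)"
        then have "x \<in> P <#> ?C" using p_elem_in_coprime_index[OF q sN sPC PCN NPC _ x] by blast
        then obtain v c where vc: "v \<in> P" "c \<in> ?C" "x = v \<otimes> c" by (rule set_multE)
        have c: "v \<in> carrier G" "c \<in> carrier G" "v \<otimes> c = c \<otimes> v"
          using vc Pc Cc(1) Cc(2)[OF vc(2,1), symmetric] by auto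
        have xc: "x \<in> carrier G" using Nc(1)[OF x(1)] .
        obtain k where k: "v [^] (p ^ k) = \<one>" using p_group_p_elem[OF P vc(1)] unfolding p_elem_def by blast
        have "x [^] (p ^ k) = v [^] (p ^ k) \<otimes> c [^] (p ^ k)" unfolding vc(3) by (rule pow_mult_distrib[OF c(3,1,2)])
        then have 1: "x [^] (p ^ k) \<in> ?C" using k c sub_nat_pow_closed[OF sC vc(2)] by simp
        obtain j where "x [^] (q ^ j) = \<one>" using x(2) unfolding p_elem_def by blast
        then have 2: "x [^] (q ^ j) \<in> ?C" using subgroup.one_closed[OF sC] by simp
        have "coprime (p ^ k) (q ^ j)" using primes_coprime[OF p q] r by simp
        then have "x \<in> ?C" using mem_of_coprime_powers[OF sC xc 1 2] by blast
        then show False using Cc(2) u by blast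
      qed
    qed
  qed
  show ?thesis
    unfolding sylow_graph_def prime_divs_def prime_set_def using main by auto
qed

section \<open>The largest normal p-nilpotent subgroup and the Hawkes graph\<close>

definition p_nilpotent_normal :: "nat \<Rightarrow> 'a set \<Rightarrow> 'a set \<Rightarrow> bool" where
  "p_nilpotent_normal p M K \<longleftrightarrow> K \<lhd> G \<and> K \<subseteq> M \<and> \<not> p dvd card K \<and> (\<exists>k. card M = card K * p ^ k)"

lemma pp_elem_if_coprime_card:
  assumes p: "prime p" and K: "subgroup K G" "\<not> p dvd card K" and x: "x \<in> K"
  shows "pp_elem G p x"
proof -
  have "x [^]\<^bsub>G\<lparr>carrier := K\<rparr>\<^esub> card K = \<one>"
    using group.pow_order_eq_1[OF subgroup_imp_group[OF K(1)], of x] x by (simp add: order_def)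
  then have "x [^] card K = \<one>" by (simp flip: nat_pow_consistent)
  moreover have "coprime (card K) p" using p K(2) by (simp add: coprime_commute prime_imp_coprime)
  ultimately show ?thesis unfolding pp_elem_def using subgroup.mem_carrier[OF K(1) x] by blast
qed

lemma pp_elem_in_p_power_index:
  assumes p: "prime p" and M: "subgroup M G" and K: "subgroup K G" "K \<subseteq> M" "M \<subseteq> conj_stab G K"
    and idx: "card M = card K * p ^ k" and x: "x \<in> M" "pp_elem G p x"
  shows "x \<in> K"
proof -
  have xc: "x \<in> carrier G" using x(2) by (rule pp_elem_in_carrier)
  let ?X = "generate G {x}"
  have sX: "subgroup ?X G" using generate_is_subgroup xc by simp
  have XM: "?X \<subseteq> M" using generate_subgroup_incl[OF _ M] x by simp
  obtain m where m: "x [^] m = \<one>" "coprime m p" using x(2) unfolding pp_elem_def by blast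
  have ppX: "pp_elem G p y" if y: "y \<in> ?X" for y
  proof -
    obtain i :: int where i: "y = x [^] i" using y generate_pow[OF xc] by auto
    have "y [^] int m = (x [^] int m) [^] i"
      unfolding i int_pow_pow[OF xc] by (simp only: mult.commute)
    then have "y [^] m = \<one>" using m unfolding int_pow_int by simp
    then show ?thesis unfolding pp_elem_def using m i xc by auto
  qed
  have "?X \<subseteq> K"
  proof (rule subgroup_contains_if_p_elems[OF sX K(1)])
    fix s y assume s: "prime s" and y: "p_elem G s y" "y \<in> ?X"
    show "y \<in> K"
    proof (cases "s = p")
      case True
      then have "y = \<one>" using p_elem_and_pp_elem ppX[OF y(2)] y(1) by blast
      then show ?thesis using subgroup.one_closed[OF K(1)] by simp
    next
      case False
      have "card M div card K = p ^ k" using idx card_sub_pos[OF K(1)] by simp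
      then have "\<not> s dvd card M div card K" using s p False by (metis prime_dvd_power primes_dvd_imp_eq)
      then show ?thesis using p_elem_in_coprime_index[OF s M K] XM y by blast
    qed
  qed
  then show ?thesis by (meson generate.incl singletonI subsetD)
qed

text \<open>The normal p-complement of M consists of all p'-elements of M, so conjugation by G
  preserves it and its normality in M improves to normality in G.\<close>

lemma p_nilpotent_iff:
  assumes p: "prime p" and M: "M \<lhd> G"
  shows "p_nilpotent (G\<lparr>carrier := M\<rparr>) p \<longleftrightarrow> (\<exists>K. p_nilpotent_normal p M K)"
proof
  have sM: "subgroup M G" using normal_imp_subgroup[OF M] .
  let ?H = "G\<lparr>carrier := M\<rparr>"
  interpret H: fin_group ?H using sub_fin_group[OF sM] .
  {
    assume "p_nilpotent ?H p"
    then obtain K k where K: "K \<lhd> ?H" "\<not> p dvd card K" "card M = card K * p ^ k"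
      unfolding p_nilpotent_def order_def by auto
    have KH: "subgroup K ?H" using normal_imp_subgroup[OF K(1)] .
    have sK: "subgroup K G" using incl_subgroup[OF sM KH] .
    have KM: "K \<subseteq> M" using subgroup.subset[OF KH] by simp
    have MK: "M \<subseteq> conj_stab G K"
      using H.normal_invE(2)[OF K(1)] m_inv_consistent[OF sM] subgroup.mem_carrier[OF sM] unfolding conj_stab_def by auto
    have "K \<lhd> G"
    proof (rule normal_invI[OF sK])
      fix g h assume g: "g \<in> carrier G" and h: "h \<in> K"
      have "conj g h \<in> M" using normal_invE(2)[OF M g] h KM by blast
      moreover have "pp_elem G p (conj g h)" using pp_elem_conj[OF pp_elem_if_coprime_card[OF p sK K(2) h] g] .
      ultimately show "conj g h \<in> K" using pp_elem_in_p_power_index[OF p sM sK KM MK K(3)] by blast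
    qed
    then show "\<exists>K. p_nilpotent_normal p M K" unfolding p_nilpotent_normal_def using K KM by blast
  }
  {
    assume "\<exists>K. p_nilpotent_normal p M K"
    then obtain K k where K: "K \<lhd> G" "K \<subseteq> M" "\<not> p dvd card K" "card M = card K * p ^ k"
      unfolding p_nilpotent_normal_def by blast
    have "K \<lhd> ?H" using normal_restrict_supergroup[OF sM K(1,2)] .
    then show "p_nilpotent ?H p" unfolding p_nilpotent_def order_def using K by auto
  }
qed

text \<open>By the product formula the index of K K' in M M' divides p^(k + k'), the cofactor being
  the index of the intersections.\<close>

lemma p_nilpotent_normal_mult:
  assumes p: "prime p" and M: "M \<lhd> G" "M' \<lhd> G" and K: "p_nilpotent_normal p M K" "p_nilpotent_normal p M' K'"
  shows "p_nilpotent_normal p (M <#> M') (K <#> K')"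
proof -
  obtain k k' where K1: "K \<lhd> G" "K \<subseteq> M" "\<not> p dvd card K" "card M = card K * p ^ k"
    and K2: "K' \<lhd> G" "K' \<subseteq> M'" "\<not> p dvd card K'" "card M' = card K' * p ^ k'"
    using K unfolding p_nilpotent_normal_def by blast
  have s: "subgroup M G" "subgroup M' G" "subgroup K G" "subgroup K' G" using M K1 K2 normal_imp_subgroup by auto
  have nKK: "K <#> K' \<lhd> G"
    using set_mult_normal K1(1) K2(1) by blast
  have sKK: "subgroup (K <#> K') G" using normal_imp_subgroup[OF nKK] .
  have sMM: "subgroup (M <#> M') G" using set_mult_permute_subgroup[OF s(1,2) commut_normal[OF s(1) M(2)]] .
  have sub: "K <#> K' \<subseteq> M <#> M'" using K1(2) K2(2) by (rule mono_set_mult)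
  have nd: "\<not> p dvd card (K <#> K')"
    using card_set_mult[OF s(3,4)] K1(3) K2(3) p by (metis dvd_mult2 prime_dvd_mult_iff)
  have si: "subgroup (M \<inter> M') G" "subgroup (K \<inter> K') G" using subgroups_Inter_pair s by blast+
  obtain c where c: "card (M <#> M') = card (K <#> K') * c" using sub_card_dvd[OF sMM sKK sub] by blast
  obtain d where d: "card (M \<inter> M') = card (K \<inter> K') * d"
    using sub_card_dvd[OF si] K1(2) K2(2) by blast
  have "card (M <#> M') * card (M \<inter> M') = card M * card M'" by (rule card_set_mult[OF s(1,2)])
  then have "(card (K <#> K') * card (K \<inter> K')) * (c * d) = (card K * card K') * p ^ (k + k')"
    unfolding c d K1(4) K2(4) by (simp add: power_add mult_ac)
  then have "(card K * card K') * (c * d) = (card K * card K') * p ^ (k + k')" unfolding card_set_mult[OF s(3,4)] .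
  moreover have "card K * card K' > 0" using card_sub_pos[OF s(3)] card_sub_pos[OF s(4)] by simp
  ultimately have "c * d = p ^ (k + k')" by (metis mult_left_cancel less_not_refl)
  then have "c dvd p ^ (k + k')" by (metis dvd_triv_left)
  then obtain j where "c = p ^ j" using divides_primepow_nat[OF p] by blast
  then show ?thesis unfolding p_nilpotent_normal_def using nKK sub nd c by blast
qed

text \<open>The description in \<open>O_pp\<close> does determine a subgroup: normal p-nilpotent
  subgroups are closed under products, so one of greatest order contains all others.\<close>

lemma O_pp_properties:
  assumes p: "prime p"
  shows "O_pp G p \<lhd> G" "\<exists>K. p_nilpotent_normal p (O_pp G p) K"
    "\<And>M K. M \<lhd> G \<Longrightarrow> p_nilpotent_normal p M K \<Longrightarrow> M \<subseteq> O_pp G p"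
proof -
  define F where "F = {M. M \<lhd> G \<and> p_nilpotent (G\<lparr>carrier := M\<rparr>) p}"
  have F_sub: "subgroup M G" if "M \<in> F" for M using that normal_imp_subgroup unfolding F_def by blast
  have one: "{\<one>} \<in> F"
  proof -
    have "p_nilpotent_normal p {\<one>} {\<one>}"
      unfolding p_nilpotent_normal_def using one_is_normal prime_gt_1_nat[OF p] by (auto intro: exI[of _ 0])
    then show ?thesis unfolding F_def using p_nilpotent_iff[OF p one_is_normal] one_is_normal by blast
  qed
  have "card M < Suc (card (carrier G))" if "M \<in> F" for M
    using subgroup.subset[OF F_sub[OF that]] by (simp add: card_mono less_Suc_eq_le)
  then obtain N where N: "N \<in> F" "\<And>M. M \<in> F \<Longrightarrow> card M \<le> card N"
    using ex_has_greatest_nat[of "\<lambda>M. M \<in> F" "{\<one>}" card "Suc (card (carrier G))"] one by blast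
  have big: "M \<subseteq> N" if M: "M \<in> F" for M
  proof -
    have n: "M \<lhd> G" "N \<lhd> G" using M N(1) unfolding F_def by auto
    obtain K K' where K: "p_nilpotent_normal p M K" "p_nilpotent_normal p N K'"
      using M N(1) p_nilpotent_iff[OF p] unfolding F_def by blast
    have MN: "M <#> N \<lhd> G" using set_mult_normal[OF n] .
    then have "M <#> N \<in> F" unfolding F_def using p_nilpotent_iff[OF p MN] p_nilpotent_normal_mult[OF p n K] by blast
    then have "card (M <#> N) \<le> card N" by (rule N(2))
    moreover have "N \<subseteq> M <#> N" "M \<subseteq> M <#> N" using set_mult_subset_left[OF F_sub[OF M] F_sub[OF N(1)]] by auto
    moreover have "finite (M <#> N)" using normal_imp_subgroup[OF MN] by simp
    ultimately have "N = M <#> N" by (intro card_seteq) auto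
    then show ?thesis using \<open>M \<subseteq> M <#> N\<close> by blast
  qed
  have "O_pp G p = N"
    unfolding O_pp_def
  proof (rule the_equality)
    show "N \<lhd> G \<and> p_nilpotent (G\<lparr>carrier := N\<rparr>) p \<and> (\<forall>M. M \<lhd> G \<and> p_nilpotent (G\<lparr>carrier := M\<rparr>) p \<longrightarrow> M \<subseteq> N)"
      using N(1) big unfolding F_def by blast
    fix N' assume N': "N' \<lhd> G \<and> p_nilpotent (G\<lparr>carrier := N'\<rparr>) p \<and> (\<forall>M. M \<lhd> G \<and> p_nilpotent (G\<lparr>carrier := M\<rparr>) p \<longrightarrow> M \<subseteq> N')"
    then have "N' \<in> F" unfolding F_def by blast
    moreover have "N \<subseteq> N'" using N' N(1) unfolding F_def by blast
    ultimately show "N' = N" using big by blast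
  qed
  moreover have "N \<lhd> G" using N(1) unfolding F_def by blast
  ultimately show "O_pp G p \<lhd> G" "\<exists>K. p_nilpotent_normal p (O_pp G p) K"
    "\<And>M K. M \<lhd> G \<Longrightarrow> p_nilpotent_normal p M K \<Longrightarrow> M \<subseteq> O_pp G p"
    using N(1) big p_nilpotent_iff[OF p] unfolding F_def by auto
qed

text \<open>Let X = O^{q'}(G). The index of O_{p',p}(G) is prime to q iff X lies in O_{p',p}(G), iff
  X is p-nilpotent, iff O^p(X) has order prime to p.\<close>

lemma hawkes_graph_edge_iff:
  "(p, q) \<in> snd (hawkes_graph G) \<longleftrightarrow> p \<in> prime_set G \<and> prime q \<and>
    (\<exists>z \<in> pp_core G (carrier G) p q. p_elem G p z \<and> z \<noteq> \<one>)"
proof -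
  have main: "q dvd card (carrier G) div card (O_pp G p) \<longleftrightarrow> (\<exists>z \<in> pp_core G (carrier G) p q. p_elem G p z \<and> z \<noteq> \<one>)"
    if p: "prime p" and q: "prime q"
  proof -
    let ?O = "O_pp G p" and ?X = "q_gen G (carrier G) q" and ?D = "pp_core G (carrier G) p q"
    note O = O_pp_properties[OF p]
    have sO: "subgroup ?O G" using normal_imp_subgroup[OF O(1)] .
    have sX: "subgroup ?X G" by (rule q_gen_subgroup)
    have sD: "subgroup ?D G" by (rule pp_core_subgroup)
    have nX: "?X \<lhd> G" using normal_iff_conj_stab sX q_gen_conj[OF subgroup_self] by blast
    have nD: "?D \<lhd> G" using normal_iff_conj_stab sD pp_core_conj[OF subgroup_self] by blast
    show ?thesis
    proof
      assume qd: "q dvd card (carrier G) div card ?O"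
      show "\<exists>z \<in> ?D. p_elem G p z \<and> z \<noteq> \<one>"
      proof (rule ccontr)
        assume no: "\<not> (\<exists>z \<in> ?D. p_elem G p z \<and> z \<noteq> \<one>)"
        then have nd: "\<not> p dvd card ?D" using cauchy_p_elem[OF p sD] by blast
        have DX: "?D \<subseteq> ?X" by (rule pp_core_le)
        obtain c where c: "card ?X = card ?D * c" using sub_card_dvd[OF sX sD DX] by blast
        have "c > 0" using c card_sub_pos[OF sX] by (metis gr0I mult_0_right less_not_refl)
        have "\<exists>k. c = p ^ k"
        proof (rule prime_power_if_only_prime_divisor[OF \<open>c > 0\<close> p])
          fix s assume s: "prime s" "s dvd c"
          show "s = p"
          proof (rule ccontr)
            assume "s \<noteq> p"
            then have "\<not> s dvd card ?X div card ?D"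
              using pp_core_mem p_elem_imp_pp_elem[OF _ p s(1)] by (intro coprime_index_if_p_elems_in[OF s(1) sX sD DX]) blast
            then show False using c s card_sub_pos[OF sD] by simp
          qed
        qed
        then have "p_nilpotent_normal p ?X ?D" unfolding p_nilpotent_normal_def using nD DX nd c by blast
        then have "?X \<subseteq> ?O" using O(3)[OF nX] by blast
        then have "\<not> q dvd card (carrier G) div card ?O"
          using q_gen_mem subgroup.subset[OF sO] by (intro coprime_index_if_p_elems_in[OF q subgroup_self sO]) blast+
        then show False using qd by blast
      qed
    next
      assume "\<exists>z \<in> ?D. p_elem G p z \<and> z \<noteq> \<one>"
      then obtain z where z: "z \<in> ?D" "p_elem G p z" "z \<noteq> \<one>" by blast
      show "q dvd card (carrier G) div card ?O"
      proof (rule ccontr)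
        assume nd: "\<not> q dvd card (carrier G) div card ?O"
        have "?X \<subseteq> ?O" unfolding q_gen_def
          using p_elem_in_normal_of_coprime_index[OF q O(1) nd] by (intro generate_subgroup_incl[OF _ sO]) blast
        obtain K k where K: "K \<lhd> G" "K \<subseteq> ?O" "\<not> p dvd card K" "card ?O = card K * p ^ k"
          using O(2) unfolding p_nilpotent_normal_def by blast
        have sK: "subgroup K G" using normal_imp_subgroup[OF K(1)] .
        have st: "?O \<subseteq> conj_stab G K" using K(1) normal_iff_conj_stab subgroup.subset[OF sO] by blast
        have "?D \<subseteq> K" unfolding pp_core_def
          using pp_elem_in_p_power_index[OF p sO sK K(2) st K(4)] \<open>?X \<subseteq> ?O\<close>
          by (intro generate_subgroup_incl[OF _ sK]) blast
        then have "pp_elem G p z" using pp_elem_if_coprime_card[OF p sK K(3)] z(1) by blast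
        then show False using p_elem_and_pp_elem z by blast
      qed
    qed
  qed
  show ?thesis
    unfolding hawkes_graph_def prime_divs_def prime_set_def order_def using main by auto
qed

section \<open>Nilpotency and the N-critical graph\<close>

lemma p_group_center:
  assumes p: "prime p" and ord: "card (carrier G) = p ^ k" "carrier G \<noteq> {\<one>}"
  obtains z where "z \<in> carrier G" "z \<noteq> \<one>" "\<And>g. g \<in> carrier G \<Longrightarrow> g \<otimes> z = z \<otimes> g"
proof -
  let ?F = "{z \<in> carrier G. \<forall>g\<in>carrier G. conj g z = z}"
  have "[card (carrier G) = card ?F] (mod p)"
    using p_group_fixed_points_act[of "carrier G" p "carrier G" k "\<lambda>g x. conj g x"] p ord(1) subgroup_self
    by (simp add: conj_conj)
  moreover have "k \<noteq> 0"
  proof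
    assume "k = 0"
    then have "card (carrier G) = 1" using ord by simp
    then show False using ord(2) one_closed by (metis card_1_singletonE singletonD)
  qed
  then have "p dvd card (carrier G)" using ord by simp
  ultimately have pd: "p dvd card ?F" by (simp add: cong_dvd_iff)
  have "\<exists>z\<in>?F. z \<noteq> \<one>"
  proof (rule ccontr)
    assume "\<not> (\<exists>z\<in>?F. z \<noteq> \<one>)"
    then have "?F \<subseteq> {\<one>}" by blast
    moreover have "\<one> \<in> ?F" by simp
    ultimately have "?F = {\<one>}" by blast
    then have "card ?F = 1" by simp
    then show False using pd prime_gt_1_nat[OF p] by simp
  qed
  then obtain z where z: "z \<in> carrier G" "z \<noteq> \<one>" "\<forall>g\<in>carrier G. conj g z = z" by blast
  have "g \<otimes> z = z \<otimes> g" if "g \<in> carrier G" for g using conj_eq_iff_comm(1)[OF that z(1)] z(3) that by blast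
  then show ?thesis using that z by blast
qed

text \<open>g represents a nontrivial central element of the p-group R modulo its intersection with
  N.\<close>

lemma p_group_center_mod:
  assumes p: "prime p" and R: "subgroup R G" "card R = p ^ k" and N: "N \<lhd> G" "\<not> R \<subseteq> N"
  obtains g where "g \<in> R" "g \<notin> N" "\<And>h. h \<in> R \<Longrightarrow> comm g h \<in> N"
proof -
  let ?H = "G\<lparr>carrier := R\<rparr>"
  interpret H: fin_group ?H using sub_fin_group[OF R(1)] .
  let ?N = "R \<inter> N"
  have nN: "?N \<lhd> ?H" using normal_Int_subgroup[OF R(1) N(1)] by (simp add: Int_commute)
  interpret nN: normal ?N ?H by (rule nN)
  let ?Q = "?H Mod ?N"
  interpret Q: group ?Q by (rule nN.factorgroup_is_group)
  have carQ: "carrier ?Q = (\<lambda>a. ?N #>\<^bsub>?H\<^esub> a) ` R" using carrier_FactGroup[of ?H ?N] by simp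
  interpret Q: fin_group ?Q by unfold_locales (simp add: carQ R(1))
  interpret \<pi>: group_hom ?H ?Q "\<lambda>a. ?N #>\<^bsub>?H\<^esub> a" using nN.r_coset_hom_Mod by unfold_locales
  have sN: "subgroup ?N ?H" by (rule normal_imp_subgroup[OF nN])
  have ker: "?N #>\<^bsub>?H\<^esub> a = \<one>\<^bsub>?Q\<^esub> \<longleftrightarrow> a \<in> ?N" if "a \<in> R" for a
    using that H.coset_join1[of ?N a] H.coset_join2[of a ?N] sN by auto
  have "card (carrier ?Q) dvd card R"
    using H.lagrange[OF sN] unfolding FactGroup_def order_def by (simp; metis dvd_triv_left)
  then obtain j where j: "card (carrier ?Q) = p ^ j" using R(2) divides_primepow_nat[OF p] by metis
  have ntriv: "carrier ?Q \<noteq> {\<one>\<^bsub>?Q\<^esub>}"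
  proof
    assume "carrier ?Q = {\<one>\<^bsub>?Q\<^esub>}"
    then have "?N #>\<^bsub>?H\<^esub> a = \<one>\<^bsub>?Q\<^esub>" if "a \<in> R" for a using carQ that by blast
    then have "R \<subseteq> N" using ker by blast
    then show False using N by blast
  qed
  obtain z where z: "z \<in> carrier ?Q" "z \<noteq> \<one>\<^bsub>?Q\<^esub>" "\<And>g. g \<in> carrier ?Q \<Longrightarrow> g \<otimes>\<^bsub>?Q\<^esub> z = z \<otimes>\<^bsub>?Q\<^esub> g"
    using Q.p_group_center[OF p j ntriv] by blast
  obtain g where g: "g \<in> R" "z = ?N #>\<^bsub>?H\<^esub> g" using z(1) carQ by blast
  have "g \<notin> N" using z(2) ker g by blast
  moreover have "comm g h \<in> N" if h: "h \<in> R" for h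
  proof -
    let ?c = "g \<otimes>\<^bsub>?H\<^esub> h \<otimes>\<^bsub>?H\<^esub> inv\<^bsub>?H\<^esub> g \<otimes>\<^bsub>?H\<^esub> inv\<^bsub>?H\<^esub> h"
    have c: "g \<in> carrier ?H" "h \<in> carrier ?H" using g h by auto
    let ?y = "?N #>\<^bsub>?H\<^esub> h"
    have y: "?y \<in> carrier ?Q" using carQ h by blast
    have "?N #>\<^bsub>?H\<^esub> ?c = z \<otimes>\<^bsub>?Q\<^esub> ?y \<otimes>\<^bsub>?Q\<^esub> inv\<^bsub>?Q\<^esub> z \<otimes>\<^bsub>?Q\<^esub> inv\<^bsub>?Q\<^esub> ?y"
      unfolding g(2) using c by (simp only: \<pi>.hom_mult \<pi>.hom_inv H.inv_closed H.m_closed)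
    also have "\<dots> = \<one>\<^bsub>?Q\<^esub>" using Q.conj_eq_iff_comm(2)[OF z(1) y] z(3)[OF y] by metis
    finally have "?c \<in> ?N" using ker[of ?c] H.m_closed H.inv_closed c by (metis partial_object.select_convs(1) partial_object.surjective partial_object.update_convs(1))
    then show ?thesis using g(1) h m_inv_consistent[OF R(1)] by simp
  qed
  ultimately show ?thesis using that g(1) by blast
qed

text \<open>Every normal N is shown to contain a term of the lower central series, by passing from N
  to the preimage M of Z(G/N): if a term lies in M, the next one lies in N. M is larger than N
  because some Sylow subgroup outside N has an element g not in N that is central in it modulo N,
  and g commutes with the elements of other prime power orders.\<close>

lemma nilpotent_if_coprime_commute:
  assumes com: "\<And>r s x y. prime r \<Longrightarrow> prime s \<Longrightarrow> r \<noteq> s \<Longrightarrow> p_elem G r x \<Longrightarrow> p_elem G s y \<Longrightarrow> x \<otimes> y = y \<otimes> x"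
  shows "nilpotent G"
proof -
  have "\<exists>n. lower_central G n \<subseteq> N" if "N \<lhd> G" for N
    using that
  proof (induction "card (carrier G) - card N" arbitrary: N rule: less_induct)
    case less
    note N = less.prems
    have sN: "subgroup N G" using normal_imp_subgroup[OF N] .
    show ?case
    proof (cases "N = carrier G")
      case True
      then show ?thesis by (intro exI[of _ 0]) simp
    next
      case False
      then have "\<not> carrier G \<subseteq> N" using subgroup.subset[OF sN] by blast
      then obtain r x where r: "prime r" "p_elem G r x" "x \<notin> N"
        using subgroup_contains_if_p_elems[OF subgroup_self sN] by blast
      obtain R where R: "subgroup R G" "R \<subseteq> carrier G" "card R = r ^ multiplicity r (card (carrier G))"
        using sylow_exists[OF r(1) subgroup_self] .
      have "\<not> R \<subseteq> N" using sylow_normal_contains_p_elems[OF r(1) N R(1) _ R(3) r(2)] r(3) by blast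
      then obtain g where g: "g \<in> R" "g \<notin> N" "\<And>h. h \<in> R \<Longrightarrow> comm g h \<in> N"
        using p_group_center_mod[OF r(1) R(1,3) N] by blast
      have gc: "g \<in> carrier G" using g(1) R(2) by blast
      have gr: "p_elem G r g" using p_group_p_elem[OF R(1,3) g(1)] .
      let ?M = "central_mod G (carrier G) N"
      have nM: "?M \<lhd> G" using central_mod_normal[OF N normal_self] .
      have sM: "subgroup ?M G" using normal_imp_subgroup[OF nM] .
      have NM: "N \<subseteq> ?M" unfolding central_mod_def
        using normal_comm_closed[OF N] subgroup.mem_carrier[OF sN] by blast
      have "carrier G \<subseteq> {m \<in> carrier G. comm g m \<in> N}"
      proof (rule generate_sylow_and_coprime[OF r(1) subgroup_self R comm_preimage_subgroup[OF N gc]])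
        show "R \<subseteq> {m \<in> carrier G. comm g m \<in> N}" using g(3) R(2) by blast
        fix s y assume s: "prime s" "s \<noteq> r" "p_elem G s y" "y \<in> carrier G"
        have "comm g y = \<one>" using com[OF r(1) s(1) _ gr s(3)] s(2) conj_eq_iff_comm(2)[OF gc s(4)] by blast
        then show "y \<in> {m \<in> carrier G. comm g m \<in> N}" using subgroup.one_closed[OF sN] s(4) by simp
      qed
      then have "g \<in> ?M" unfolding central_mod_def using gc by blast
      then have "card N < card ?M" using NM g(2) finite_sub[OF sM] by (intro psubset_card_mono) auto
      moreover have "card ?M \<le> card (carrier G)" using subgroup.subset[OF sM] by (intro card_mono) auto
      ultimately have "card (carrier G) - card ?M < card (carrier G) - card N" by linarith
      then obtain n where n: "lower_central G n \<subseteq> ?M" using less.hyps[OF _ nM] by blast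
      have "comm_set G (lower_central G n) (carrier G) \<subseteq> N"
        using n unfolding comm_set_def central_mod_def by blast
      then have "lower_central G (Suc n) \<subseteq> N" using generate_subgroup_incl[OF _ sN] by simp
      then show ?thesis by blast
    qed
  qed
  then obtain n where n: "lower_central G n \<subseteq> {\<one>}" using one_is_normal by blast
  have "\<one> \<in> lower_central G n" by (cases n) (auto intro: generate.one)
  then show ?thesis unfolding nilpotent_def using n by blast
qed

text \<open>Induction from the trivial end of the lower central series: for v in P and in some term,
  [v, x] is in P and in the next term, so it commutes with x, and \<open>stable_commute\<close>
  gives the same for v.\<close>

lemma nilpotent_coprime_commute:
  assumes nil: "nilpotent G" and p: "prime p" "prime q" "p \<noteq> q"
    and P: "subgroup P G" "\<And>u. u \<in> P \<Longrightarrow> p_elem G p u" and x: "p_elem G q x" "x \<in> conj_stab G P" and u: "u \<in> P"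
  shows "x \<otimes> u = u \<otimes> x"
proof -
  have xc: "x \<in> carrier G" using x(1) by (rule p_elem_in_carrier)
  obtain n where n: "lower_central G n = {\<one>}" using nil unfolding nilpotent_def by blast
  have "x \<otimes> v = v \<otimes> x" if "j \<le> n" "v \<in> P" "v \<in> lower_central G (n - j)" for j v
    using that
  proof (induction j arbitrary: v)
    case 0
    then have "v = \<one>" using n by simp
    then show ?case using xc by simp
  next
    case (Suc j)
    have vc: "v \<in> carrier G" using subgroup.mem_carrier[OF P(1) Suc.prems(2)] .
    have e: "n - j = Suc (n - Suc j)" using Suc.prems(1) by simp
    have "comm v x \<in> comm_set G (lower_central G (n - Suc j)) (carrier G)"
      unfolding comm_set_def using Suc.prems(3) xc by blast
    then have 1: "comm v x \<in> lower_central G (n - j)" unfolding e by (simp add: generate.incl)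
    have "v \<otimes> conj x (inv v) \<in> P"
      using Suc.prems(2) x(2) subgroup.m_closed[OF P(1)] subgroup.m_inv_closed[OF P(1)] unfolding conj_stab_def by blast
    then have 2: "comm v x \<in> P" using vc xc by (simp add: grp_word)
    have "x \<otimes> comm v x = comm v x \<otimes> x" using Suc.IH[OF _ 2 1] Suc.prems(1) by simp
    then show ?case using stable_commute[OF p vc x(1) P(2)[OF 2]] by blast
  qed
  from this[of n u] u subgroup.mem_carrier[OF P(1) u] show ?thesis by simp
qed

lemma nilpotent_if_p_group:
  assumes p: "prime p" and all: "\<And>r. prime r \<Longrightarrow> r dvd card (carrier G) \<Longrightarrow> r = p"
  shows "nilpotent G"
proof (rule nilpotent_if_coprime_commute)
  fix r s x y assume rs: "prime r" "prime s" "r \<noteq> s" and xy: "p_elem G r x" "p_elem G s y"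
  have triv: "z = \<one>" if t: "prime t" "t \<noteq> p" "p_elem G t z" for t z
  proof (rule ccontr)
    assume "z \<noteq> \<one>"
    then have "t dvd card (carrier G)"
      using p_elem_prime_dvd[OF t(1) subgroup_self p_elem_in_carrier[OF t(3)] t(3)] by blast
    then show False using all t by blast
  qed
  have "x = \<one> \<or> y = \<one>" using triv[OF rs(1) _ xy(1)] triv[OF rs(2) _ xy(2)] rs(3) by blast
  then show "x \<otimes> y = y \<otimes> x" using xy p_elem_in_carrier by auto
qed

text \<open>If all q-elements of the Schmidt group centralised its normal Sylow p-subgroup, elements
  of distinct prime power orders would commute and the group would be nilpotent. A group of prime
  power order is nilpotent too, so p and q differ.\<close>

lemma ncrit_edge_imp:
  assumes e: "(p, q) \<in> snd (ncrit_graph G)"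
  shows "p \<noteq> q" "\<exists>P x u. subgroup P G \<and> (\<forall>u\<in>P. p_elem G p u) \<and> p_elem G q x \<and> x \<in> conj_stab G P \<and> u \<in> P \<and> x \<otimes> u \<noteq> u \<otimes> x"
proof -
  obtain S where S: "subgroup S G" "schmidt_pq_group (G\<lparr>carrier := S\<rparr>) p q"
    and pq: "prime p" "prime q"
    using e unfolding ncrit_graph_def prime_set_def by auto
  let ?S = "G\<lparr>carrier := S\<rparr>"
  interpret S: fin_group ?S using sub_fin_group[OF S(1)] .
  have nn: "\<not> nilpotent ?S" using S(2) unfolding schmidt_pq_group_def schmidt_group_def by blast
  have ps: "r = p \<or> r = q" if "prime r" "r dvd card S" for r
  proof -
    have "r \<in> prime_set ?S" unfolding prime_set_def order_def using that by simp
    then show ?thesis using S(2) unfolding schmidt_pq_group_def by auto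
  qed
  show pneq: "p \<noteq> q" using S.nilpotent_if_p_group[OF pq(1)] nn ps by auto
  obtain P where P: "subgroup P ?S" "card P = p ^ multiplicity p (card S)" "P \<lhd> ?S"
    using S(2) unfolding schmidt_pq_group_def sylow_subgroup_def order_def by auto
  have sP: "subgroup P G" using incl_subgroup[OF S(1) P(1)] .
  have PS: "P \<subseteq> S" using subgroup.subset[OF P(1)] by simp
  have st: "S \<subseteq> conj_stab G P"
    using S.normal_invE(2)[OF P(3)] m_inv_consistent[OF S(1)] subgroup.mem_carrier[OF S(1)] unfolding conj_stab_def by auto
  have Pel: "p_elem G p u" if "u \<in> P" for u using p_group_p_elem[OF sP P(2) that] .
  have inP: "x \<in> P" if "x \<in> S" "p_elem G p x" for x
    using sylow_overgroup_contains_p_elems[OF pq(1) S(1) sP PS st sP _ P(2) that] by blast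
  have "\<exists>x\<in>S. p_elem G q x \<and> (\<exists>u\<in>P. x \<otimes> u \<noteq> u \<otimes> x)"
  proof (rule ccontr)
    assume no: "\<not> (\<exists>x\<in>S. p_elem G q x \<and> (\<exists>u\<in>P. x \<otimes> u \<noteq> u \<otimes> x))"
    have "nilpotent ?S"
    proof (rule S.nilpotent_if_coprime_commute)
      fix r s x y assume rs: "prime r" "prime s" "r \<noteq> s" and "p_elem ?S r x" "p_elem ?S s y"
      then have xy: "p_elem G r x" "x \<in> S" "p_elem G s y" "y \<in> S" using p_elem_restrict[OF S(1)] by auto
      have c: "x \<in> carrier G" "y \<in> carrier G" using xy p_elem_in_carrier by auto
      have "x \<otimes> y = y \<otimes> x"
      proof (cases "x = \<one> \<or> y = \<one>")
        case True
        then show ?thesis using c by auto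
      next
        case False
        then have "r dvd card S" "s dvd card S" using p_elem_prime_dvd[OF _ S(1)] rs xy by blast+
        then consider "r = p" "s = q" | "r = q" "s = p" using ps rs by blast
        then show ?thesis using no xy inP by cases metis+
      qed
      then show "x \<otimes>\<^bsub>?S\<^esub> y = y \<otimes>\<^bsub>?S\<^esub> x" by simp
    qed
    then show False using nn by blast
  qed
  then show "\<exists>P x u. subgroup P G \<and> (\<forall>u\<in>P. p_elem G p u) \<and> p_elem G q x \<and> x \<in> conj_stab G P \<and> u \<in> P \<and> x \<otimes> u \<noteq> u \<otimes> x"
    using sP Pel st by blast
qed

text \<open>A non-nilpotent subgroup S of P<x> of least order is a Schmidt group, and only p and q
  can divide its order. P contains all p-elements of P<x>, so S meets P in a normal Sylow p-subgroup
  of S.\<close>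

lemma ncrit_edgeI:
  assumes p: "prime p" "prime q" "p \<noteq> q"
    and P: "subgroup P G" "\<And>u. u \<in> P \<Longrightarrow> p_elem G p u" and x: "p_elem G q x" "x \<in> conj_stab G P"
    and u: "u \<in> P" "x \<otimes> u \<noteq> u \<otimes> x"
  shows "(p, q) \<in> snd (ncrit_graph G)"
proof -
  have xc: "x \<in> carrier G" using x(1) by (rule p_elem_in_carrier)
  let ?Q = "generate G {x}"
  have sQ: "subgroup ?Q G" using generate_is_subgroup xc by simp
  have Qst: "?Q \<subseteq> conj_stab G P" using generate_subgroup_incl[OF _ conj_stab_subgroup[OF P(1)]] x(2) by simp
  have perm: "P <#> ?Q = ?Q <#> P"
  proof
    show "P <#> ?Q \<subseteq> ?Q <#> P"
    proof
      fix z assume "z \<in> P <#> ?Q"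
      then obtain a b where ab: "a \<in> P" "b \<in> ?Q" "z = a \<otimes> b" by (rule set_multE)
      have "inv b \<in> conj_stab G P" using subgroup.m_inv_closed[OF sQ ab(2)] Qst by blast
      then have "conj (inv b) a \<in> P" using ab(1) unfolding conj_stab_def by blast
      moreover have "z = b \<otimes> conj (inv b) a"
        using ab subgroup.mem_carrier[OF P(1) ab(1)] subgroup.mem_carrier[OF sQ ab(2)] by (simp add: grp_word)
      ultimately show "z \<in> ?Q <#> P" using ab(2) set_multI by metis
    qed
    show "?Q <#> P \<subseteq> P <#> ?Q"
    proof
      fix z assume "z \<in> ?Q <#> P"
      then obtain b a where ab: "b \<in> ?Q" "a \<in> P" "z = b \<otimes> a" by (rule set_multE)
      have "conj b a \<in> P" using ab(1,2) Qst unfolding conj_stab_def by blast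
      moreover have "z = conj b a \<otimes> b"
        using ab subgroup.mem_carrier[OF P(1) ab(2)] subgroup.mem_carrier[OF sQ ab(1)] by (simp add: grp_word)
      ultimately show "z \<in> P <#> ?Q" using ab(1) set_multI by metis
    qed
  qed
  let ?L = "P <#> ?Q"
  have sL: "subgroup ?L G" using set_mult_permute_subgroup[OF P(1) sQ perm] .
  have PL: "P \<subseteq> ?L" "?Q \<subseteq> ?L" using set_mult_subset_left[OF P(1) sQ] by auto
  have Lst: "?L \<subseteq> conj_stab G P"
    using set_mult_subset_subgroup[OF subgroup_le_conj_stab[OF P(1)] Qst conj_stab_subgroup[OF P(1)]] .
  obtain a b where ab: "card P = p ^ a" "card ?Q = q ^ b"
    using p_group_card[OF p(1) P] cyclic_p_group(1)[OF p(2) x(1)] by blast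
  have cL: "card ?L dvd p ^ a * q ^ b" using card_set_mult[OF P(1) sQ] ab by (metis dvd_triv_left)
  have primes: "r = p \<or> r = q" if "prime r" "r dvd card ?L" for r
  proof -
    have "r dvd p ^ a * q ^ b" using that(2) cL dvd_trans by blast
    then have "r dvd p \<or> r dvd q" using that(1) prime_dvd_mult_iff prime_dvd_power by blast
    then show ?thesis using that(1) p primes_dvd_imp_eq by blast
  qed
  have pP: "y \<in> P" if "y \<in> ?L" "p_elem G p y" for y
  proof -
    have "card ?L div card P dvd q ^ b"
    proof -
      obtain c where c: "card ?L = card P * c" using sub_card_dvd[OF sL P(1) PL(1)] by blast
      then have "card P * (c * card (P \<inter> ?Q)) = card P * q ^ b" using card_set_mult[OF P(1) sQ] ab(2) by (simp add: mult.assoc)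
      then have "c * card (P \<inter> ?Q) = q ^ b" using card_sub_pos[OF P(1)] by simp
      then have "c dvd q ^ b" by (metis dvd_triv_left)
      then show ?thesis using c card_sub_pos[OF P(1)] by simp
    qed
    then have "\<not> p dvd card ?L div card P" using p by (metis dvd_trans prime_dvd_power primes_dvd_imp_eq)
    then show ?thesis using p_elem_in_coprime_index[OF p(1) sL P(1) PL(1) Lst _ that] by blast
  qed
  have xL: "x \<in> ?L" using PL(2) by (meson generate.incl singletonI subsetD)
  have nL: "\<not> nilpotent (G\<lparr>carrier := ?L\<rparr>)"
  proof
    let ?G = "G\<lparr>carrier := ?L\<rparr>"
    interpret L: fin_group ?G using sub_fin_group[OF sL] .
    assume nil: "nilpotent ?G"
    have st: "x \<in> conj_stab ?G P" using x(2) xL m_inv_consistent[OF sL xL] unfolding conj_stab_def by simp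
    have "p_elem ?G q x" using x(1) xL p_elem_restrict[OF sL] by blast
    moreover have "p_elem ?G p v" if "v \<in> P" for v using P(2) that PL p_elem_restrict[OF sL] by blast
    ultimately have "x \<otimes>\<^bsub>?G\<^esub> u = u \<otimes>\<^bsub>?G\<^esub> x"
      using L.nilpotent_coprime_commute[OF nil p subgroup_incl[OF P(1) sL PL(1)] _ _ st u(1)] by blast
    then show False using u(2) by simp
  qed
  define B where "B S \<longleftrightarrow> subgroup S G \<and> S \<subseteq> ?L \<and> \<not> nilpotent (G\<lparr>carrier := S\<rparr>)" for S
  have "B ?L" unfolding B_def using sL nL by blast
  then obtain S where S: "B S" "\<And>S'. B S' \<Longrightarrow> card S \<le> card S'"
    using ex_has_least_nat[of B ?L card] by blast
  have sS: "subgroup S G" and SL: "S \<subseteq> ?L" and nS: "\<not> nilpotent (G\<lparr>carrier := S\<rparr>)" using S(1) unfolding B_def by auto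
  let ?S = "G\<lparr>carrier := S\<rparr>"
  interpret S: fin_group ?S using sub_fin_group[OF sS] .
  have schm: "schmidt_group ?S"
    unfolding schmidt_group_def
  proof (intro conjI allI impI nS)
    fix H assume H: "subgroup H ?S \<and> H \<noteq> carrier ?S"
    have sH: "subgroup H G" using incl_subgroup[OF sS] H by blast
    have "H \<subset> S" using H subgroup.subset[of H ?S] by auto
    then have "card H < card S" using finite_sub[OF sS] by (intro psubset_card_mono) auto
    then have "\<not> B H" using S(2) by (meson not_le)
    then have "nilpotent (G\<lparr>carrier := H\<rparr>)" unfolding B_def using sH \<open>H \<subset> S\<close> SL by blast
    then show "nilpotent (?S\<lparr>carrier := H\<rparr>)" by simp
  qed
  have sub_pr: "r = p \<or> r = q" if "prime r" "r dvd card S" for r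
    using primes[OF that(1)] that(2) sub_card_dvd[OF sL sS SL] dvd_trans by blast
  have pd: "p dvd card S" using S.nilpotent_if_p_group[OF p(2)] sub_pr nS by auto
  have qd: "q dvd card S" using S.nilpotent_if_p_group[OF p(1)] sub_pr nS by auto
  have ps: "prime_set ?S = {p, q}" unfolding prime_set_def order_def using pd qd p sub_pr by auto
  let ?T = "S \<inter> P"
  have sT: "subgroup ?T G" using subgroups_Inter_pair[OF sS P(1)] .
  have TS: "?T \<subseteq> S" by blast
  have "\<not> p dvd card S div card ?T"
    using pP SL by (intro coprime_index_if_p_elems_in[OF p(1) sS sT TS]) blast
  then have cT: "card ?T = p ^ multiplicity p (card S)"
    using p_group_card_iff_sylow[OF p(1) sT TS sS] P(2) by blast
  have TSs: "subgroup ?T ?S" using subgroup_incl[OF sT sS TS] .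
  have "?T \<lhd> ?S"
  proof (rule S.normal_invI[OF TSs])
    fix g h assume g: "g \<in> carrier ?S" and h: "h \<in> ?T"
    have "conj g h \<in> P" using g h SL Lst unfolding conj_stab_def by auto
    moreover have "conj g h \<in> S" using g h sS by (simp add: subgroup.m_closed subgroup.m_inv_closed)
    ultimately show "g \<otimes>\<^bsub>?S\<^esub> h \<otimes>\<^bsub>?S\<^esub> inv\<^bsub>?S\<^esub> g \<in> ?T" using g m_inv_consistent[OF sS] by simp
  qed
  moreover have "sylow_subgroup ?S p ?T" unfolding sylow_subgroup_def order_def using TSs cT by simp
  ultimately have "schmidt_pq_group ?S p q" unfolding schmidt_pq_group_def using schm ps by blast
  moreover have "p \<in> prime_set G" "q \<in> prime_set G"
    unfolding prime_set_def order_def using pd qd p sub_card_dvd_order[OF sS] dvd_trans by blast+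
  ultimately show ?thesis unfolding ncrit_graph_def using sS by auto
qed

section \<open>Passage to the factors and the three inclusions\<close>

lemma conj_stab_restrict:
  "subgroup A G \<Longrightarrow> conj_stab (G\<lparr>carrier := A\<rparr>) T = A \<inter> conj_stab G T"
  unfolding conj_stab_def using subgroup.mem_carrier by (auto simp: m_inv_consistent)

lemma pp_core_restrict:
  assumes A: "subgroup A G"
  shows "pp_core (G\<lparr>carrier := A\<rparr>) A p q = pp_core G A p q"
proof -
  have 1: "{x \<in> A. p_elem (G\<lparr>carrier := A\<rparr>) q x} = {x \<in> A. p_elem G q x}" using p_elem_restrict[OF A] by blast
  have 2: "q_gen (G\<lparr>carrier := A\<rparr>) A q = q_gen G A q" unfolding q_gen_def 1 by (rule generate_consistent[OF _ A]) auto
  have 3: "{x \<in> q_gen G A q. pp_elem (G\<lparr>carrier := A\<rparr>) p x} = {x \<in> q_gen G A q. pp_elem G p x}"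
    using pp_elem_restrict[OF A] q_gen_le[OF A] by blast
  show ?thesis unfolding pp_core_def 2 3 by (rule generate_consistent[OF _ A]) (use q_gen_le[OF A] in auto)
qed

end

context tp_product begin

lemma sub_edge_sylow:
  assumes i: "i < n" and p: "prime p" "prime q" "p \<noteq> q"
    and T: "subgroup T G" "T \<subseteq> Gs i" "card T = p ^ multiplicity p (card (Gs i))"
    and y: "y \<in> Gs i" "p_elem G q y" "y \<in> conj_stab G T" and t: "t \<in> T" "y \<otimes> t \<noteq> t \<otimes> y"
  shows "(p, q) \<in> snd (sylow_graph (G\<lparr>carrier := Gs i\<rparr>))"
proof -
  let ?A = "G\<lparr>carrier := Gs i\<rparr>"
  interpret A: fin_group ?A using sub_fin_group[OF Gs[OF i]] .
  have "t \<noteq> \<one>" using t y p_elem_in_carrier by auto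
  then have "p dvd card (Gs i)"
    using p_elem_prime_dvd[OF p(1) Gs[OF i] _ p_group_p_elem[OF T(1,3) t(1)]] T(2) t(1) by blast
  then have "p \<in> prime_set ?A" unfolding prime_set_def order_def using p(1) by simp
  moreover have "sylow_subgroup ?A p T" unfolding sylow_subgroup_def order_def using T subgroup_incl[OF T(1) Gs[OF i] T(2)] by simp
  moreover have "y \<in> conj_stab ?A T" using conj_stab_restrict[OF Gs[OF i]] y by blast
  moreover have "p_elem ?A q y" using p_elem_restrict[OF Gs[OF i]] y by blast
  ultimately show ?thesis unfolding A.sylow_graph_edge_iff using p t by auto
qed

lemma sylow_graph_subset:
  assumes e: "(p, q) \<in> snd (sylow_graph G)" and nd: "\<not> q dvd p - 1"
  shows "\<exists>i<n. (p, q) \<in> snd (sylow_graph (G\<lparr>carrier := Gs i\<rparr>))"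
proof (rule ccontr)
  assume no: "\<not> (\<exists>i<n. (p, q) \<in> snd (sylow_graph (G\<lparr>carrier := Gs i\<rparr>)))"
  obtain P x u where pq: "p \<in> prime_set G" "prime q" "p \<noteq> q" and P: "sylow_subgroup G p P"
    and x: "x \<in> conj_stab G P" "p_elem G q x" and u: "u \<in> P" "x \<otimes> u \<noteq> u \<otimes> x"
    using e unfolding sylow_graph_edge_iff by blast
  have p: "prime p" using pq(1) unfolding prime_set_def by blast
  have P': "subgroup P G" "card P = p ^ multiplicity p (card (carrier G))" using P unfolding sylow_subgroup_def order_def by auto
  have "x \<otimes> u = u \<otimes> x"
  proof (rule sylow_commute[OF p pq(2,3) nd _ P' x(2,1) u(1)])
    fix i T y t assume "i < n" "subgroup T G" "T \<subseteq> Gs i" "card T = p ^ multiplicity p (card (Gs i))"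
      "y \<in> Gs i" "p_elem G q y" "y \<in> conj_stab G T" "t \<in> T"
    then show "y \<otimes> t = t \<otimes> y" using sub_edge_sylow[of i p q T y t] p pq(2,3) no by blast
  qed
  then show False using u by blast
qed

lemma sub_edge_ncrit:
  assumes i: "i < n" and p: "prime p" "prime q" "p \<noteq> q"
    and T: "subgroup T G" "T \<subseteq> Gs i" "\<And>t. t \<in> T \<Longrightarrow> p_elem G p t"
    and y: "y \<in> Gs i" "p_elem G q y" "y \<in> conj_stab G T" and t: "t \<in> T" "y \<otimes> t \<noteq> t \<otimes> y"
  shows "(p, q) \<in> snd (ncrit_graph (G\<lparr>carrier := Gs i\<rparr>))"
proof -
  let ?A = "G\<lparr>carrier := Gs i\<rparr>"
  interpret A: fin_group ?A using sub_fin_group[OF Gs[OF i]] .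
  have "y \<in> conj_stab ?A T" using conj_stab_restrict[OF Gs[OF i]] y by blast
  moreover have "p_elem ?A q y" using p_elem_restrict[OF Gs[OF i]] y by blast
  moreover have "p_elem ?A p t" if "t \<in> T" for t using p_elem_restrict[OF Gs[OF i]] T that by blast
  ultimately show ?thesis using A.ncrit_edgeI[OF p subgroup_incl[OF T(1) Gs[OF i] T(2)], of y t] t by simp
qed

lemma ncrit_graph_subset:
  assumes e: "(p, q) \<in> snd (ncrit_graph G)" and nd: "\<not> q dvd p - 1"
  shows "\<exists>i<n. (p, q) \<in> snd (ncrit_graph (G\<lparr>carrier := Gs i\<rparr>))"
proof (rule ccontr)
  assume no: "\<not> (\<exists>i<n. (p, q) \<in> snd (ncrit_graph (G\<lparr>carrier := Gs i\<rparr>)))"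
  have p: "prime p" "prime q" using e unfolding ncrit_graph_def prime_set_def by auto
  have pq: "p \<noteq> q" by (rule ncrit_edge_imp(1)[OF e])
  obtain P x u where P: "subgroup P G" "\<forall>u\<in>P. p_elem G p u"
    and x: "p_elem G q x" "x \<in> conj_stab G P" and u: "u \<in> P" "x \<otimes> u \<noteq> u \<otimes> x"
    using ncrit_edge_imp(2)[OF e] by blast
  have "x \<otimes> u = u \<otimes> x"
  proof (rule ncrit_commute[OF p pq nd _ P(1) _ x u(1)])
    fix i T y t assume "i < n" "subgroup T G" "T \<subseteq> Gs i" "\<And>t. t \<in> T \<Longrightarrow> p_elem G p t"
      "y \<in> Gs i" "p_elem G q y" "y \<in> conj_stab G T" "t \<in> T"
    then show "y \<otimes> t = t \<otimes> y" using sub_edge_ncrit[of i p q T y t] p pq no by blast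
  qed (use P in blast)
  then show False using u by blast
qed

lemma hawkes_graph_subset:
  assumes e: "(p, q) \<in> snd (hawkes_graph G)" and nd: "\<not> q dvd p - 1"
  shows "\<exists>i<n. (p, q) \<in> snd (hawkes_graph (G\<lparr>carrier := Gs i\<rparr>))"
proof (rule ccontr)
  assume no: "\<not> (\<exists>i<n. (p, q) \<in> snd (hawkes_graph (G\<lparr>carrier := Gs i\<rparr>)))"
  obtain z where pq: "p \<in> prime_set G" "prime q" and z: "z \<in> pp_core G (carrier G) p q" "p_elem G p z" "z \<noteq> \<one>"
    using e unfolding hawkes_graph_edge_iff by blast
  have p: "prime p" using pq(1) unfolding prime_set_def by blast
  have "z = \<one>"
  proof (rule pp_core_coprime[OF p pq(2) nd _ z(1,2)])
    fix i x assume i: "i < n" and x: "x \<in> pp_core G (Gs i) p q" "p_elem G p x"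
    show "x = \<one>"
    proof (rule ccontr)
      assume x1: "x \<noteq> \<one>"
      let ?A = "G\<lparr>carrier := Gs i\<rparr>"
      interpret A: fin_group ?A using sub_fin_group[OF Gs[OF i]] .
      have xG: "x \<in> Gs i" using x(1) pp_core_le q_gen_le[OF Gs[OF i]] by blast
      have "p \<in> prime_set ?A" unfolding prime_set_def order_def
        using p p_elem_prime_dvd[OF p Gs[OF i] xG x(2) x1] by simp
      moreover have "x \<in> pp_core ?A (carrier ?A) p q" using x(1) pp_core_restrict[OF Gs[OF i]] by simp
      moreover have "p_elem ?A p x" using p_elem_restrict[OF Gs[OF i]] xG x(2) by blast
      ultimately have "(p, q) \<in> snd (hawkes_graph ?A)" unfolding A.hawkes_graph_edge_iff using pq(2) x1 by auto
      then show False using no i by blast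
    qed
  qed
  then show False using z(3) by blast
qed

lemma subgraph_union_pm1:
  fixes \<Gamma> :: "('a, 'b) monoid_scheme \<Rightarrow> graph"
  assumes v: "fst (\<Gamma> G) = prime_set G"
    and e: "\<And>p q. (p, q) \<in> snd (\<Gamma> G) \<Longrightarrow> p \<in> prime_set G \<and> q \<in> prime_set G"
    and s: "\<And>p q. (p, q) \<in> snd (\<Gamma> G) \<Longrightarrow> \<not> q dvd p - 1 \<Longrightarrow> \<exists>i<n. (p, q) \<in> snd (\<Gamma> (G\<lparr>carrier := Gs i\<rparr>))"
  shows "subgraph (\<Gamma> G) (graph_union (graph_Union {..<n} (\<lambda>i. \<Gamma> (G\<lparr>carrier := Gs i\<rparr>))) (pm1_graph G))"
  unfolding subgraph_def
proof
  show "fst (\<Gamma> G) \<subseteq> fst (graph_union (graph_Union {..<n} (\<lambda>i. \<Gamma> (G\<lparr>carrier := Gs i\<rparr>))) (pm1_graph G))"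
    using v by (simp add: graph_union_def pm1_graph_def)
  show "snd (\<Gamma> G) \<subseteq> snd (graph_union (graph_Union {..<n} (\<lambda>i. \<Gamma> (G\<lparr>carrier := Gs i\<rparr>))) (pm1_graph G))"
  proof
    fix a assume a: "a \<in> snd (\<Gamma> G)"
    obtain p q where pq: "a = (p, q)" by (cases a)
    show "a \<in> snd (graph_union (graph_Union {..<n} (\<lambda>i. \<Gamma> (G\<lparr>carrier := Gs i\<rparr>))) (pm1_graph G))"
    proof (cases "q dvd p - 1")
      case True
      have "p \<in> prime_set G" "q \<in> prime_set G" using e a pq by auto
      moreover have "q \<in> prime_divs (p - 1)"
        using True \<open>q \<in> prime_set G\<close> unfolding prime_divs_def prime_set_def by blast
      ultimately show ?thesis using pq by (simp add: graph_union_def pm1_graph_def)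
    next
      case False
      then show ?thesis using s a pq by (auto simp: graph_union_def graph_Union_def)
    qed
  qed
qed

text \<open>In the Sylow and Hawkes graphs q is given only as a prime divisor of a quotient of
  orders, whereas \<open>pm1_graph\<close> asks for q in \<open>prime_set G\<close>.\<close>

lemma edge_in_prime_set:
  "(p, q) \<in> snd (sylow_graph G) \<Longrightarrow> p \<in> prime_set G \<and> q \<in> prime_set G"
  "(p, q) \<in> snd (hawkes_graph G) \<Longrightarrow> p \<in> prime_set G \<and> q \<in> prime_set G"
  "(p, q) \<in> snd (ncrit_graph G) \<Longrightarrow> p \<in> prime_set G \<and> q \<in> prime_set G"
proof -
  have mem: "q \<in> prime_set G" if "prime q" "p_elem G q x" "x \<noteq> \<one>" for x
    using p_elem_prime_dvd[OF that(1) subgroup_self p_elem_in_carrier[OF that(2)] that(2,3)] that(1)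
    unfolding prime_set_def order_def by blast
  show "p \<in> prime_set G \<and> q \<in> prime_set G" if "(p, q) \<in> snd (sylow_graph G)"
  proof -
    from that[unfolded sylow_graph_edge_iff]
    obtain P x u where x: "p \<in> prime_set G" "prime q" "p_elem G q x" "sylow_subgroup G p P" "u \<in> P" "x \<otimes> u \<noteq> u \<otimes> x"
      by fast
    then have "u \<in> carrier G" unfolding sylow_subgroup_def using subgroup.mem_carrier by metis
    then have "x \<noteq> \<one>" using x(6) by auto
    then show ?thesis using mem x by blast
  qed
  show "p \<in> prime_set G \<and> q \<in> prime_set G" if "(p, q) \<in> snd (hawkes_graph G)"
  proof -
    have p: "p \<in> prime_set G" "prime q" "q dvd card (carrier G) div card (O_pp G p)"
      using that unfolding hawkes_graph_def prime_divs_def order_def by auto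
    then have "prime p" unfolding prime_set_def by blast
    then have "subgroup (O_pp G p) G" using O_pp_properties(1) normal_imp_subgroup by blast
    then have "card (carrier G) div card (O_pp G p) dvd card (carrier G)"
      using sub_card_dvd_order by (metis dvd_div_mult_self dvd_triv_left)
    then show ?thesis using p dvd_trans unfolding prime_set_def order_def by blast
  qed
  show "p \<in> prime_set G \<and> q \<in> prime_set G" if "(p, q) \<in> snd (ncrit_graph G)"
    using that unfolding ncrit_graph_def by auto
qed

end

theorem theorem2:
  fixes G :: "('a, 'b) monoid_scheme" and Gs :: "nat \<Rightarrow> 'a set" and n :: nat
  assumes "group G" and "finite (carrier G)"
    and "\<And>i. i < n \<Longrightarrow> subgroup (Gs i) G"
    and "\<And>i j. i < n \<Longrightarrow> j < n \<Longrightarrow> i \<noteq> j \<Longrightarrow> totally_permutable G (Gs i) (Gs j)"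
    and "carrier G = prod_sets G Gs n"
  shows "subgraph (sylow_graph G)
           (graph_union (graph_Union {..<n} (\<lambda>i. sylow_graph (G\<lparr>carrier := Gs i\<rparr>))) (pm1_graph G)) \<and>
         subgraph (hawkes_graph G)
           (graph_union (graph_Union {..<n} (\<lambda>i. hawkes_graph (G\<lparr>carrier := Gs i\<rparr>))) (pm1_graph G)) \<and>
         subgraph (ncrit_graph G)
           (graph_union (graph_Union {..<n} (\<lambda>i. ncrit_graph (G\<lparr>carrier := Gs i\<rparr>))) (pm1_graph G))"
proof -
  interpret tp_product G Gs n
    using assms by (simp add: tp_product_def tp_product_axioms_def fin_group_def fin_group_axioms_def)
  show ?thesis
    by (intro conjI subgraph_union_pm1 edge_in_prime_set sylow_graph_subset hawkes_graph_subset ncrit_graph_subset)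
      (simp_all add: sylow_graph_def hawkes_graph_def ncrit_graph_def)
qed

end
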